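(* Let $\mathbb{K}$ be a complete ultrametric field, $E$ be a locally convex topological $\mathbb{K}$-vector space, $n\in\mathbb{N}$ and $U\subseteq\mathbb{K}^n$ be a locally closed, locally cartesian subset. Then the space $\mathrm{Pol}(U,E)$ of all $E$-valued polynomial functions on $U$ is dense in $C^r(U,E)$, for each $r\in\mathbb{N}_0\cup\{\infty\}$. Moreover, $\mathrm{Pol}(U,E)$ is dense in $C^\alpha(U,E)$, for each $\alpha\in(\mathbb{N}_0\cup\{\infty\})^n$.
   Context: An ultrametric field is a field $\mathbb{K}$ with an absolute value satisfying the ultrametric inequality and defining a non-discrete topology; complete means complete for the metric $|x-y|$. All topological vector spaces are Hausdorff. A topological $\mathbb{K}$-vector space is locally convex if its open $\mathbb{O}$-submodules form a basis of $0$-neighbourhoods, $\mathbb{O}=\{z\in\mathbb{K}:|z|\le1\}$ (equivalently, its topology is defined by ultrametric seminorms). $\mathbb{N}_0=\{0,1,\ldots\}$. $\mathrm{Pol}(U,E)$ is the space of functions $p\colon U\to E$ of the form $p(x)=\sum_\beta x^\beta a_\beta$ with a finite family of $a_\beta\in E$, $\beta\in\mathbb{N}_0^n$, $x^\beta=x_1^{\beta_1}\cdots x_n^{\beta_n}$. A subset $Y$ of a topological space $X$ is locally closed if for each $x\in Y$ and each neighbourhood $W\subseteq Y$ of $x$ (in the induced topology) there is a neighbourhood $V\subseteq W$ of $x$ in $Y$ which is closed in $X$. A subset $U\subseteq\mathbb{K}^n$ is cartesian if $U=U_1\times\cdots\times U_n$ with subsets $U_i\subseteq\mathbb{K}$ without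 isolated points; it is locally cartesian if every point of $U$ has a relatively open neighbourhood in $U$ which is cartesian. Let $U=U_1\times\cdots\times U_n$ be cartesian, $f\colon U\to E$ and $\beta\in\mathbb{N}_0^n$. Put $U^{<\beta>}:=U_1^{1+\beta_1}\times\cdots\times U_n^{1+\beta_n}$, with elements $x=(x^{(1)},\ldots,x^{(n)})$, $x^{(i)}=(x^{(i)}_0,\ldots,x^{(i)}_{\beta_i})$, and let $U^{>\beta<}$ be the (dense, open) set of $x\in U^{<\beta>}$ with $x^{(i)}_j\ne x^{(i)}_k$ for all $i$ and $0\le j<k\le\beta_i$. Define \[ f^{>\beta<}(x)=\sum_{j_1=0}^{\beta_1}\cdots\sum_{j_n=0}^{\beta_n}\Big(\prod_{i=1}^n\ \prod_{k_i\in\{0,\ldots,\beta_i\}\setminus\{j_i\}}\frac{1}{x^{(i)}_{j_i}-x^{(i)}_{k_i}}\Big)f(x^{(1)}_{j_1},\ldots,x^{(n)}_{j_n}) \] for $x\in U^{>\beta<}$ (empty products are $1$). For $\alpha\in(\mathbb{N}_0\cup\{\infty\})^n$, $f$ is $C^\alpha$ if for every $\beta\in\mathbb{N}_0^n$ with $\beta\le\alpha$ (componentwise) $f^{>\beta<}$ has a (unique) continuous extension $f^{<\beta>}\colon U^{<\beta>}\to E$. If $U$ is only locally cartesian, $f$ is $C^\alpha$ if $f|_V$ is $C^\alpha$ for each cartesian relatively open $V\subseteq U$. The space $C^\alpha(U,E)$ of $C^\alpha$-maps carries the initial topology with respect to the maps $f\mapsto(f|_V)^{<\beta>}\in C(V^{<\beta>},E)$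 (compact-open topology on the target) for all $\beta\le\alpha$ in $\mathbb{N}_0^n$ and cartesian relatively open $V\subseteq U$. For $r\in\mathbb{N}_0\cup\{\infty\}$, $f$ is $C^r$ if it is $C^\alpha$ for all $\alpha\in\mathbb{N}_0^n$ with $|\alpha|=\alpha_1+\cdots+\alpha_n\le r$; $C^r(U,E)$ carries the initial topology with respect to the inclusion maps $C^r(U,E)\to C^\alpha(U,E)$ for these $\alpha$. *)

theory Defs
  imports "HOL-Analysis.Analysis"
begin

section \<open>Ultrametric fields and locally convex spaces\<close>

text \<open>
  The library's \<open>norm\<close> is only usable at sort \<open>real_normed_vector\<close>, hence a separate
  constant for the absolute value. That it is nonnegative and vanishes only at 0 follows
  from \<open>dist_absval\<close> and the axioms of a metric space.
\<close>

class ultrametric_field = field + metric_space +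
  fixes absval :: "'a \<Rightarrow> real"
  assumes dist_absval: "dist x y = absval (x - y)"
    and absval_mult: "absval (x * y) = absval x * absval y"
    and absval_add_le_max: "absval (x + y) \<le> max (absval x) (absval y)"
    and nondiscrete: "\<exists>S. \<not> open S"

class complete_ultrametric_field = ultrametric_field + complete_space

text \<open>The Hausdorff property of vector spaces is carried by the sort \<open>t2_space\<close>.\<close>

locale topological_vector_space = vector_space smul
  for smul :: "'k::ultrametric_field \<Rightarrow> 'e::{topological_ab_group_add,t2_space} \<Rightarrow> 'e" +
  assumes continuous_smul: "continuous_on UNIV (\<lambda>(c, x). smul c x)"

definition ball_submodule ::
    "('k::ultrametric_field \<Rightarrow> 'e::ab_group_add \<Rightarrow> 'e) \<Rightarrow> 'e set \<Rightarrow> bool" where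
  "ball_submodule smul M \<longleftrightarrow>
     0 \<in> M \<and> (\<forall>x\<in>M. \<forall>y\<in>M. x + y \<in> M) \<and> (\<forall>c. \<forall>x\<in>M. absval c \<le> 1 \<longrightarrow> smul c x \<in> M)"

locale locally_convex_space = topological_vector_space smul
  for smul :: "'k::ultrametric_field \<Rightarrow> 'e::{topological_ab_group_add,t2_space} \<Rightarrow> 'e" +
  assumes locally_convex:
    "\<And>W. open W \<Longrightarrow> 0 \<in> W \<Longrightarrow> \<exists>M. open M \<and> ball_submodule smul M \<and> M \<subseteq> W"

section \<open>Cartesian and locally cartesian sets\<close>

definition box_of :: "('n \<Rightarrow> 'k set) \<Rightarrow> ('k ^ 'n) set" where
  "box_of A = {x. \<forall>i. x $ i \<in> A i}"

definition no_isolated_points :: "'k::topological_space set \<Rightarrow> bool" where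
  "no_isolated_points S \<longleftrightarrow> \<not> (\<exists>x. x isolated_in S)"

definition cartesian :: "('k::topological_space ^ 'n::finite) set \<Rightarrow> bool" where
  "cartesian V \<longleftrightarrow> (\<exists>A. (\<forall>i. no_isolated_points (A i)) \<and> V = box_of A)"

definition locally_cartesian :: "('k::topological_space ^ 'n::finite) set \<Rightarrow> bool" where
  "locally_cartesian U \<longleftrightarrow>
     (\<forall>x\<in>U. \<exists>V. openin (top_of_set U) V \<and> x \<in> V \<and> cartesian V)"

text \<open>
  The cartesian relatively open subsets of \<open>U\<close>, presented by their families of factors.
  A nonempty box determines its factors; for an empty box the choice of factors is
  irrelevant because \<open>multi_pow A \<beta>\<close> below is then empty too.
\<close>

definition cartesian_charts ::
    "('k::topological_space ^ 'n::finite) set \<Rightarrow> ('n \<Rightarrow> 'k set) set" where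
  "cartesian_charts U =
     {A. (\<forall>i. no_isolated_points (A i)) \<and> openin (top_of_set U) (box_of A)}"

section \<open>Difference quotients\<close>

text \<open>
  A point of \<open>U\<^sub>1\<^bsup>1+\<beta>\<^sub>1\<^esup> \<times> \<dots> \<times> U\<^sub>n\<^bsup>1+\<beta>\<^sub>n\<^esup>\<close> is encoded as \<open>x :: 'n \<Rightarrow> nat \<Rightarrow> 'k\<close> with entry \<open>x i j\<close>
  for \<open>j \<le> \<beta> i\<close> and \<open>x i j = undefined\<close> for \<open>j > \<beta> i\<close>. As these coordinates are
  constant, the subspace topology inherited from the product topology on the function
  type is that of the finite product.
\<close>

definition multi_pow :: "('n \<Rightarrow> 'k set) \<Rightarrow> ('n \<Rightarrow> nat) \<Rightarrow> ('n \<Rightarrow> nat \<Rightarrow> 'k) set" where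
  "multi_pow A \<beta> = (\<Pi>\<^sub>E i\<in>UNIV. \<Pi>\<^sub>E j\<in>{..\<beta> i}. A i)"

definition multi_pow_distinct ::
    "('n \<Rightarrow> 'k set) \<Rightarrow> ('n \<Rightarrow> nat) \<Rightarrow> ('n \<Rightarrow> nat \<Rightarrow> 'k) set" where
  "multi_pow_distinct A \<beta> =
     {x \<in> multi_pow A \<beta>. \<forall>i j k. j < k \<and> k \<le> \<beta> i \<longrightarrow> x i j \<noteq> x i k}"

definition diff_quot ::
    "('k::field \<Rightarrow> 'e::comm_monoid_add \<Rightarrow> 'e) \<Rightarrow> ('n::finite \<Rightarrow> nat) \<Rightarrow> ('k ^ 'n \<Rightarrow> 'e)
       \<Rightarrow> ('n \<Rightarrow> nat \<Rightarrow> 'k) \<Rightarrow> 'e" where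
  "diff_quot smul \<beta> f x =
     (\<Sum>j\<in>(\<Pi>\<^sub>E i\<in>UNIV. {..\<beta> i}).
        smul (\<Prod>i\<in>UNIV. \<Prod>k\<in>{..\<beta> i} - {j i}. 1 / (x i (j i) - x i k))
              (f (\<chi> i. x i (j i))))"

text \<open>
  \<open>g\<close> is a continuous extension of the difference quotient of order \<open>\<beta>\<close> of the
  restriction of \<open>f\<close> to \<open>box_of A\<close>; only values of \<open>f\<close> on \<open>box_of A\<close> enter.
\<close>

definition is_diff_quot_ext ::
    "('k::{field,topological_space} \<Rightarrow> 'e::{comm_monoid_add,topological_space} \<Rightarrow> 'e)
       \<Rightarrow> ('n::finite \<Rightarrow> 'k set) \<Rightarrow> ('n \<Rightarrow> nat) \<Rightarrow> ('k ^ 'n \<Rightarrow> 'e)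
       \<Rightarrow> (('n \<Rightarrow> nat \<Rightarrow> 'k) \<Rightarrow> 'e) \<Rightarrow> bool" where
  "is_diff_quot_ext smul A \<beta> f g \<longleftrightarrow>
     g \<in> extensional (multi_pow A \<beta>) \<and> continuous_on (multi_pow A \<beta>) g \<and>
     (\<forall>x\<in>multi_pow_distinct A \<beta>. g x = diff_quot smul \<beta> f x)"

definition diff_quot_ext ::
    "('k::{field,topological_space} \<Rightarrow> 'e::{comm_monoid_add,topological_space} \<Rightarrow> 'e)
       \<Rightarrow> ('n::finite \<Rightarrow> 'k set) \<Rightarrow> ('n \<Rightarrow> nat) \<Rightarrow> ('k ^ 'n \<Rightarrow> 'e)
       \<Rightarrow> ('n \<Rightarrow> nat \<Rightarrow> 'k) \<Rightarrow> 'e" where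
  "diff_quot_ext smul A \<beta> f = (THE g. is_diff_quot_ext smul A \<beta> f g)"

section \<open>Spaces of differentiable maps\<close>

text \<open>Functions \<open>U \<rightarrow> E\<close> are represented by functions that are \<open>undefined\<close> off \<open>U\<close>.\<close>

definition C_alpha ::
    "('k::{field,topological_space} \<Rightarrow> 'e::{comm_monoid_add,topological_space} \<Rightarrow> 'e)
       \<Rightarrow> ('k ^ 'n::finite) set \<Rightarrow> ('n \<Rightarrow> enat) \<Rightarrow> ('k ^ 'n \<Rightarrow> 'e) set" where
  "C_alpha smul U \<alpha> =
     {f \<in> extensional U. \<forall>A\<in>cartesian_charts U. \<forall>\<beta>.
        (\<forall>i. enat (\<beta> i) \<le> \<alpha> i) \<longrightarrow> (\<exists>g. is_diff_quot_ext smul A \<beta> f g)}"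

definition C_r ::
    "('k::{field,topological_space} \<Rightarrow> 'e::{comm_monoid_add,topological_space} \<Rightarrow> 'e)
       \<Rightarrow> ('k ^ 'n::finite) set \<Rightarrow> enat \<Rightarrow> ('k ^ 'n \<Rightarrow> 'e) set" where
  "C_r smul U r =
     {f \<in> extensional U. \<forall>\<alpha>::'n \<Rightarrow> nat.
        enat (\<Sum>i\<in>UNIV. \<alpha> i) \<le> r \<longrightarrow> f \<in> C_alpha smul U (\<lambda>i. enat (\<alpha> i))}"

definition compact_open_topology ::
    "'a::topological_space set \<Rightarrow> ('a \<Rightarrow> 'b::topological_space) topology" where
  "compact_open_topology X = topology_generated_by
     {{g \<in> extensional X. continuous_on X g \<and> g ` K \<subseteq> W} | K W. compact K \<and> K \<subseteq> X \<and> open W}"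

definition initial_topology ::
    "'a set \<Rightarrow> 'i set \<Rightarrow> ('i \<Rightarrow> 'a \<Rightarrow> 'b) \<Rightarrow> ('i \<Rightarrow> 'b topology) \<Rightarrow> 'a topology" where
  "initial_topology X I h T = topology_generated_by
     (insert X {{x \<in> X. h i x \<in> W} | i W. i \<in> I \<and> openin (T i) W})"

definition C_alpha_topology ::
    "('k::{field,topological_space} \<Rightarrow> 'e::{comm_monoid_add,topological_space} \<Rightarrow> 'e)
       \<Rightarrow> ('k ^ 'n::finite) set \<Rightarrow> ('n \<Rightarrow> enat) \<Rightarrow> ('k ^ 'n \<Rightarrow> 'e) topology" where
  "C_alpha_topology smul U \<alpha> =
     initial_topology (C_alpha smul U \<alpha>)
       (cartesian_charts U \<times> {\<beta>. \<forall>i. enat (\<beta> i) \<le> \<alpha> i})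
       (\<lambda>(A, \<beta>) f. diff_quot_ext smul A \<beta> f)
       (\<lambda>(A, \<beta>). compact_open_topology (multi_pow A \<beta>))"

definition C_r_topology ::
    "('k::{field,topological_space} \<Rightarrow> 'e::{comm_monoid_add,topological_space} \<Rightarrow> 'e)
       \<Rightarrow> ('k ^ 'n::finite) set \<Rightarrow> enat \<Rightarrow> ('k ^ 'n \<Rightarrow> 'e) topology" where
  "C_r_topology smul U r =
     initial_topology (C_r smul U r)
       {\<alpha>::'n \<Rightarrow> nat. enat (\<Sum>i\<in>UNIV. \<alpha> i) \<le> r}
       (\<lambda>\<alpha> f. f)
       (\<lambda>\<alpha>. C_alpha_topology smul U (\<lambda>i. enat (\<alpha> i)))"

section \<open>Polynomial functions and density\<close>

definition Pol ::
    "('k::field \<Rightarrow> 'e::comm_monoid_add \<Rightarrow> 'e) \<Rightarrow> ('k ^ 'n::finite) set \<Rightarrow> ('k ^ 'n \<Rightarrow> 'e) set" where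
  "Pol smul U =
     {restrict (\<lambda>x. \<Sum>\<beta>\<in>B. smul (\<Prod>i\<in>UNIV. x $ i ^ \<beta> i) (a \<beta>)) U
       | (B :: ('n \<Rightarrow> nat) set) a. finite B}"

text \<open>
  The inclusion in the carrier is stated separately because \<open>closure_of\<close> ignores points
  outside the topological space.
\<close>

definition dense_subset_of :: "'a topology \<Rightarrow> 'a set \<Rightarrow> bool" where
  "dense_subset_of T S \<longleftrightarrow> S \<subseteq> topspace T \<and> T closure_of S = topspace T"

lemma topspace_compact_open_topology:
  "topspace (compact_open_topology X) = {g \<in> extensional X. continuous_on X g}"
proof -
  have "{g \<in> extensional X. continuous_on X g} \<in>
     {{g \<in> extensional X. continuous_on X g \<and> g ` K \<subseteq> W} | K W. compact K \<and> K \<subseteq> X \<and> open W}"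
    by (rule CollectI, rule exI[of _ "{}"], rule exI[of _ UNIV]) auto
  then show ?thesis
    unfolding compact_open_topology_def topology_generated_by_topspace by blast
qed

lemma topspace_initial_topology: "topspace (initial_topology X I h T) = X"
  unfolding initial_topology_def topology_generated_by_topspace by blast

lemma topspace_C_alpha_topology:
  "topspace (C_alpha_topology smul U \<alpha>) = C_alpha smul U \<alpha>"
  by (simp add: C_alpha_topology_def topspace_initial_topology)

lemma topspace_C_r_topology: "topspace (C_r_topology smul U r) = C_r smul U r"
  by (simp add: C_r_topology_def topspace_initial_topology)

end

theory Submission
  imports Defs
begin

text \<open>
  Difference quotients are divided differences over finite sets of nodes. A function is
  first approximated by one that is polynomial on every small polydisc. Two points in
  different closed balls of radius \<open>d\<close> have distance greater than \<open>d\<close>, so a divided difference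
  of order \<open>k\<close> that mixes several balls costs at most a factor \<open>d ^ (- k)\<close>; this is compensated
  because, inside one ball, the error of Newton interpolation of degree \<open>m\<close> has divided
  differences of order \<open>k\<close> of size \<open>\<epsilon> * d ^ (m - k)\<close>, where \<open>\<epsilon>\<close> is the oscillation of the
  top order difference quotient. For \<open>C\<^sup>r\<close> one interpolates in all variables at once with total
  degree \<open>m\<close>, for \<open>C\<^sup>\<alpha>\<close> in one variable after the other; the latter works because the
  interpolation error never exceeds the oscillation, which makes interpolation a
  contraction. Finally, Kaplansky's bump polynomials approximate the indicator functions of
  balls together with all their difference quotients.
\<close>

text \<open>Two scales must be kept apart. At a scale \<open>d\<close> fixed by \<open>U\<close> and
  a compact set alone, the domain is cut into boxes; mixing these costs at most
  \<open>d ^ (- N)\<close> for orders up to \<open>N\<close>, which is prepaid by approximating up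
  to \<open>e * d ^ N\<close> in each box. The scale \<delta> on which the approximant is polynomial
  depends on the accuracy already asked for, so the interpolation error cannot be prepaid in this
  way: the powers of \<delta> gained by interpolation have to cancel those lost. There are two
  interpolation schemes because the oscillation of \<open>f\<close> is controlled only for the
  orders in question. For C^r these form a simplex, and total degree interpolation stays inside it.
  For C^\<alpha> they form a box; total degree interpolation would call for orders outside the box,
  while interpolation in one variable raises the order in that direction only. Tuples with repeated
  entries are reached by limits: the bounds are shown for tuples of distinct entries nearby and are
  closed conditions.\<close>

lemma absval_dist_0: "absval x = dist x 0"
  by (simp add: dist_absval)

lemma absval_nonneg [simp]: "0 \<le> absval x"
  by (simp add: absval_dist_0)

lemma absval_0 [simp]: "absval 0 = 0"
  by (simp add: absval_dist_0)

lemma absval_eq_0 [simp]: "absval x = 0 \<longleftrightarrow> x = 0"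
  by (simp add: absval_dist_0)

lemma absval_pos [simp]: "0 < absval x \<longleftrightarrow> x \<noteq> 0"
  using absval_nonneg[of x] absval_eq_0[of x] by linarith

lemma absval_1 [simp]: "absval (1::'k::ultrametric_field) = 1"
proof -
  have "absval (1::'k) * absval (1::'k) = absval (1::'k)"
    by (metis absval_mult mult_1)
  then show ?thesis by simp
qed

lemma absval_uminus [simp]: "absval (- x) = absval x"
  by (metis absval_dist_0 diff_0 dist_absval dist_commute)

lemma absval_minus_commute: "absval (x - y) = absval (y - x)"
  by (metis dist_absval dist_commute)

lemma absval_inverse: "absval (inverse x) = inverse (absval x)"
proof (cases "x = 0")
  case False
  then have "absval x * absval (inverse x) = 1"
    by (metis absval_1 absval_mult right_inverse)
  then show ?thesis by (metis inverse_unique)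
qed simp

lemma absval_divide: "absval (x / y) = absval x / absval y"
  by (simp add: divide_inverse absval_mult absval_inverse)

lemma absval_power: "absval (x ^ n) = absval x ^ n"
  by (induction n) (auto simp: absval_mult)

lemma dist_ultra:
  fixes x :: "'k::ultrametric_field"
  shows "dist x y \<le> d \<Longrightarrow> dist y z \<le> d \<Longrightarrow> dist x z \<le> d"
  using absval_add_le_max[of "x - y" "y - z"] by (auto simp: dist_absval)

lemma cball_ultra_eq:
  fixes x :: "'k::ultrametric_field"
  assumes "dist x y \<le> d"
  shows "cball x d = cball y d"
  using assms dist_ultra[of x y d] dist_ultra[of y x d] by (auto simp: dist_commute)

text \<open>If all nonzero absolute values were 1, distinct points would have distance 1 and the
  topology would be discrete. Otherwise the powers of some \<open>c\<close> or of its inverse tend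
  to 0.\<close>

lemma ex_absval_less:
  assumes "0 < e"
  shows "\<exists>c::'k::ultrametric_field. c \<noteq> 0 \<and> absval c < e"
proof -
  have "\<exists>c::'k. c \<noteq> 0 \<and> absval c \<noteq> 1"
  proof (rule ccontr)
    assume "\<not> ?thesis"
    then have *: "dist x y = 1" if "x \<noteq> y" for x y :: 'k
      using that by (metis dist_absval right_minus_eq)
    have "open S" for S :: "'k set"
      unfolding open_dist
      by (metis * dual_order.irrefl zero_less_one)
    then show False using nondiscrete by blast
  qed
  then obtain c :: 'k where c: "c \<noteq> 0" "absval c < 1"
  proof -
    obtain c :: 'k where c: "c \<noteq> 0" "absval c \<noteq> 1"
      using \<open>\<exists>c::'k. c \<noteq> 0 \<and> absval c \<noteq> 1\<close> by blast
    have "absval (inverse c) < 1" if "\<not> absval c < 1"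
      using that c by (auto simp: absval_inverse inverse_less_1_iff)
    with c show thesis using that[of c] that[of "inverse c"] by fastforce
  qed
  then obtain n where "absval c ^ n < e"
    using real_arch_pow_inv[of e "absval c"] assms by auto
  then show ?thesis
    using c by (intro exI[of _ "c ^ n"]) (auto simp: absval_power)
qed

section \<open>Divided differences\<close>

text \<open>
  Indexing by finite sets of nodes instead of tuples makes the symmetry of divided
  differences part of the notation.
\<close>

definition node_box :: "('n \<Rightarrow> 'k set) \<Rightarrow> ('n \<Rightarrow> 'k) set" where
  "node_box Y = {s. \<forall>i. s i \<in> Y i}"

definition dd_coeff :: "('n::finite \<Rightarrow> 'k set) \<Rightarrow> ('n \<Rightarrow> 'k) \<Rightarrow> 'k::field" where
  "dd_coeff Y s = (\<Prod>i\<in>UNIV. \<Prod>t\<in>Y i - {s i}. 1 / (s i - t))"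

text \<open>In one variable this is the classical divided difference f[s_0, ..., s_k] written with
  Lagrange coefficients; in several variables it is the tensor product of these functionals.\<close>

definition divdiff ::
    "('k::field \<Rightarrow> 'e::comm_monoid_add \<Rightarrow> 'e) \<Rightarrow> ('n::finite \<Rightarrow> 'k set) \<Rightarrow> (('n \<Rightarrow> 'k) \<Rightarrow> 'e) \<Rightarrow> 'e"
  where "divdiff smul Y f = (\<Sum>s\<in>node_box Y. smul (dd_coeff Y s) (f s))"

definition node_sets :: "('n \<Rightarrow> 'k set) \<Rightarrow> bool" where
  "node_sets Y \<longleftrightarrow> (\<forall>i. finite (Y i) \<and> Y i \<noteq> {})"

text \<open>A divided difference on \<open>k + 1\<close> nodes has order \<open>k\<close>.\<close>

definition dd_type :: "('n \<Rightarrow> 'k set) \<Rightarrow> 'n \<Rightarrow> nat" where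
  "dd_type Y i = card (Y i) - 1"

abbreviation dd_order :: "('n::finite \<Rightarrow> 'k set) \<Rightarrow> nat" where
  "dd_order Y \<equiv> (\<Sum>i\<in>UNIV. dd_type Y i)"

lemma node_box_eq_PiE: "node_box Y = PiE UNIV Y"
  by (auto simp: node_box_def)

lemma finite_node_box: "node_sets Y \<Longrightarrow> finite (node_box (Y :: 'n::finite \<Rightarrow> 'k set))"
  unfolding node_box_eq_PiE node_sets_def by (intro finite_PiE) auto

lemma node_box_nonempty: "node_sets Y \<Longrightarrow> node_box Y \<noteq> {}"
  by (auto simp: node_box_eq_PiE PiE_eq_empty_iff node_sets_def)

lemma node_box_through: "node_sets Y \<Longrightarrow> t \<in> Y i \<Longrightarrow> \<exists>s\<in>node_box Y. s i = t"
proof -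
  assume Y: "node_sets Y" and t: "t \<in> Y i"
  then obtain s where "s \<in> node_box Y" using node_box_nonempty by blast
  with t show ?thesis by (intro bexI[of _ "s(i := t)"]) (auto simp: node_box_def)
qed

lemma node_box_mono: "(\<And>i. Y i \<subseteq> Z i) \<Longrightarrow> node_box Y \<subseteq> node_box Z"
  by (auto simp: node_box_def)

lemma dd_type_eq_iff: "node_sets Y \<Longrightarrow> dd_type Y i = m \<longleftrightarrow> card (Y i) = Suc m"
proof -
  assume "node_sets Y"
  then have "0 < card (Y i)" by (simp add: node_sets_def card_gt_0_iff)
  then show ?thesis by (auto simp: dd_type_def)
qed

lemma dd_type_ex_ne: "0 < dd_type Y i \<Longrightarrow> \<exists>u\<in>Y i. \<exists>v\<in>Y i. u \<noteq> v"
proof -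
  assume "0 < dd_type Y i"
  then have *: "1 < card (Y i)" by (simp add: dd_type_def)
  then have "finite (Y i)" by (metis card.infinite not_less_zero)
  with * show ?thesis using card_le_Suc0_iff_eq[of "Y i"] by auto
qed

lemma dd_type_0_singleton: "node_sets Y \<Longrightarrow> dd_type Y i = 0 \<Longrightarrow> \<exists>a. Y i = {a}"
  by (metis One_nat_def card_1_singletonE dd_type_eq_iff)

lemma node_sets_remove:
  "node_sets Y \<Longrightarrow> 0 < dd_type Y i \<Longrightarrow> node_sets (Y(i := Y i - {u}))"
  using dd_type_ex_ne[of Y i] by (auto simp: node_sets_def)

lemma dd_type_remove:
  "node_sets Y \<Longrightarrow> u \<in> Y i \<Longrightarrow> dd_type (Y(i := Y i - {u})) = (dd_type Y)(i := dd_type Y i - 1)"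
  by (rule ext) (auto simp: dd_type_def)

lemma sum_fun_upd:
  fixes \<gamma> :: "'n::finite \<Rightarrow> nat"
  shows "(\<Sum>j\<in>UNIV. (\<gamma>(i := m)) j) + \<gamma> i = (\<Sum>j\<in>UNIV. \<gamma> j) + m"
  proof -
  have "(\<Sum>j\<in>UNIV - {i}. (\<gamma>(i := m)) j) = (\<Sum>j\<in>UNIV - {i}. \<gamma> j)"
    by (rule sum.cong) auto
  then show ?thesis
    by (simp add: sum.remove[of UNIV i] del: fun_upd_apply) simp
qed

lemma dd_order_remove:
  assumes "node_sets Y" "u \<in> Y i" "0 < dd_type Y i"
  shows "Suc (dd_order (Y(i := Y i - {u}))) = dd_order Y"
  using sum_fun_upd[of "dd_type Y" i "dd_type Y i - 1"] assms(3)
  unfolding dd_type_remove[OF assms(1,2)] by simp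

lemma node_sets_insert: "node_sets Y \<Longrightarrow> node_sets (Y(i := insert u (Y i)))"
  by (auto simp: node_sets_def)

lemma dd_type_insert:
  "node_sets Y \<Longrightarrow> u \<notin> Y i \<Longrightarrow> dd_type (Y(i := insert u (Y i))) = (dd_type Y)(i := Suc (dd_type Y i))"
  by (rule ext) (auto simp: dd_type_def node_sets_def card_gt_0_iff)

lemma dd_order_insert:
  assumes "node_sets Y" "u \<notin> Y i"
  shows "dd_order (Y(i := insert u (Y i))) = Suc (dd_order Y)"
  using sum_fun_upd[of "dd_type Y" i "Suc (dd_type Y i)"]
  unfolding dd_type_insert[OF assms] by simp

lemma divdiff_cong:
  "(\<And>s. s \<in> node_box Y \<Longrightarrow> f s = g s) \<Longrightarrow> divdiff smul Y f = divdiff smul Y g"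
  unfolding divdiff_def by (rule sum.cong) auto

locale divided_differences = vector_space smul
  for smul :: "'k::field \<Rightarrow> 'e::ab_group_add \<Rightarrow> 'e"
begin

abbreviation dd :: "('n::finite \<Rightarrow> 'k set) \<Rightarrow> (('n \<Rightarrow> 'k) \<Rightarrow> 'e) \<Rightarrow> 'e"
  where "dd \<equiv> divdiff smul"

lemma divdiff_add: "dd Y (\<lambda>x. f x + g x) = dd Y f + dd Y g"
  by (simp add: divdiff_def scale_right_distrib sum.distrib)

lemma divdiff_diff: "dd Y (\<lambda>x. f x - g x) = dd Y f - dd Y g"
  by (simp add: divdiff_def scale_right_diff_distrib sum_subtractf)

lemma divdiff_scale: "dd Y (\<lambda>x. smul c (f x)) = smul c (dd Y f)"
  by (simp add: divdiff_def scale_sum_right mult.commute)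

lemma divdiff_zero: "dd Y (\<lambda>x. 0) = 0"
  by (simp add: divdiff_def)

lemma divdiff_sum: "dd Y (\<lambda>x. \<Sum>k\<in>K. f k x) = (\<Sum>k\<in>K. dd Y (f k))"
  by (induction K rule: infinite_finite_induct) (simp_all add: divdiff_zero divdiff_add)

lemma divdiff_order_0:
  assumes "\<And>i. Y i = {a i}"
  shows "dd Y f = f a"
proof -
  have "node_box Y = {a}" using assms by (auto simp: node_box_def)
  then show ?thesis using assms by (simp add: divdiff_def dd_coeff_def)
qed

text \<open>The factor vanishes at the node \<open>s\<close>, and at every other node it cancels
  \<open>1 / (x i - s)\<close> in the coefficient. All recursions below come from this
  cancellation.\<close>

lemma divdiff_mult_node:
  fixes Y :: "'n::finite \<Rightarrow> 'k set"
  assumes Y: "node_sets Y" and s: "s \<in> Y i"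
  shows "dd Y (\<lambda>x. smul (x i - s) (f x)) = (if dd_type Y i = 0 then 0 else dd (Y(i := Y i - {s})) f)"
proof -
  let ?Z = "Y(i := Y i - {s})"
  have "dd_coeff Y x * (x i - s) = dd_coeff ?Z x" if "x \<in> node_box ?Z" for x
  proof -
    have xi: "x i \<in> Y i" "x i \<noteq> s" using that by (auto simp: node_box_def split: if_splits)
    have eq: "Y i - {x i} = insert s (Y i - {s} - {x i})" using s xi by auto
    have fin: "finite (Y i - {s} - {x i})" using Y by (auto simp: node_sets_def)
    have "(\<Prod>t\<in>Y i - {x i}. 1 / (x i - t)) = 1 / (x i - s) * (\<Prod>t\<in>Y i - {s} - {x i}. 1 / (x i - t))"
      using xi by (subst eq, subst prod.insert[OF fin]) auto
    moreover have "(\<Prod>j\<in>UNIV - {i}. \<Prod>t\<in>?Z j - {x j}. 1 / (x j - t))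
        = (\<Prod>j\<in>UNIV - {i}. \<Prod>t\<in>Y j - {x j}. 1 / (x j - t))"
      by (rule prod.cong) auto
    moreover have "dd_coeff Z x = (\<Prod>t\<in>Z i - {x i}. 1 / (x i - t))
        * (\<Prod>j\<in>UNIV - {i}. \<Prod>t\<in>Z j - {x j}. 1 / (x j - t))" for Z :: "'n \<Rightarrow> 'k set"
      unfolding dd_coeff_def by (simp add: prod.remove[of UNIV i])
    ultimately show ?thesis
      using xi by (simp only: fun_upd_same) simp
  qed
  then have "(\<Sum>x\<in>node_box ?Z. smul (dd_coeff Y x * (x i - s)) (f x)) = dd ?Z f"
    by (simp add: divdiff_def)
  moreover have "(\<Sum>x\<in>node_box ?Z. smul (dd_coeff Y x * (x i - s)) (f x))
    = (\<Sum>x\<in>node_box Y. smul (dd_coeff Y x * (x i - s)) (f x))"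
  proof (rule sum.mono_neutral_left[OF finite_node_box[OF Y]])
    show "node_box ?Z \<subseteq> node_box Y" by (rule node_box_mono) auto
    show "\<forall>x\<in>node_box Y - node_box ?Z. smul (dd_coeff Y x * (x i - s)) (f x) = 0"
      by (auto simp: node_box_def split: if_splits)
  qed
  moreover have "dd ?Z f = 0" if i0: "dd_type Y i = 0"
  proof -
    obtain a where "Y i = {a}" using dd_type_0_singleton[OF Y i0] ..
    then have "node_box ?Z = {}" using s by (auto simp: node_box_def intro!: exI[of _ i])
    then show ?thesis by (simp add: divdiff_def)
  qed
  ultimately show ?thesis by (simp add: divdiff_def)
qed

text \<open>The Leibniz rule for a linear factor, from \<open>x i - a = (s - a) + (x i - s)\<close>.
  The node \<open>s\<close> can be chosen at will.\<close>

lemma divdiff_mult_linear: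
  assumes "node_sets Y" "s \<in> Y i"
  shows "dd Y (\<lambda>x. smul (x i - a) (f x))
     = smul (s - a) (dd Y f) + (if dd_type Y i = 0 then 0 else dd (Y(i := Y i - {s})) f)"
proof -
  have "smul (x i - a) (f x) = smul (s - a) (f x) + smul (x i - s) (f x)" for x
    by (simp add: scale_left_diff_distrib)
  then show ?thesis
    by (simp add: divdiff_add divdiff_scale divdiff_mult_node[OF assms])
qed

text \<open>The divided difference of \<open>(x i - v) * f\<close> is expanded once at the node
  \<open>u\<close> and once at the node \<open>v\<close>; comparison gives the recursion.\<close>

lemma divdiff_rec:
  assumes Y: "node_sets Y" and u: "u \<in> Y i" and v: "v \<in> Y i" and ne: "u \<noteq> v"
  shows "smul (u - v) (dd Y f) = dd (Y(i := Y i - {v})) f - dd (Y(i := Y i - {u})) f"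
proof -
  have "0 < dd_type Y i"
    using Y u v ne unfolding dd_type_def node_sets_def
    using card_le_Suc0_iff_eq[of "Y i"] by fastforce
  then show ?thesis
    using divdiff_mult_linear[OF Y u, of v f] divdiff_mult_linear[OF Y v, of v f] by simp
qed

lemma divdiff_rec':
  assumes "node_sets Y" "u \<in> Y i" "v \<in> Y i" "u \<noteq> v"
  shows "dd Y f = smul (inverse (u - v)) (dd (Y(i := Y i - {v})) f - dd (Y(i := Y i - {u})) f)"
  using divdiff_rec[OF assms, of f] assms(4) by (simp flip: divdiff_rec[OF assms, of f])

lemma divdiff_const:
  assumes "node_sets Y"
  shows "dd Y (\<lambda>x. c) = (if dd_order Y = 0 then c else 0)"
  using assms
proof (induction "dd_order Y" arbitrary: Y)
  case 0
  then have "\<exists>a. Y i = {a}" for i by (intro dd_type_0_singleton) auto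
  then obtain a where "\<And>i. Y i = {a i}" by metis
  then have "dd Y (\<lambda>x. c) = c" by (rule divdiff_order_0)
  then show ?case using 0(1)[symmetric] by (simp only: if_True simp_thms)
next
  case (Suc n)
  then obtain i where i: "0 < dd_type Y i"
    by (metis (mono_tags) gr0I sum.neutral nat.distinct(1))
  then obtain u v where uv: "u \<in> Y i" "v \<in> Y i" "u \<noteq> v" using dd_type_ex_ne[OF i] by auto
  have "n = dd_order (Y(i := Y i - {w}))" if "w \<in> Y i" for w
    using dd_order_remove[OF Suc.prems that i] Suc.hyps(2) by simp
  then have "dd (Y(i := Y i - {w})) (\<lambda>x. c) = (if n = 0 then c else 0)" if "w \<in> Y i" for w
    using Suc.hyps(1) node_sets_remove[OF Suc.prems i] that by metis
  then show ?case
    using divdiff_rec'[OF Suc.prems uv] uv Suc.hyps(2)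
    by (metis diff_self nat.distinct(1) scale_zero_right)
qed

text \<open>Fubini: both sides obey the recursion of divided differences in the \<open>i\<close>-th direction.\<close>

lemma divdiff_fubini:
  assumes "node_sets Y"
  shows "dd Y f = dd (\<lambda>_::unit. Y i) (\<lambda>t. dd (Y(i := {t ()})) f)"
  using assms
proof (induction "dd_type Y i" arbitrary: Y)
  case 0
  then obtain a where a: "Y i = {a}" using dd_type_0_singleton by metis
  then have Y: "Y(i := {a}) = Y" by (metis fun_upd_triv)
  have "dd (\<lambda>_::unit. Y i) (\<lambda>t. dd (Y(i := {t ()})) f) = dd (Y(i := {a})) f"
    using a by (intro divdiff_order_0)
  then show ?case unfolding Y by (rule sym)
next
  case (Suc n)
  then obtain u v where uv: "u \<in> Y i" "v \<in> Y i" "u \<noteq> v" using dd_type_ex_ne[of Y i] by auto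
  let ?G = "\<lambda>t::unit \<Rightarrow> 'k. dd (Y(i := {t ()})) f"
  have Yu: "node_sets (\<lambda>_::unit. Y i)" using Suc.prems by (auto simp: node_sets_def)
  have *: "dd (Y(i := Y i - {w})) f = dd ((\<lambda>_::unit. Y i)(() := Y i - {w})) ?G" if "w \<in> Y i" for w
  proof -
    have "n = dd_type (Y(i := Y i - {w})) i" using Suc.hyps(2) that by (simp add: dd_type_remove[OF Suc.prems])
    from Suc.hyps(1)[OF this node_sets_remove[OF Suc.prems]] Suc.hyps(2)
    have "dd (Y(i := Y i - {w})) f
      = dd (\<lambda>_::unit. Y i - {w}) (\<lambda>t. dd ((Y(i := Y i - {w}))(i := {t ()})) f)" by simp
    moreover have "(\<lambda>_::unit. Y i)(() := Y i - {w}) = (\<lambda>_. Y i - {w})" by auto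
    ultimately show ?thesis by simp
  qed
  show ?case
    using divdiff_rec'[OF Suc.prems uv, of f] divdiff_rec'[OF Yu, where u = u and i = "()" and v = v and f = ?G] uv *[of u] *[of v]
    by simp
qed

end

section \<open>Bounds on divided differences\<close>

definition same_cell :: "real \<Rightarrow> ('n \<Rightarrow> 'k::metric_space set) \<Rightarrow> bool" where
  "same_cell d Y \<longleftrightarrow> (\<forall>i. \<forall>s\<in>Y i. \<forall>t\<in>Y i. dist s t \<le> d)"

text \<open>Polynomials in the variables of \<open>I\<close> whose coefficients are arbitrary
  functions of the other variables. For \<open>I = {}\<close> these are all functions, for
  \<open>I = UNIV\<close> the polynomials proper, so that the variables can be made polynomial one
  at a time.\<close>

inductive poly_in ::
    "('k::field \<Rightarrow> 'e::ab_group_add \<Rightarrow> 'e) \<Rightarrow> 'n set \<Rightarrow> (('n \<Rightarrow> 'k) \<Rightarrow> 'e) \<Rightarrow> bool"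
  for smul I where
  indep: "(\<And>x y. (\<And>j. j \<notin> I \<Longrightarrow> x j = y j) \<Longrightarrow> g x = g y) \<Longrightarrow> poly_in smul I g"
| add: "poly_in smul I f \<Longrightarrow> poly_in smul I g \<Longrightarrow> poly_in smul I (\<lambda>x. f x + g x)"
| mult: "i \<in> I \<Longrightarrow> poly_in smul I f \<Longrightarrow> poly_in smul I (\<lambda>x. smul (x i) (f x))"

locale ultrametric_seminorm = divided_differences smul
  for smul :: "'k::ultrametric_field \<Rightarrow> 'e::ab_group_add \<Rightarrow> 'e" +
  fixes q :: "'e \<Rightarrow> real"
  assumes q_add: "q (x + y) \<le> max (q x) (q y)"
    and q_smul: "q (smul c x) = absval c * q x"
begin

lemma q_0 [simp]: "q 0 = 0"
  using q_smul[of 0 0] by simp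

lemma q_uminus [simp]: "q (- x) = q x"
  using q_smul[of "-1" x] by simp

lemma q_diff: "q (x - y) \<le> max (q x) (q y)"
  using q_add[of x "- y"] by simp

lemma q_minus_commute: "q (x - y) = q (y - x)"
  by (metis q_uminus minus_diff_eq)

lemma q_nonneg [simp]: "0 \<le> q x"
  using q_diff[of x x] by simp

lemma q_add_le: "q x \<le> c \<Longrightarrow> q y \<le> c \<Longrightarrow> q (x + y) \<le> c"
  using q_add[of x y] by simp

lemma q_diff_le: "q x \<le> c \<Longrightarrow> q y \<le> c \<Longrightarrow> q (x - y) \<le> c"
  using q_diff[of x y] by simp

lemma q_divdiff_rec:
  assumes "node_sets Y" "u \<in> Y i" "v \<in> Y i"
    and "q (dd (Y(i := Y i - {v})) f) \<le> c" "q (dd (Y(i := Y i - {u})) f) \<le> c"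
  shows "dist u v * q (dd Y f) \<le> c"
proof (cases "u = v")
  case True
  then show ?thesis using assms(4) by (auto intro: order_trans[OF q_nonneg])
next
  case False
  have "dist u v * q (dd Y f) = q (smul (u - v) (dd Y f))"
    by (simp add: q_smul dist_absval)
  also have "\<dots> \<le> c"
    unfolding divdiff_rec[OF assms(1-3) False] using q_diff assms(4,5) by (meson max.boundedI order_trans)
  finally show ?thesis .
qed

text \<open>If two nodes in some direction are more than \<open>d\<close> apart, the recursion
  divides by their difference. This costs less than \<open>1 / d\<close> and lowers the order by
  one, so the weight \<open>d ^ dd_order Y\<close> absorbs it. The hereditary property
  \<open>P\<close> admits families of nodes whose grid is confined to a set that is not a
  box.\<close>

lemma divdiff_glue:
  assumes "P Y" and d: "0 < d"
    and node: "\<And>Y. P Y \<Longrightarrow> node_sets Y"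
    and hered: "\<And>Y i u. P Y \<Longrightarrow> u \<in> Y i \<Longrightarrow> 0 < dd_type Y i \<Longrightarrow> P (Y(i := Y i - {u}))"
    and cell: "\<And>Y. P Y \<Longrightarrow> same_cell d Y \<Longrightarrow> q (dd Y f) * d ^ dd_order Y \<le> c"
  shows "q (dd Y f) * d ^ dd_order Y \<le> c"
  using \<open>P Y\<close>
proof (induction "dd_order Y" arbitrary: Y rule: less_induct)
  case less
  show ?case
  proof (cases "same_cell d Y")
    case True
    then show ?thesis using cell less.prems by blast
  next
    case False
    then obtain i u v where uv: "u \<in> Y i" "v \<in> Y i" "d < dist u v"
      unfolding same_cell_def by (meson not_le)
    note Y = node[OF less.prems]
    have pos: "0 < dd_type Y i"
    proof (rule ccontr)
      assume "\<not> 0 < dd_type Y i"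
      then obtain a where "Y i = {a}" using dd_type_0_singleton[OF Y] by blast
      with uv d show False by auto
    qed
    define m where "m = dd_order Y - 1"
    have m: "dd_order Y = Suc m" "\<And>w. w \<in> Y i \<Longrightarrow> dd_order (Y(i := Y i - {w})) = m"
      using dd_order_remove[OF Y uv(1) pos] dd_order_remove[OF Y _ pos]
      by (simp_all only: m_def) (metis Suc_pred' diff_Suc_1 zero_less_Suc)+
    have "q (dd (Y(i := Y i - {w})) f) \<le> c / d ^ m" if w: "w \<in> Y i" for w
    proof -
      have "q (dd (Y(i := Y i - {w})) f) * d ^ dd_order (Y(i := Y i - {w})) \<le> c"
        using m w by (intro less.hyps hered less.prems pos) auto
      then show ?thesis using d m(2)[OF w] by (simp add: field_simps)
    qed
    then have "dist u v * q (dd Y f) \<le> c / d ^ m"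
      using uv by (intro q_divdiff_rec[OF Y]) auto
    moreover have "d * q (dd Y f) \<le> dist u v * q (dd Y f)"
      using uv(3) by (intro mult_right_mono) auto
    ultimately have "d * q (dd Y f) \<le> c / d ^ m" by linarith
    then show ?thesis using d unfolding m by (simp add: field_simps)
  qed
qed

text \<open>A weighted C^r seminorm on \<open>S\<close>. The weight makes the different orders
  comparable at scale \<open>d\<close>, and it is what allows the bound to be tested on single
  cells.\<close>

definition dd_bound ::
    "nat \<Rightarrow> ('n::finite \<Rightarrow> 'k set) \<Rightarrow> real \<Rightarrow> real \<Rightarrow> (('n \<Rightarrow> 'k) \<Rightarrow> 'e) \<Rightarrow> bool" where
  "dd_bound r S d c f \<longleftrightarrow>
     (\<forall>Y. node_sets Y \<longrightarrow> (\<forall>i. Y i \<subseteq> S i) \<longrightarrow> dd_order Y \<le> r \<longrightarrow> q (dd Y f) * d ^ dd_order Y \<le> c)"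

lemma dd_boundD:
  "dd_bound r S d c f \<Longrightarrow> node_sets Y \<Longrightarrow> (\<And>i. Y i \<subseteq> S i) \<Longrightarrow> dd_order Y \<le> r
    \<Longrightarrow> q (dd Y f) * d ^ dd_order Y \<le> c"
  unfolding dd_bound_def by blast

lemma dd_bound_add:
  assumes "0 < d" "dd_bound r S d a f" "dd_bound r S d b g"
  shows "dd_bound r S d (max a b) (\<lambda>x. f x + g x)"
  unfolding dd_bound_def
proof (intro allI impI)
  fix Y :: "'a \<Rightarrow> 'k set"
  assume Y: "node_sets Y" "\<forall>i. Y i \<subseteq> S i" "dd_order Y \<le> r"
  have *: "q (dd Y f) * d ^ dd_order Y \<le> max a b" "q (dd Y g) * d ^ dd_order Y \<le> max a b"
    using dd_boundD[OF assms(2), of Y] dd_boundD[OF assms(3), of Y] Y by (auto intro: max.coboundedI1 max.coboundedI2)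
  have "q (dd Y (\<lambda>x. f x + g x)) \<le> max (q (dd Y f)) (q (dd Y g))"
    by (simp add: divdiff_add q_add)
  then have "q (dd Y (\<lambda>x. f x + g x)) * d ^ dd_order Y \<le> max (q (dd Y f)) (q (dd Y g)) * d ^ dd_order Y"
    using assms(1) by (intro mult_right_mono) auto
  also have "\<dots> \<le> max a b" using * by (auto simp: max_def)
  finally show "q (dd Y (\<lambda>x. f x + g x)) * d ^ dd_order Y \<le> max a b" .
qed

lemma dd_bound_mono: "dd_bound r S d a f \<Longrightarrow> a \<le> b \<Longrightarrow> dd_bound r S d b f"
  unfolding dd_bound_def by fastforce

lemma dd_bound_cong:
  "dd_bound r S d a f \<Longrightarrow> (\<And>s. s \<in> node_box S \<Longrightarrow> f s = g s) \<Longrightarrow> dd_bound r S d a g"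
  unfolding dd_bound_def
proof (intro allI impI)
  fix Y :: "'a \<Rightarrow> 'k set"
  assume f: "\<forall>Y. node_sets Y \<longrightarrow> (\<forall>i. Y i \<subseteq> S i) \<longrightarrow> dd_order Y \<le> r \<longrightarrow> q (dd Y f) * d ^ dd_order Y \<le> a"
    and fg: "\<And>s. s \<in> node_box S \<Longrightarrow> f s = g s"
    and Y: "node_sets Y" "\<forall>i. Y i \<subseteq> S i" "dd_order Y \<le> r"
  have "dd Y f = dd Y g"
    using Y(2) by (intro divdiff_cong fg) (auto simp: node_box_def)
  then show "q (dd Y g) * d ^ dd_order Y \<le> a" using f Y by metis
qed

lemma dd_bound_smul:
  assumes "dd_bound r S d b f"
  shows "dd_bound r S d (absval a * b) (\<lambda>x. smul a (f x))"
  unfolding dd_bound_def divdiff_scale q_smul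
  using assms by (auto simp: dd_bound_def mult.assoc intro!: mult_left_mono)

lemma dd_bound_sum:
  assumes "0 < d" "0 \<le> c" "\<And>k. k \<in> K \<Longrightarrow> dd_bound r S d c (f k)"
  shows "dd_bound r S d c (\<lambda>x. \<Sum>k\<in>K. f k x)"
  using assms(3)
proof (induction K rule: infinite_finite_induct)
  case (insert k K)
  then show ?case using dd_bound_add[OF assms(1), of r S c "f k" c] by simp
qed (use assms(2) in \<open>auto simp: dd_bound_def divdiff_zero\<close>)

lemma dd_bound_const: "dd_bound r S d (q v) (\<lambda>x. v)"
  unfolding dd_bound_def by (auto simp: divdiff_const)

text \<open>The bound is tested with the finite family \<open>Y\<close> itself as domain, so that
  inside a cell a function can be replaced by another one that agrees with it only there.\<close>

lemma dd_bound_glue: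
  assumes "0 < d"
    and "\<And>Y. node_sets Y \<Longrightarrow> (\<And>i. Y i \<subseteq> S i) \<Longrightarrow> same_cell d Y \<Longrightarrow> dd_bound r Y d c f"
  shows "dd_bound r S d c f"
  unfolding dd_bound_def
proof (intro allI impI)
  fix Y :: "'a \<Rightarrow> 'k set"
  assume Y: "node_sets Y" "\<forall>i. Y i \<subseteq> S i" "dd_order Y \<le> r"
  show "q (dd Y f) * d ^ dd_order Y \<le> c"
  proof (rule divdiff_glue[where P = "\<lambda>Y. node_sets Y \<and> (\<forall>i. Y i \<subseteq> S i) \<and> dd_order Y \<le> r"])
    show "q (dd Y f) * d ^ dd_order Y \<le> c"
      if "node_sets Y \<and> (\<forall>i. Y i \<subseteq> S i) \<and> dd_order Y \<le> r" "same_cell d Y" for Y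
      using that by (intro dd_boundD[OF assms(2)]) auto
    show "node_sets (Y(i := Y i - {u})) \<and> (\<forall>ia. (Y(i := Y i - {u})) ia \<subseteq> S ia)
        \<and> dd_order (Y(i := Y i - {u})) \<le> r"
      if "node_sets Y \<and> (\<forall>i. Y i \<subseteq> S i) \<and> dd_order Y \<le> r" "u \<in> Y i" "0 < dd_type Y i" for Y i u
      using that node_sets_remove[of Y i u] dd_order_remove[of Y u i] by auto
  qed (use Y assms(1) in auto)
qed

text \<open>
  Measuring a multiplier by its operator norm makes submultiplicativity trivial and
  replaces the full Leibniz rule by its special case for linear factors.
\<close>

definition mult_bound ::
    "nat \<Rightarrow> ('n::finite \<Rightarrow> 'k set) \<Rightarrow> 'n \<Rightarrow> real \<Rightarrow> real \<Rightarrow> ('k \<Rightarrow> 'k) \<Rightarrow> bool" where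
  "mult_bound r S i d c \<phi> \<longleftrightarrow> 0 \<le> c \<and>
     (\<forall>f b. 0 \<le> b \<longrightarrow> dd_bound r S d b f \<longrightarrow> dd_bound r S d (c * b) (\<lambda>x. smul (\<phi> (x i)) (f x)))"

lemma mult_boundD:
  "mult_bound r S i d c \<phi> \<Longrightarrow> 0 \<le> b \<Longrightarrow> dd_bound r S d b f
    \<Longrightarrow> dd_bound r S d (c * b) (\<lambda>x. smul (\<phi> (x i)) (f x))"
  by (simp add: mult_bound_def)

lemma mult_bound_mono: "mult_bound r S i d a \<phi> \<Longrightarrow> a \<le> b \<Longrightarrow> mult_bound r S i d b \<phi>"
  unfolding mult_bound_def by (meson dd_bound_mono mult_right_mono order_trans)

lemma mult_bound_const: "absval a \<le> c \<Longrightarrow> mult_bound r S i d c (\<lambda>x. a)"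
  by (rule mult_bound_mono[of _ _ _ _ "absval a"]) (auto simp: mult_bound_def dd_bound_smul)

lemma mult_bound_add:
  assumes "0 < d" "mult_bound r S i d c \<phi>" "mult_bound r S i d c \<psi>"
  shows "mult_bound r S i d c (\<lambda>x. \<phi> x + \<psi> x)"
  unfolding mult_bound_def
proof (intro conjI allI impI)
  show "0 \<le> c" using assms(2) by (simp add: mult_bound_def)
  fix f b assume "0 \<le> b" "dd_bound r S d b f"
  then have "dd_bound r S d (max (c * b) (c * b)) (\<lambda>x. smul (\<phi> (x i)) (f x) + smul (\<psi> (x i)) (f x))"
    by (intro dd_bound_add assms(1) mult_boundD[OF assms(2)] mult_boundD[OF assms(3)])
  then show "dd_bound r S d (c * b) (\<lambda>x. smul (\<phi> (x i) + \<psi> (x i)) (f x))"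
    by (simp add: scale_left_distrib)
qed

lemma mult_bound_mult:
  assumes "mult_bound r S i d a \<phi>" "mult_bound r S i d b \<psi>" "a * b \<le> c"
  shows "mult_bound r S i d c (\<lambda>x. \<phi> x * \<psi> x)"
proof (rule mult_bound_mono[OF _ assms(3)], unfold mult_bound_def, intro conjI allI impI)
  show "0 \<le> a * b" using assms(1,2) by (simp add: mult_bound_def)
  fix f e assume e: "0 \<le> e" "dd_bound r S d e f"
  have "dd_bound r S d (a * (b * e)) (\<lambda>x. smul (\<phi> (x i)) (smul (\<psi> (x i)) (f x)))"
    using assms(2) e by (intro mult_boundD[OF assms(1)] mult_boundD[OF assms(2)])
      (auto simp: mult_bound_def)
  then show "dd_bound r S d (a * b * e) (\<lambda>x. smul (\<phi> (x i) * \<psi> (x i)) (f x))"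
    by (simp add: mult.assoc)
qed

lemma mult_bound_minus: "mult_bound r S i d c \<phi> \<Longrightarrow> mult_bound r S i d c (\<lambda>x. - \<phi> x)"
  using mult_bound_mult[OF mult_bound_const[of "-1" 1], of r S i d c \<phi> c] by simp

lemma mult_bound_power:
  "mult_bound r S i d c \<phi> \<Longrightarrow> mult_bound r S i d (c ^ n) (\<lambda>x. \<phi> x ^ n)"
  by (induction n) (auto intro: mult_bound_const mult_bound_mult)

text \<open>In the Leibniz rule one term keeps the order and costs \<open>absval (s - a)\<close>;
  the other loses one order, which the weight turns into a factor \<open>d\<close>. So
  \<open>M\<close> has to dominate both.\<close>

lemma mult_bound_linear:
  assumes d: "0 < d" "d \<le> M" and M: "\<And>s. s \<in> S i \<Longrightarrow> absval (s - a) \<le> M"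
  shows "mult_bound r S i d M (\<lambda>x. x - a)"
  unfolding mult_bound_def
proof (intro conjI allI impI)
  show "0 \<le> M" using d by linarith
  fix f :: "('a \<Rightarrow> 'k) \<Rightarrow> 'e" and b assume b: "0 \<le> b" and f: "dd_bound r S d b f"
  show "dd_bound r S d (M * b) (\<lambda>x. smul (x i - a) (f x))"
    unfolding dd_bound_def
  proof (intro allI impI)
    fix Y :: "'a \<Rightarrow> 'k set"
    assume Y: "node_sets Y" "\<forall>i. Y i \<subseteq> S i" "dd_order Y \<le> r"
    obtain s where s: "s \<in> Y i" using Y(1) unfolding node_sets_def by blast
    let ?p = "d ^ dd_order Y"
    have 1: "q (smul (s - a) (dd Y f)) * ?p \<le> M * b"
    proof -
      have "absval (s - a) * (q (dd Y f) * ?p) \<le> M * b"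
        using M Y s b d dd_boundD[OF f, of Y] by (intro mult_mono) auto
      then show ?thesis by (simp add: q_smul mult.assoc)
    qed
    have 2: "q (if dd_type Y i = 0 then 0 else dd (Y(i := Y i - {s})) f) * ?p \<le> M * b"
    proof (cases "dd_type Y i = 0")
      case True
      then show ?thesis using b d by simp
    next
      case False
      let ?Z = "Y(i := Y i - {s})"
      have ord: "dd_order Y = Suc (dd_order ?Z)"
        using dd_order_remove[OF Y(1) s] False by simp
      have "q (dd ?Z f) * d ^ dd_order ?Z \<le> b"
        using Y ord False node_sets_remove[OF Y(1), of i s] by (intro dd_boundD[OF f]) auto
      then have "d * (q (dd ?Z f) * d ^ dd_order ?Z) \<le> M * b"
        using d b by (intro mult_mono) auto
      then show ?thesis using False unfolding ord by (simp add: mult_ac)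
    qed
    show "q (dd Y (\<lambda>x. smul (x i - a) (f x))) * ?p \<le> M * b"
    proof -
      have "q (dd Y (\<lambda>x. smul (x i - a) (f x))) * ?p
        \<le> max (q (smul (s - a) (dd Y f))) (q (if dd_type Y i = 0 then 0 else dd (Y(i := Y i - {s})) f)) * ?p"
        unfolding divdiff_mult_linear[OF Y(1) s] using q_add d by (intro mult_right_mono) auto
      also have "\<dots> \<le> M * b" using 1 2 by (simp add: max_def)
      finally show ?thesis .
    qed
  qed
qed

text \<open>The order of the quantifiers matters: \<open>C\<close> serves all \<open>r\<close>,
  \<open>S\<close> and \<open>i\<close>, so that an exponent can be chosen in terms of it.\<close>

lemma mult_bound_poly:
  assumes "0 < d"
  shows "\<exists>C. \<forall>r (S::'n::finite \<Rightarrow> 'k set) i. S i \<subseteq> cball a d \<longrightarrow> mult_bound r S i d C (poly p)"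
proof (induction p)
  case 0
  show ?case by (rule exI[of _ 0]) (auto intro!: mult_bound_const)
next
  case (pCons c p)
  then obtain C where C: "\<And>r (S::'n \<Rightarrow> 'k set) i. S i \<subseteq> cball a d \<Longrightarrow> mult_bound r S i d C (poly p)"
    by blast
  let ?M = "max d (absval a)"
  have "mult_bound r S i d (max (absval c) (?M * C)) (poly (pCons c p))"
    if S: "S i \<subseteq> cball a d" for r and S :: "'n \<Rightarrow> 'k set" and i
  proof -
    have "absval s \<le> ?M" if "s \<in> S i" for s
    proof -
      have "absval (s - a) \<le> d" using S that by (auto simp: dist_absval absval_minus_commute)
      then show ?thesis using absval_add_le_max[of "s - a" a] by auto
    qed
    then have "mult_bound r S i d ?M (\<lambda>x. x - 0)"
      using assms by (intro mult_bound_linear) auto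
    then have "mult_bound r S i d (max (absval c) (?M * C)) (\<lambda>x. c + (x - 0) * poly p x)"
      using C S by (intro mult_bound_add assms mult_bound_const mult_bound_mult) auto
    moreover have "poly (pCons c p) = (\<lambda>x. c + (x - 0) * poly p x)" by (auto simp: fun_eq_iff)
    ultimately show ?thesis by simp
  qed
  then show ?case by blast
qed

section \<open>Approximating cells by polynomials\<close>

text \<open>
  Kaplansky's bump polynomial. A point \<open>a\<close> at maximal distance from \<open>b\<close> is dealt with by
  the factor \<open>(1 - ((x - b) / (a - b)) ^ n) ^ m\<close>: it is close to 1 near \<open>b\<close>, bounded by 1 near
  the points of smaller distance, and small near \<open>a\<close> once \<open>m\<close> is large.
\<close>

lemma kaplansky_bump:
  assumes "finite T" and d: "0 < d" and e: "0 < e" "e \<le> 1" and "\<And>a. a \<in> T \<Longrightarrow> d < dist a b"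
  shows "\<exists>p. \<forall>r (S::'n::finite \<Rightarrow> 'k set) i.
      (S i \<subseteq> cball b d \<longrightarrow> mult_bound r S i d e (\<lambda>x. poly p x - 1)) \<and>
      (\<forall>a\<in>T. S i \<subseteq> cball a d \<longrightarrow> mult_bound r S i d e (poly p))"
  using assms(1,5)
proof (induction T rule: finite_ranking_induct[where f = "\<lambda>a. dist a b"])
  case empty
  have "mult_bound r S i d e (\<lambda>x. poly 1 x - 1)" for r and S :: "'n \<Rightarrow> 'k set" and i
    using mult_bound_const[of 0 e] e by simp
  then show ?case by blast
next
  case (insert a T)
  then obtain p where p: "\<And>r (S::'n \<Rightarrow> 'k set) i. S i \<subseteq> cball b d \<Longrightarrow> mult_bound r S i d e (\<lambda>x. poly p x - 1)"
    "\<And>r (S::'n \<Rightarrow> 'k set) i a. a \<in> T \<Longrightarrow> S i \<subseteq> cball a d \<Longrightarrow> mult_bound r S i d e (poly p)"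
    by (metis insertCI)
  define R where "R = dist a b"
  have R: "d < R" using insert.prems by (simp add: R_def)
  have ab: "a \<noteq> b" using R d by (auto simp: R_def)
  \<comment> \<open>The multiplier \<open>y\<close> below has size \<open>d / R\<close> near
    \<open>b\<close>, and \<open>1 - y\<close> has this size near \<open>a\<close>.\<close>
  define \<rho> where "\<rho> = d / R"
  have \<rho>: "0 \<le> \<rho>" "\<rho> < 1" using R d by (auto simp: \<rho>_def)
  obtain n where n: "\<rho> ^ n < e" using real_arch_pow_inv[OF e(1) \<rho>(2)] by blast
  obtain C where C: "\<And>r (S::'n \<Rightarrow> 'k set) i. S i \<subseteq> cball a d \<Longrightarrow> mult_bound r S i d C (poly p)"
    using mult_bound_poly[OF d] by blast
  \<comment> \<open>Near the new point \<open>a\<close> the old polynomial is merely bounded, by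
    \<open>C\<close>; the exponent \<open>m\<close> is there to outweigh this bound.\<close>
  obtain m where m: "\<rho> ^ m < e / (\<bar>C\<bar> + 1)"
    using real_arch_pow_inv[OF _ \<rho>(2), of "e / (\<bar>C\<bar> + 1)"] e by (auto simp: add_nonneg_pos)
  define y where "y = (\<lambda>x. inverse (a - b) * (x - b))"
  define u where "u = (\<lambda>x. 1 - y x ^ n)"
  define P where "P = p * (1 - [:- b / (a - b), inverse (a - b):] ^ n) ^ m"
  have P: "poly P = (\<lambda>x. poly p x * u x ^ m)"
    by (rule ext) (simp add: P_def u_def y_def left_diff_distrib right_diff_distrib divide_inverse mult.commute)
  have inv: "absval (inverse (a - b)) = 1 / R"
    by (simp add: absval_inverse R_def dist_absval divide_inverse del: inverse_eq_divide)
  have "mult_bound r S i d e (\<lambda>x. poly P x - 1)" if S: "S i \<subseteq> cball b d" for r and S :: "'n \<Rightarrow> 'k set" and i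
  proof -
    have pS: "mult_bound r S i d e (\<lambda>x. poly p x - 1)" using S by (intro p)
    have "mult_bound r S i d d (\<lambda>x. x - b)"
      using S d by (intro mult_bound_linear) (auto simp: dist_absval absval_minus_commute)
    then have y: "mult_bound r S i d \<rho> y"
      unfolding y_def using inv by (intro mult_bound_mult[OF mult_bound_const]) (auto simp: \<rho>_def)
    then have u1: "mult_bound r S i d e (\<lambda>x. u x - 1)"
      using mult_bound_mono[OF mult_bound_minus[OF mult_bound_power[OF y]] less_imp_le[OF n]]
      by (simp add: u_def)
    have "mult_bound r S i d 1 (\<lambda>x. 1 + (u x - 1))"
      using u1 e by (intro mult_bound_add d mult_bound_const) (auto intro: mult_bound_mono)
    then have u: "mult_bound r S i d 1 u" by simp
    have um: "mult_bound r S i d e (\<lambda>x. u x ^ k - 1)" for k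
    proof (induction k)
      case 0
      show ?case using mult_bound_const[of 0 e] e by simp
    next
      case (Suc k)
      have "mult_bound r S i d e (\<lambda>x. u x * (u x ^ k - 1) + (u x - 1))"
        by (intro mult_bound_add d u1 mult_bound_mult[OF u Suc]) simp
      then show ?case by (simp add: algebra_simps)
    qed
    have "mult_bound r S i d 1 (\<lambda>x. 1 + (poly p x - 1))"
      using pS e by (intro mult_bound_add d mult_bound_const) (auto intro: mult_bound_mono)
    then have p1: "mult_bound r S i d 1 (poly p)" by simp
    have "mult_bound r S i d e (\<lambda>x. poly p x * (u x ^ m - 1) + (poly p x - 1))"
      by (intro mult_bound_add d pS mult_bound_mult[OF p1 um]) simp
    then show ?thesis by (simp add: P algebra_simps)
  qed
  \<comment> \<open>The old point \<open>a'\<close> is not farther from \<open>b\<close> than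
    \<open>a\<close>, so \<open>y\<close> has size at most 1 near it and the new factor preserves
    the smallness of \<open>p\<close>.\<close>
  moreover have "mult_bound r S i d e (poly P)"
    if S: "S i \<subseteq> cball a' d" and a': "a' \<in> T" for r and S :: "'n \<Rightarrow> 'k set" and i a'
  proof -
    have pS: "mult_bound r S i d e (poly p)" using S a' by (intro p)
    have "absval (s - b) \<le> R" if "s \<in> S i" for s
    proof -
      have "dist s a' \<le> d" using S that by (auto simp: dist_commute)
      moreover have "dist a' b \<le> R" using insert.hyps a' by (auto simp: R_def)
      ultimately show ?thesis using dist_ultra[of s a' R b] R by (auto simp: dist_absval)
    qed
    then have "mult_bound r S i d R (\<lambda>x. x - b)"
      using R d by (intro mult_bound_linear) auto
    then have "mult_bound r S i d 1 y"
      unfolding y_def using inv R d by (intro mult_bound_mult[OF mult_bound_const]) auto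
    then have "mult_bound r S i d 1 (\<lambda>x. 1 + - (y x ^ n))"
      by (intro mult_bound_add d mult_bound_const mult_bound_minus) (auto dest: mult_bound_power[where n = n])
    then have "mult_bound r S i d 1 (\<lambda>x. u x ^ m)"
      unfolding u_def by (auto dest: mult_bound_power[where n = m])
    then show ?thesis unfolding P by (intro mult_bound_mult[OF pS]) auto
  qed
  \<comment> \<open>Near \<open>a\<close> the multiplier \<open>1 - y\<close> has size
    \<open>\<rho>\<close>, hence so does every \<open>1 - y ^ k\<close>.\<close>
  moreover have "mult_bound r S i d e (poly P)" if S: "S i \<subseteq> cball a d" for r and S :: "'n \<Rightarrow> 'k set" and i
  proof -
    have pS: "mult_bound r S i d C (poly p)" using S by (intro C)
    have "mult_bound r S i d d (\<lambda>x. x - a)"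
      using S d by (intro mult_bound_linear) (auto simp: dist_absval absval_minus_commute)
    then have "mult_bound r S i d \<rho> (\<lambda>x. - (inverse (a - b) * (x - a)))"
      using inv by (intro mult_bound_minus mult_bound_mult[OF mult_bound_const]) (auto simp: \<rho>_def)
    moreover have "- (inverse (a - b) * (x - a)) = 1 - y x" for x
      using ab by (simp add: y_def field_simps)
    ultimately have y1: "mult_bound r S i d \<rho> (\<lambda>x. 1 - y x)" by simp
    have "mult_bound r S i d 1 (\<lambda>x. 1 + - (1 - y x))"
      using y1 \<rho> by (intro mult_bound_add d mult_bound_const mult_bound_minus) (auto intro: mult_bound_mono)
    then have y: "mult_bound r S i d 1 y" by simp
    have "mult_bound r S i d \<rho> (\<lambda>x. 1 - y x ^ k)" for k
    proof (induction k)
      case 0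
      show ?case using mult_bound_const[of 0 \<rho>] \<rho> by simp
    next
      case (Suc k)
      have "mult_bound r S i d \<rho> (\<lambda>x. (1 - y x) + y x * (1 - y x ^ k))"
        by (intro mult_bound_add d y1 mult_bound_mult[OF y Suc]) simp
      then show ?case by (simp add: algebra_simps)
    qed
    then have um: "mult_bound r S i d (\<rho> ^ m) (\<lambda>x. u x ^ m)"
      unfolding u_def by (intro mult_bound_power)
    have "C * \<rho> ^ m \<le> (\<bar>C\<bar> + 1) * (e / (\<bar>C\<bar> + 1))"
      using m \<rho> by (intro mult_mono) auto
    then show ?thesis unfolding P by (intro mult_bound_mult[OF pS um]) auto
  qed
  ultimately show ?case by (intro exI[of _ P]) blast
qed

end

definition cell :: "real \<Rightarrow> ('n \<Rightarrow> 'k::metric_space) \<Rightarrow> ('n \<Rightarrow> 'k) set" where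
  "cell d c = {x. \<forall>i. dist (x i) (c i) \<le> d}"

text \<open>Only the coordinates in \<open>I\<close> are confined to a ball. In the other ones the
  identity holds without restriction, in accordance with coefficients that are arbitrary functions
  of them.\<close>

definition locally_poly_in ::
    "('k::ultrametric_field \<Rightarrow> 'e::ab_group_add \<Rightarrow> 'e) \<Rightarrow> 'n set \<Rightarrow> real \<Rightarrow> (('n \<Rightarrow> 'k) \<Rightarrow> 'e) \<Rightarrow> bool"
  where "locally_poly_in smul I d F \<longleftrightarrow>
    (\<forall>c. \<exists>p. poly_in smul I p \<and> (\<forall>x. (\<forall>i\<in>I. dist (x i) (c i) \<le> d) \<longrightarrow> F x = p x))"

lemma separated_net:
  fixes S :: "'k::ultrametric_field set"
  assumes "finite T" "S \<subseteq> (\<Union>t\<in>T. cball t d)"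
  shows "\<exists>T'\<subseteq>T. S \<subseteq> (\<Union>t\<in>T'. cball t d) \<and> (\<forall>s\<in>T'. \<forall>t\<in>T'. s \<noteq> t \<longrightarrow> d < dist s t)"
  using assms
proof (induction T arbitrary: S rule: finite_induct)
  case (insert a T)
  have "S - cball a d \<subseteq> (\<Union>t\<in>T. cball t d)" using insert.prems by auto
  from insert.IH[OF this] obtain T' where T': "T' \<subseteq> T" "S - cball a d \<subseteq> (\<Union>t\<in>T'. cball t d)"
    "\<And>s t. s \<in> T' \<Longrightarrow> t \<in> T' \<Longrightarrow> s \<noteq> t \<Longrightarrow> d < dist s t" by metis
  show ?case
  proof (cases "\<exists>t\<in>T'. dist a t \<le> d")
    case True
    then obtain t where t: "t \<in> T'" "dist a t \<le> d" by blast
    then have "S \<subseteq> (\<Union>t\<in>T'. cball t d)" using T'(2) unfolding cball_ultra_eq[OF t(2)] by blast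
    then show ?thesis using T'(1,3) by (intro exI[of _ T']) (simp add: subset_insertI2)
  next
    case False
    then have "\<forall>s\<in>insert a T'. \<forall>t\<in>insert a T'. s \<noteq> t \<longrightarrow> d < dist s t"
      using T'(3) by (auto simp: dist_commute not_le)
    moreover have "S \<subseteq> (\<Union>t\<in>insert a T'. cball t d)" using T'(2) by auto
    ultimately show ?thesis using T'(1) by (intro exI[of _ "insert a T'"]) auto
  qed
qed auto

context divided_differences
begin

lemma poly_in_smul: "poly_in smul I f \<Longrightarrow> poly_in smul I (\<lambda>x. smul a (f x))"
proof (induction rule: poly_in.induct)
  case (indep g)
  show ?case by (rule poly_in.indep) (metis indep)
next
  case (add f g)
  then show ?case using poly_in.add by (simp add: scale_right_distrib)
next
  case (mult i f)
  have "poly_in smul I (\<lambda>x. smul (x i) (smul a (f x)))" using mult by (intro poly_in.mult)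
  then show ?case by (simp add: mult.commute)
qed

lemma poly_in_const: "poly_in smul I (\<lambda>x. v)"
  by (rule poly_in.indep) simp

lemma poly_in_sum: "(\<And>k. k \<in> K \<Longrightarrow> poly_in smul I (f k)) \<Longrightarrow> poly_in smul I (\<lambda>x. \<Sum>k\<in>K. f k x)"
  by (induction K rule: infinite_finite_induct) (simp_all add: poly_in_const poly_in.add)

lemma poly_in_linear:
  assumes "i \<in> I" "poly_in smul I f"
  shows "poly_in smul I (\<lambda>x. smul (x i - a) (f x))"
proof -
  have "poly_in smul I (\<lambda>x. smul (x i) (f x) + smul (- a) (f x))"
    using assms by (intro poly_in.add poly_in.mult poly_in_smul)
  then show ?thesis by (simp add: scale_left_diff_distrib)
qed

lemma poly_in_poly:
  assumes "i \<in> I" "poly_in smul I f"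
  shows "poly_in smul I (\<lambda>x. smul (poly p (x i)) (f x))"
proof (induction p)
  case 0
  show ?case by (simp add: poly_in_const)
next
  case (pCons a p)
  have "poly_in smul I (\<lambda>x. smul a (f x) + smul (x i) (smul (poly p (x i)) (f x)))"
    using assms pCons.IH by (intro poly_in.add poly_in.mult poly_in_smul)
  then show ?case by (simp add: scale_left_distrib)
qed

lemma poly_in_prod_poly:
  assumes "J \<subseteq> I" "finite J" "poly_in smul I f"
  shows "poly_in smul I (\<lambda>x. smul (\<Prod>i\<in>J. poly (p i) (x i)) (f x))"
  using assms(2,1)
proof (induction J rule: finite_induct)
  case (insert j J)
  then have "poly_in smul I (\<lambda>x. smul (poly (p j) (x j)) (smul (\<Prod>i\<in>J. poly (p i) (x i)) (f x)))"
    by (intro poly_in_poly) auto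
  then show ?case using insert.hyps by simp
qed (use assms(3) in simp)

end

context ultrametric_seminorm
begin

text \<open>The polynomial is the product over all directions of bump polynomials at
  \<open>b i\<close>, taken relative to the centres of the net outside the ball around
  \<open>b i\<close>. By gluing, the nodes may be assumed to lie in one cell: if this is the cell of
  \<open>b\<close>, all factors are close to 1; otherwise one factor is small and the others have
  size at most 1.\<close>

lemma cell_indicator_approx:
  fixes S :: "'n::finite \<Rightarrow> 'k set"
  assumes d: "0 < d" and e: "0 < e"
    and T: "\<And>i. finite (T i)" "\<And>i. S i \<subseteq> (\<Union>t\<in>T i. cball t d)"
  shows "\<exists>P. poly_in smul UNIV P \<and> dd_bound r S d e (\<lambda>x. P x - (if x \<in> cell d b then v else 0))"
proof -
  \<comment> \<open>The summand 1 allows for \<open>q v = 0\<close>; the minimum with 1 makes each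
    factor a multiplier of size at most 1.\<close>
  define \<eta> where "\<eta> = min 1 (e / (q v + 1))"
  have qv: "0 < q v + 1" by (simp add: add_nonneg_pos)
  then have \<eta>: "0 < \<eta>" "\<eta> \<le> 1" using e by (auto simp: \<eta>_def)
  have "\<eta> * q v \<le> e / (q v + 1) * (q v + 1)"
    using e by (intro mult_mono) (auto simp: \<eta>_def add_nonneg_nonneg)
  then have \<eta>q: "\<eta> * q v \<le> e" using qv by simp
  define good where "good = (\<lambda>i p. \<forall>(S::'n \<Rightarrow> 'k set) i'.
      (S i' \<subseteq> cball (b i) d \<longrightarrow> mult_bound r S i' d \<eta> (\<lambda>x. poly p x - 1)) \<and>
      (\<forall>a\<in>{a\<in>T i. d < dist a (b i)}. S i' \<subseteq> cball a d \<longrightarrow> mult_bound r S i' d \<eta> (poly p)))"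
  have "\<exists>p. good i p" for i
  proof -
    have "finite {a\<in>T i. d < dist a (b i)}" using T(1) by simp
    then have "\<exists>p. \<forall>r (S::'n \<Rightarrow> 'k set) i'.
      (S i' \<subseteq> cball (b i) d \<longrightarrow> mult_bound r S i' d \<eta> (\<lambda>x. poly p x - 1)) \<and>
      (\<forall>a\<in>{a\<in>T i. d < dist a (b i)}. S i' \<subseteq> cball a d \<longrightarrow> mult_bound r S i' d \<eta> (poly p))"
      by (rule kaplansky_bump[OF _ d \<eta>]) simp
    then show ?thesis unfolding good_def by meson
  qed
  then obtain p where p0: "\<And>i. good i (p i)" by metis
  have p: "mult_bound r Y i d \<eta> (\<lambda>x. poly (p i) x - 1)" if "Y i \<subseteq> cball (b i) d" for Y :: "'n \<Rightarrow> 'k set" and i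
    using p0[of i] that unfolding good_def by blast
  have p': "mult_bound r Y i d \<eta> (poly (p i))" if "a \<in> T i" "d < dist a (b i)" "Y i \<subseteq> cball a d"
    for Y :: "'n \<Rightarrow> 'k set" and i a
    using p0[of i] that unfolding good_def by blast
  define P where "P = (\<lambda>x::'n \<Rightarrow> 'k. smul (\<Prod>i\<in>UNIV. poly (p i) (x i)) v)"
  have "poly_in smul UNIV P"
    unfolding P_def by (intro poly_in_prod_poly poly_in_const) auto
  moreover have "dd_bound r S d e (\<lambda>x. P x - (if x \<in> cell d b then v else 0))"
  proof (rule dd_bound_glue[OF d])
    fix Y :: "'n \<Rightarrow> 'k set"
    assume Y: "node_sets Y" "\<And>i. Y i \<subseteq> S i" "same_cell d Y"
    define near where "near = (\<lambda>i. Y i \<subseteq> cball (b i) d)"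
    have near: "mult_bound r Y i d \<eta> (\<lambda>x. poly (p i) x - 1)" if "near i" for i
      using that unfolding near_def by (rule p)
    \<comment> \<open>Nodes of a single cell that are not all in the ball around \<open>b i\<close>
      are all outside it, and they lie in the ball around one centre of the net.\<close>
    have far: "mult_bound r Y i d \<eta> (poly (p i)) \<and> (\<forall>t\<in>Y i. d < dist t (b i))" if not_near: "\<not> near i" for i
    proof -
      obtain s where s: "s \<in> Y i" "d < dist s (b i)"
        using not_near unfolding near_def by (metis dist_commute mem_cball not_le subsetI)
      then obtain t where t: "t \<in> T i" "dist s t \<le> d" using Y(2) T(2) by (force simp: dist_commute)
      have Yt: "Y i \<subseteq> cball t d"
        using Y(3) s t dist_ultra[of t s d] by (auto simp: same_cell_def dist_commute)
      have dt: "d < dist t (b i)" using s t dist_ultra[of s t d "b i"] by linarith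
      have "d < dist u (b i)" if "u \<in> Y i" for u
        using s that Y(3) dist_ultra[of s u d "b i"] by (auto simp: same_cell_def) (meson not_le)
      moreover have "mult_bound r Y i d \<eta> (poly (p i))" using Yt by (intro p'[OF t(1) dt])
      ultimately show ?thesis by blast
    qed
    have one: "mult_bound r Y i d 1 (poly (p i))" for i
    proof (cases "near i")
      case True
      have "mult_bound r Y i d 1 (\<lambda>x. 1 + (poly (p i) x - 1))"
        using near[OF True] \<eta> by (intro mult_bound_add d mult_bound_const) (auto intro: mult_bound_mono)
      then show ?thesis by simp
    next
      case False
      then show ?thesis using far \<eta> mult_bound_mono by blast
    qed
    show "dd_bound r Y d e (\<lambda>x. P x - (if x \<in> cell d b then v else 0))"
    proof (cases "\<forall>i. near i")
      case True
      \<comment> \<open>Telescoping: for the partial product \<open>w\<close>,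
        \<open>p * w - v = p * (w - v) + (p - 1) * v\<close>, and the ultrametric inequality keeps
        the errors from adding up.\<close>
      have "dd_bound r Y d (\<eta> * q v) (\<lambda>x. smul (\<Prod>i\<in>J. poly (p i) (x i)) v - v)" for J
      proof (induction J rule: infinite_finite_induct)
        case (insert j J)
        have "dd_bound r Y d (max (1 * (\<eta> * q v)) (\<eta> * q v)) (\<lambda>x. smul (poly (p j) (x j)) (smul (\<Prod>i\<in>J. poly (p i) (x i)) v - v) + smul (poly (p j) (x j) - 1) v)"
          using True \<eta> insert.IH
          by (intro dd_bound_add d mult_boundD[OF one] mult_boundD[OF near] dd_bound_const) auto
        then show ?case using insert.hyps by (simp add: scale_left_diff_distrib scale_right_diff_distrib)
      qed (use \<eta> in \<open>auto simp: dd_bound_def divdiff_zero\<close>)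
      then have "dd_bound r Y d e (\<lambda>x. P x - v)"
        unfolding P_def using \<eta>q dd_bound_mono by blast
      then show ?thesis
      proof (rule dd_bound_cong)
        fix s assume "s \<in> node_box Y"
        then have "s i \<in> cball (b i) d" for i using True unfolding near_def node_box_def by blast
        then have "s \<in> cell d b" by (simp add: cell_def dist_commute)
        then show "P s - v = P s - (if s \<in> cell d b then v else 0)" by simp
      qed
    next
      case False
      then obtain i where i: "\<not> near i" by blast
      have "dd_bound r Y d (1 * q v) (\<lambda>x. smul (\<Prod>i\<in>J. poly (p i) (x i)) v)" for J
      proof (induction J rule: infinite_finite_induct)
        case (insert j J)
        have "dd_bound r Y d (1 * (1 * q v)) (\<lambda>x. smul (poly (p j) (x j)) (smul (\<Prod>i\<in>J. poly (p i) (x i)) v))"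
          using insert.IH by (intro mult_boundD[OF one]) auto
        then show ?case using insert.hyps by simp
      qed (use dd_bound_const in auto)
      from this[of "UNIV - {i}"]
      have "dd_bound r Y d (\<eta> * (1 * q v)) (\<lambda>x. smul (poly (p i) (x i)) (smul (\<Prod>i\<in>UNIV - {i}. poly (p i) (x i)) v))"
        using far[OF i] by (intro mult_boundD) auto
      then have "dd_bound r Y d e P"
        unfolding P_def using \<eta>q dd_bound_mono by (simp add: prod.remove[of UNIV i])
      then show ?thesis
      proof (rule dd_bound_cong)
        fix s assume "s \<in> node_box Y"
        then have "s \<notin> cell d b" using far[OF i] by (auto simp: node_box_def cell_def not_le intro!: exI[of _ i])
        then show "P s = P s - (if s \<in> cell d b then v else 0)" by simp
      qed
    qed
  qed
  ultimately show ?thesis by blast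
qed

text \<open>Induction on the polynomial. A coordinate is a multiplier of size \<open>M\<close> on
  the bounded set \<open>S i\<close>, so its cofactor is approximated up to
  \<open>e / M\<close>.\<close>

lemma cell_poly_approx:
  fixes S :: "'n::finite \<Rightarrow> 'k set"
  assumes p: "poly_in smul UNIV p" and d: "0 < d" and e: "0 < e"
    and T: "\<And>i. finite (T i)" "\<And>i. S i \<subseteq> (\<Union>t\<in>T i. cball t d)"
  shows "\<exists>P. poly_in smul UNIV P \<and> dd_bound r S d e (\<lambda>x. P x - (if x \<in> cell d b then p x else 0))"
  using p e
proof (induction arbitrary: e rule: poly_in.induct)
  case (indep g)
  define v where "v = g undefined"
  have g: "g = (\<lambda>x. v)" unfolding v_def by (rule ext, rule indep(1)) simp
  have "\<exists>P. poly_in smul UNIV P \<and>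
      dd_bound r S d e (\<lambda>x. P x - (if x \<in> cell d b then v else 0))"
    by (rule cell_indicator_approx[OF d indep(2) T])
  then show ?case unfolding g .
next
  case (add f g)
  obtain P where P: "poly_in smul UNIV P" "dd_bound r S d e (\<lambda>x. P x - (if x \<in> cell d b then f x else 0))"
    using add by metis
  obtain Q where Q: "poly_in smul UNIV Q" "dd_bound r S d e (\<lambda>x. Q x - (if x \<in> cell d b then g x else 0))"
    using add by metis
  have "dd_bound r S d (max e e) (\<lambda>x. (P x - (if x \<in> cell d b then f x else 0)) + (Q x - (if x \<in> cell d b then g x else 0)))"
    by (intro dd_bound_add d P Q)
  moreover have "(\<lambda>x. (P x - (if x \<in> cell d b then f x else 0)) + (Q x - (if x \<in> cell d b then g x else 0)))
     = (\<lambda>x. (P x + Q x) - (if x \<in> cell d b then f x + g x else 0))" by auto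
  ultimately show ?case using poly_in.add[OF P(1) Q(1)] by (intro exI[of _ "\<lambda>x. P x + Q x"]) simp
next
  case (mult i f)
  obtain M where M: "d \<le> M" "\<And>s. s \<in> S i \<Longrightarrow> absval (s - 0) \<le> M"
  proof -
    define M where "M = Max (insert d (absval ` T i))"
    have M: "d \<le> M" "\<And>t. t \<in> T i \<Longrightarrow> absval t \<le> M" using T(1) by (auto simp: M_def)
    have "absval (s - 0) \<le> M" if s: "s \<in> S i" for s
    proof -
      obtain t where t: "t \<in> T i" "dist s t \<le> M" using T(2) s M(1) by (force simp: dist_commute)
      then show ?thesis using dist_ultra[of s t M 0] M(2)[of t] by (simp add: dist_absval)
    qed
    with M(1) show thesis by (rule that)
  qed
  have M0: "0 < M" using M(1) d by linarith
  obtain P where P: "poly_in smul UNIV P" "dd_bound r S d (e / M) (\<lambda>x. P x - (if x \<in> cell d b then f x else 0))"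
    using mult.IH[of "e / M"] mult.prems M0 by auto
  have "dd_bound r S d (M * (e / M)) (\<lambda>x. smul (x i - 0) (P x - (if x \<in> cell d b then f x else 0)))"
    using mult.prems M0 by (intro mult_boundD[OF mult_bound_linear[OF d M]] P) auto
  moreover have "(\<lambda>x. smul (x i - 0) (P x - (if x \<in> cell d b then f x else 0)))
     = (\<lambda>x. smul (x i) (P x) - (if x \<in> cell d b then smul (x i) (f x) else 0))"
    by (auto simp: scale_right_diff_distrib)
  ultimately show ?case
    using poly_in.mult[OF mult.hyps(1) P(1)] M0 by (intro exI[of _ "\<lambda>x. smul (x i) (P x)"]) simp
qed

text \<open>The cells over a separated net are disjoint, so on the grid of \<open>S\<close> the
  function is the finite sum of its pieces, each cut off outside its own cell.\<close>

theorem locally_poly_approx: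
  fixes S :: "'n::finite \<Rightarrow> 'k set"
  assumes F: "locally_poly_in smul UNIV d F" and d: "0 < d" and e: "0 < e"
    and T: "\<And>i. finite (T i)" "\<And>i. S i \<subseteq> (\<Union>t\<in>T i. cball t d)"
  shows "\<exists>P. poly_in smul UNIV P \<and> dd_bound r S d e (\<lambda>x. P x - F x)"
proof -
  have "\<exists>T'\<subseteq>T i. S i \<subseteq> (\<Union>t\<in>T'. cball t d) \<and> (\<forall>s\<in>T'. \<forall>t\<in>T'. s \<noteq> t \<longrightarrow> d < dist s t)" for i
    by (rule separated_net[OF T])
  then obtain T' where T': "\<And>i. T' i \<subseteq> T i" "\<And>i. S i \<subseteq> (\<Union>t\<in>T' i. cball t d)"
    "\<And>i s t. s \<in> T' i \<Longrightarrow> t \<in> T' i \<Longrightarrow> s \<noteq> t \<Longrightarrow> d < dist s t" by metis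
  have fT': "finite (T' i)" for i using T'(1) T(1) finite_subset by blast
  have fin: "finite (node_box T')"
    unfolding node_box_eq_PiE using fT' by (intro finite_PiE) auto
  obtain p where p: "\<And>b. poly_in smul UNIV (p b)" "\<And>b x. x \<in> cell d b \<Longrightarrow> F x = p b x"
    using F unfolding locally_poly_in_def cell_def by (auto dest!: choice)
  obtain P where P: "\<And>b. poly_in smul UNIV (P b)"
    "\<And>b. dd_bound r S d e (\<lambda>x. P b x - (if x \<in> cell d b then p b x else 0))"
  proof -
    have "\<exists>P. poly_in smul UNIV P \<and> dd_bound r S d e (\<lambda>x. P x - (if x \<in> cell d b then p b x else 0))" for b
      by (rule cell_poly_approx[OF p(1) d e fT' T'(2)])
    then show thesis using that by metis
  qed
  have "dd_bound r S d e (\<lambda>x. \<Sum>b\<in>node_box T'. P b x - (if x \<in> cell d b then p b x else 0))"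
    using e by (intro dd_bound_sum d P) auto
  then have "dd_bound r S d e (\<lambda>x. (\<Sum>b\<in>node_box T'. P b x) - F x)"
  proof (rule dd_bound_cong)
    fix s assume s: "s \<in> node_box S"
    then have "\<exists>t\<in>T' i. dist (s i) t \<le> d" for i
      using T'(2)[of i] by (force simp: node_box_def dist_commute)
    then obtain b where b: "\<And>i. b i \<in> T' i" "\<And>i. dist (s i) (b i) \<le> d" by metis
    have "b' = b" if b': "b' \<in> node_box T'" "s \<in> cell d b'" for b'
    proof
      fix i
      have "dist (b' i) (b i) \<le> d"
        using b' b(2)[of i] dist_ultra[of "b' i" "s i" d "b i"] by (auto simp: cell_def dist_commute)
      then show "b' i = b i" using T'(3)[of "b' i" i "b i"] b(1) b'(1) by (force simp: node_box_def)
    qed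
    moreover have "s \<in> cell d b" using b(2) by (simp add: cell_def)
    ultimately have "s \<in> cell d c \<longleftrightarrow> c = b" if "c \<in> node_box T'" for c using that by blast
    then have "(\<Sum>c\<in>node_box T'. if s \<in> cell d c then p c s else 0) = (\<Sum>c\<in>node_box T'. if c = b then p c s else 0)"
      by (intro sum.cong refl) simp
    also have "\<dots> = F s" using fin b(1) p(2)[OF \<open>s \<in> cell d b\<close>] by (simp add: node_box_def)
    finally show "(\<Sum>b\<in>node_box T'. P b s - (if s \<in> cell d b then p b s else 0)) = (\<Sum>b\<in>node_box T'. P b s) - F s"
      by (simp add: sum_subtractf)
  qed
  moreover have "poly_in smul UNIV (\<lambda>x. \<Sum>b\<in>node_box T'. P b x)" by (intro poly_in_sum P)
  ultimately show ?thesis by blast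
qed

end

section \<open>Newton interpolation\<close>

definition newton_set :: "('n \<Rightarrow> nat \<Rightarrow> 'k) \<Rightarrow> ('n \<Rightarrow> nat) \<Rightarrow> 'n \<Rightarrow> 'k set" where
  "newton_set z \<gamma> = (\<lambda>i. z i ` {..\<gamma> i})"

text \<open>The Newton basis polynomial of degree \<open>\<gamma> i\<close> in direction
  \<open>i\<close>. It uses the nodes with index below \<open>\<gamma> i\<close>, one fewer than
  \<open>newton_set\<close>, whose divided difference is the coefficient belonging to it.\<close>

definition newton_poly :: "('n::finite \<Rightarrow> nat \<Rightarrow> 'k::field) \<Rightarrow> ('n \<Rightarrow> nat) \<Rightarrow> ('n \<Rightarrow> 'k) \<Rightarrow> 'k" where
  "newton_poly z \<gamma> x = (\<Prod>i\<in>UNIV. \<Prod>k<\<gamma> i. x i - z i k)"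

lemma finite_order_le: "finite {\<gamma> :: 'n::finite \<Rightarrow> nat. (\<Sum>i\<in>UNIV. \<gamma> i) \<le> r}"
proof (rule finite_subset)
  show "{\<gamma> :: 'n \<Rightarrow> nat. (\<Sum>i\<in>UNIV. \<gamma> i) \<le> r} \<subseteq> node_box (\<lambda>_. {..r})"
  proof
    fix \<gamma> :: "'n \<Rightarrow> nat" assume "\<gamma> \<in> {\<gamma>. (\<Sum>i\<in>UNIV. \<gamma> i) \<le> r}"
    moreover have "\<gamma> i \<le> (\<Sum>i\<in>UNIV. \<gamma> i)" for i by (rule member_le_sum) auto
    ultimately show "\<gamma> \<in> node_box (\<lambda>_. {..r})" by (auto simp: node_box_def intro: order_trans)
  qed
  show "finite (node_box (\<lambda>_::'n. {..r}))"
    by (rule finite_node_box) (auto simp: node_sets_def)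
qed

lemma newton_poly_Suc:
  assumes "\<gamma> i = Suc k"
  shows "newton_poly z \<gamma> x = (x i - z i k) * newton_poly z (\<gamma>(i := k)) x"
proof -
  have "(\<Prod>j\<in>UNIV - {i}. \<Prod>l<(\<gamma>(i := k)) j. x j - z j l) = (\<Prod>j\<in>UNIV - {i}. \<Prod>l<\<gamma> j. x j - z j l)"
    by (rule prod.cong) auto
  then show ?thesis
    using assms by (simp add: newton_poly_def prod.remove[of UNIV i] mult_ac)
qed

lemma newton_poly_0: "newton_poly z (\<lambda>_. 0) x = 1"
  by (simp add: newton_poly_def)

lemma newton_poly_vanish: "s i = z i k \<Longrightarrow> k < \<gamma> i \<Longrightarrow> newton_poly z \<gamma> s = 0"
  unfolding newton_poly_def by (rule prod_zero) (auto intro!: exI[of _ i] prod_zero)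

lemma node_sets_newton: "node_sets (newton_set z \<gamma>)"
  by (auto simp: node_sets_def newton_set_def)

lemma dd_type_newton:
  assumes "\<And>i. inj_on (z i) {..\<gamma> i}"
  shows "dd_type (newton_set z \<gamma>) = \<gamma>"
  by (rule ext) (simp add: dd_type_def newton_set_def card_image[OF assms])

lemma sum_le_ex_less:
  fixes \<gamma> \<beta> :: "'n::finite \<Rightarrow> nat"
  assumes "(\<Sum>i\<in>UNIV. \<gamma> i) \<le> (\<Sum>i\<in>UNIV. \<beta> i)" "\<gamma> \<noteq> \<beta>"
  shows "\<exists>i. \<gamma> i < \<beta> i"
proof (rule ccontr)
  assume *: "\<not> ?thesis"
  obtain j where "\<gamma> j \<noteq> \<beta> j" using assms(2) by blast
  with * have "\<beta> j < \<gamma> j" by (metis linorder_neqE_nat)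
  then have "(\<Sum>i\<in>UNIV. \<beta> i) < (\<Sum>i\<in>UNIV. \<gamma> i)"
    using * by (intro sum_strict_mono_ex1) (auto simp: not_less)
  with assms(1) show False by simp
qed

context ultrametric_seminorm
begin

text \<open>Newton interpolation of total degree at most \<open>r\<close>, that is, on the
  simplicial part of the grid \<open>z\<close>.\<close>

definition newton :: "('n::finite \<Rightarrow> nat \<Rightarrow> 'k) \<Rightarrow> nat \<Rightarrow> (('n \<Rightarrow> 'k) \<Rightarrow> 'e) \<Rightarrow> ('n \<Rightarrow> 'k) \<Rightarrow> 'e" where
  "newton z r f x =
     (\<Sum>\<gamma> | (\<Sum>i\<in>UNIV. \<gamma> i) \<le> r. smul (newton_poly z \<gamma> x) (dd (newton_set z \<gamma>) f))"

text \<open>Divided differences kill polynomials whose degree in some direction is below the order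
  there, and they give the leading coefficient if all degrees agree with the orders. Once a linear
  factor is split off, the Leibniz term that keeps \<open>Y\<close> has too low a degree, so only
  the term with one node removed can contribute.\<close>

lemma divdiff_newton_poly:
  assumes "node_sets Y" "\<gamma> = dd_type Y \<or> (\<exists>i. \<gamma> i < dd_type Y i)"
  shows "dd Y (\<lambda>x. smul (newton_poly z \<gamma> x) v) = (if \<gamma> = dd_type Y then v else 0)"
  using assms
proof (induction "\<Sum>i\<in>UNIV. \<gamma> i" arbitrary: \<gamma> Y)
  case 0
  then have \<gamma>: "\<gamma> = (\<lambda>_. 0)" by auto
  show ?case
  proof (cases "\<gamma> = dd_type Y")
    case True
    then show ?thesis using \<gamma> divdiff_const[OF 0(2), of v] by (simp add: newton_poly_0 flip: True)
  next
    case False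
    then have "dd_order Y \<noteq> 0" using 0(3) by auto
    then have "dd Y (\<lambda>x. v) = 0" using divdiff_const[OF 0(2), of v] by argo
    then show ?thesis using False \<gamma> by (simp add: newton_poly_0)
  qed
next
  case (Suc n)
  then obtain i where "\<gamma> i \<noteq> 0" by (metis (mono_tags, lifting) nat.distinct(1) sum.neutral)
  then obtain k where k: "\<gamma> i = Suc k" using not0_implies_Suc by blast
  let ?\<gamma> = "\<gamma>(i := k)"
  have n: "n = (\<Sum>j\<in>UNIV. ?\<gamma> j)" using sum_fun_upd[of \<gamma> i k] Suc.hyps(2) k by simp
  obtain s where s: "s \<in> Y i" using Suc.prems(1) unfolding node_sets_def by blast
  have "\<exists>j. ?\<gamma> j < dd_type Y j"
    using Suc.prems(2)
  proof
    assume "\<gamma> = dd_type Y"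
    then have "?\<gamma> i < dd_type Y i" using k by auto
    then show ?thesis by blast
  next
    assume "\<exists>j. \<gamma> j < dd_type Y j"
    then obtain j where "\<gamma> j < dd_type Y j" by blast
    then have "?\<gamma> j < dd_type Y j" using k by (cases "j = i") auto
    then show ?thesis by blast
  qed
  then have less: "?\<gamma> \<noteq> dd_type Y" "?\<gamma> = dd_type Y \<or> (\<exists>j. ?\<gamma> j < dd_type Y j)"
    by (metis less_irrefl, blast)
  have 1: "dd Y (\<lambda>x. smul (newton_poly z ?\<gamma> x) v) = 0"
    using Suc.hyps(1)[OF n Suc.prems(1) less(2)] less(1) by argo
  let ?Z = "Y(i := Y i - {s})"
  have 2: "dd ?Z (\<lambda>x. smul (newton_poly z ?\<gamma> x) v) = (if \<gamma> = dd_type Y then v else 0)" if pos: "dd_type Y i \<noteq> 0"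
  proof -
    have Z: "node_sets ?Z" using node_sets_remove[OF Suc.prems(1)] pos by simp
    have ty: "dd_type ?Z = (dd_type Y)(i := dd_type Y i - 1)" by (rule dd_type_remove[OF Suc.prems(1) s])
    have eq: "?\<gamma> = dd_type ?Z \<longleftrightarrow> \<gamma> = dd_type Y"
    proof
      assume *: "?\<gamma> = dd_type ?Z"
      show "\<gamma> = dd_type Y"
      proof
        fix j show "\<gamma> j = dd_type Y j"
          using fun_cong[OF *, of j] k pos unfolding ty by (cases "j = i") auto
      qed
    next
      assume *: "\<gamma> = dd_type Y"
      show "?\<gamma> = dd_type ?Z" unfolding ty using k by (auto simp: fun_eq_iff *[symmetric])
    qed
    have "?\<gamma> = dd_type ?Z \<or> (\<exists>j. ?\<gamma> j < dd_type ?Z j)"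
    proof (cases "\<gamma> = dd_type Y")
      case True
      then show ?thesis using eq by blast
    next
      case False
      then obtain j where "\<gamma> j < dd_type Y j" using Suc.prems(2) by blast
      then have "?\<gamma> j < dd_type ?Z j" unfolding ty using k by (cases "j = i") auto
      then show ?thesis by blast
    qed
    from Suc.hyps(1)[OF n Z this] show ?thesis unfolding eq .
  qed
  have "dd Y (\<lambda>x. smul (newton_poly z \<gamma> x) v) = dd Y (\<lambda>x. smul (x i - z i k) (smul (newton_poly z ?\<gamma> x) v))"
    by (simp add: newton_poly_Suc[of \<gamma> i k, OF k])
  also have "\<dots> = (if \<gamma> = dd_type Y then v else 0)"
    unfolding divdiff_mult_linear[OF Suc.prems(1) s] 1 using 2 k by auto
  finally show ?case .
qed

text \<open>Duality of the Newton basis and the divided differences at the interpolation nodes. In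
  the case left open for general nodes, \<open>\<beta> i < \<gamma> i\<close> for some
  \<open>i\<close>, the basis polynomial vanishes at all nodes.\<close>

lemma divdiff_newton_set_poly:
  assumes "\<And>i. inj_on (z i) {..\<beta> i}"
  shows "dd (newton_set z \<beta>) (\<lambda>x. smul (newton_poly z \<gamma> x) v) = (if \<gamma> = \<beta> then v else 0)"
proof (cases "\<gamma> = \<beta> \<or> (\<exists>i. \<gamma> i < \<beta> i)")
  case True
  then show ?thesis
    using divdiff_newton_poly[OF node_sets_newton, of \<gamma> z \<beta> z v]
    unfolding dd_type_newton[of z \<beta>, OF assms] by blast
next
  case False
  then obtain i where "\<gamma> i \<noteq> \<beta> i" by blast
  then have i: "\<beta> i < \<gamma> i" using False by (metis linorder_neqE_nat)
  have "newton_poly z \<gamma> s = 0" if s: "s \<in> node_box (newton_set z \<beta>)" for s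
  proof -
    obtain k where "k \<le> \<beta> i" "s i = z i k" using s by (auto simp: node_box_def newton_set_def)
    then show ?thesis using i by (intro newton_poly_vanish[of s i z k]) auto
  qed
  then have "dd (newton_set z \<beta>) (\<lambda>x. smul (newton_poly z \<gamma> x) v) = dd (newton_set z \<beta>) (\<lambda>x. 0)"
    by (intro divdiff_cong) simp
  then show ?thesis using False by (auto simp: divdiff_zero)
qed

lemma divdiff_newton_interpolates:
  assumes "\<And>i. inj_on (z i) {..\<beta> i}" "(\<Sum>i\<in>UNIV. \<beta> i) \<le> r"
  shows "dd (newton_set z \<beta>) (newton z r f) = dd (newton_set z \<beta>) f"
  using assms(2)
  unfolding newton_def divdiff_sum divdiff_newton_set_poly[of z, OF assms(1)]
  by (simp add: finite_order_le)

text \<open>Here the nodes \<open>Y\<close> are arbitrary: at top order, every multi-index other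
  than \<open>dd_type Y\<close> is too low in some direction.\<close>

lemma divdiff_newton_top:
  assumes "node_sets Y"
  shows "dd Y (newton z (dd_order Y) f) = dd (newton_set z (dd_type Y)) f"
proof -
  have "dd Y (newton z (dd_order Y) f)
    = (\<Sum>\<gamma> | (\<Sum>i\<in>UNIV. \<gamma> i) \<le> dd_order Y. if \<gamma> = dd_type Y then dd (newton_set z \<gamma>) f else 0)"
    unfolding newton_def divdiff_sum
    using sum_le_ex_less by (intro sum.cong refl divdiff_newton_poly assms) blast
  then show ?thesis by (simp add: finite_order_le)
qed

text \<open>
  Exchanging the elements of \<open>Y\<close> one at a time for interpolation nodes, where the divided
  differences of the error vanish, costs a factor \<open>d\<close> and one order of differentiation.
\<close>

lemma newton_error_cell:
  fixes X :: "'n::finite \<Rightarrow> 'k set"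
  assumes d: "0 < d" and e: "0 \<le> e" and X: "same_cell d X"
    and z: "\<And>i. inj_on (z i) {..r}" "\<And>i k. k \<le> r \<Longrightarrow> z i k \<in> X i"
    and osc: "\<And>Y. node_sets Y \<Longrightarrow> (\<And>i. Y i \<subseteq> X i) \<Longrightarrow> dd_order Y = r
      \<Longrightarrow> q (dd Y f - dd (newton_set z (dd_type Y)) f) \<le> e"
    and Y: "node_sets Y" "\<And>i. Y i \<subseteq> X i" "dd_order Y \<le> r"
  shows "q (dd Y (\<lambda>x. f x - newton z r f x)) * d ^ dd_order Y \<le> e * d ^ r"
proof -
  define h where "h = (\<lambda>x. f x - newton z r f x)"
  have le: "dd_type Y i \<le> dd_order Y" for Y :: "'n \<Rightarrow> 'k set" and i
    by (rule member_le_sum) auto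
  have "q (dd Y h) * d ^ dd_order Y \<le> e * d ^ r"
    using Y
  \<comment> \<open>Descending induction on the order; at the top, the error is the difference
    between two divided differences of \<open>f\<close> of equal type.\<close>
  proof (induction "r - dd_order Y" arbitrary: Y)
    case 0
    then have r: "dd_order Y = r" by simp
    have "dd Y h = dd Y f - dd (newton_set z (dd_type Y)) f"
      unfolding h_def divdiff_diff using divdiff_newton_top[OF 0(2), of z f] r by simp
    then have "q (dd Y h) \<le> e" using osc[OF 0(2,3) r] by simp
    then show ?case unfolding r using d by (intro mult_right_mono) auto
  next
    case (Suc n)
    define \<gamma> where "\<gamma> = dd_type Y"
    define m where "m = dd_order Y"
    have m: "m < r" using Suc.hyps(2) by (simp add: m_def)
    have \<gamma>: "\<gamma> i \<le> r" for i using le[of Y i] m by (simp add: \<gamma>_def m_def)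
    let ?Z = "newton_set z \<gamma>"
    have inj: "inj_on (z i) {..\<gamma> i}" for i using inj_on_subset[OF z(1)] \<gamma>[of i] by fastforce
    have Z: "node_sets ?Z" "dd_type ?Z = \<gamma>"
      using node_sets_newton dd_type_newton[of z \<gamma>, OF inj] by auto
    have ZX: "?Z i \<subseteq> X i" for i
      using z(2) order_trans[OF _ \<gamma>] by (auto simp: newton_set_def)
    have "q (dd W h) * d ^ m \<le> e * d ^ r"
      if "node_sets W" "\<And>i. W i \<subseteq> X i" "dd_type W = \<gamma>" for W
      using that
    \<comment> \<open>The number of elements still to be exchanged. When none is left, equal
      cardinalities force \<open>W = ?Z\<close>, where the error vanishes.\<close>
    proof (induction "\<Sum>i\<in>UNIV. card (W i - ?Z i)" arbitrary: W rule: less_induct)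
      case less
      have m_W: "dd_order W = m" by (simp add: less.prems(3) m_def \<gamma>_def)
      have fin: "finite (W i)" "finite (?Z i)" for i
        using less.prems(1) Z(1) by (simp_all add: node_sets_def)
      have card: "card (W i) = card (?Z i)" for i
        using dd_type_eq_iff[OF less.prems(1), of i "\<gamma> i"] dd_type_eq_iff[OF Z(1), of i "\<gamma> i"]
        by (simp add: less.prems(3) Z(2))
      show ?case
      proof (cases "\<forall>i. W i \<subseteq> ?Z i")
        case True
        then have "W = ?Z" using card fin by (intro ext card_subset_eq) auto
        then have "dd W h = 0"
          using m divdiff_newton_interpolates[of z \<gamma> r f, OF inj]
          unfolding h_def divdiff_diff by (simp add: m_def \<gamma>_def)
        then show ?thesis using e d by simp
      next
        case False
        then obtain i u where u: "u \<in> W i" "u \<notin> ?Z i" by blast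
        have "\<not> ?Z i \<subseteq> W i" using card_subset_eq[OF fin(1)[of i]] card[of i] u by metis
        then obtain w where w: "w \<in> ?Z i" "w \<notin> W i" by blast
        \<comment> \<open>\<open>?V\<close> has one order more and is covered by the outer
          induction, \<open>?W\<close> is one exchange closer to \<open>?Z\<close>; the recursion on
          \<open>?V\<close> expresses the divided difference on \<open>W\<close> through these
          two.\<close>
        let ?V = "W(i := insert w (W i))"
        let ?W = "W(i := insert w (W i - {u}))"
        have V: "node_sets ?V" "dd_order ?V = Suc m" "\<And>j. ?V j \<subseteq> X j"
          using node_sets_insert[OF less.prems(1)] dd_order_insert[of W w i, OF less.prems(1) w(2)]
            m_W less.prems(2) subsetD[OF ZX w(1)] by auto
        have "n = r - dd_order ?V" "dd_order ?V \<le> r"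
          unfolding V(2) using Suc.hyps(2) m by (simp_all add: m_def)
        from Suc.hyps(1)[OF this(1) V(1,3) this(2)]
        have IH: "q (dd ?V h) * d ^ Suc m \<le> e * d ^ r" unfolding V(2) .
        have uw: "u \<in> ?V i" "w \<in> ?V i" "u \<noteq> w" using u w by auto
        have Vw: "?V(i := ?V i - {w}) = W" "?V(i := ?V i - {u}) = ?W"
          using w u by (auto simp: fun_eq_iff)
        have "dist u w \<le> d"
          using X uw(1,2) V(3) unfolding same_cell_def by blast
        then have "q (smul (u - w) (dd ?V h)) * d ^ m \<le> d * q (dd ?V h) * d ^ m"
          unfolding q_smul using d by (intro mult_right_mono) (auto simp: dist_absval)
        with IH have 1: "q (smul (u - w) (dd ?V h)) * d ^ m \<le> e * d ^ r" by (simp add: mult_ac)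
        have W: "node_sets ?W" "\<And>j. ?W j \<subseteq> X j" "dd_type ?W = \<gamma>"
        proof -
          have "card (?W j) = card (W j)" for j
            using u w fin(1)[of i] card_Suc_Diff1[OF fin(1) u(1)]
            by (cases "j = i") (simp_all add: card_insert_if)
          then show "dd_type ?W = \<gamma>" using less.prems(3) by (auto simp: dd_type_def fun_eq_iff)
        qed (use less.prems(1,2) subsetD[OF ZX w(1)] in \<open>auto simp: node_sets_def split: if_splits\<close>)
        have "card (?W j - ?Z j) \<le> card (W j - ?Z j)" for j
          using w fin(1)[of j] by (intro card_mono) auto
        moreover have "card (?W i - ?Z i) < card (W i - ?Z i)"
        proof (rule psubset_card_mono)
          show "finite (W i - ?Z i)" using fin(1) by blast
          show "?W i - ?Z i \<subset> W i - ?Z i" using u w by auto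
        qed
        ultimately have "(\<Sum>j\<in>UNIV. card (?W j - ?Z j)) < (\<Sum>j\<in>UNIV. card (W j - ?Z j))"
          by (intro sum_strict_mono_ex1) auto
        from less.hyps[OF this W] have 2: "q (dd ?W h) * d ^ m \<le> e * d ^ r" .
        have "dd W h = smul (u - w) (dd ?V h) + dd ?W h"
          using divdiff_rec[OF V(1) uw, of h] unfolding Vw by (metis diff_add_cancel)
        then have "q (dd W h) \<le> max (q (smul (u - w) (dd ?V h))) (q (dd ?W h))" using q_add by metis
        then have "q (dd W h) * d ^ m \<le> max (q (smul (u - w) (dd ?V h))) (q (dd ?W h)) * d ^ m"
          using d by (intro mult_right_mono) auto
        also have "\<dots> \<le> e * d ^ r" using 1 2 by (simp add: max_def)
        finally show ?thesis .
      qed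
    qed
    from this[OF Suc.prems(1,2)] show ?case by (simp add: \<gamma>_def m_def)
  qed
  then show ?thesis by (simp add: h_def)
qed

text \<open>The point \<open>a\<close> enters only through its ball, so all points of a ball get the
  same nodes. This makes \<open>newton_cell\<close> polynomial on every cell.\<close>

definition cell_nodes :: "('n \<Rightarrow> 'k set) \<Rightarrow> real \<Rightarrow> nat \<Rightarrow> 'n \<Rightarrow> 'k \<Rightarrow> nat \<Rightarrow> 'k" where
  "cell_nodes X d r i a = (SOME z. inj_on z {..r} \<and> z ` {..r} \<subseteq> X i \<inter> cball a d)"

definition newton_cell ::
    "('n::finite \<Rightarrow> 'k set) \<Rightarrow> real \<Rightarrow> nat \<Rightarrow> (('n \<Rightarrow> 'k) \<Rightarrow> 'e) \<Rightarrow> ('n \<Rightarrow> 'k) \<Rightarrow> 'e" where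
  "newton_cell X d r f x = newton (\<lambda>i. cell_nodes X d r i (x i)) r f x"

lemma cell_nodes_cong: "dist a b \<le> d \<Longrightarrow> cell_nodes X d r i a = cell_nodes X d r i b"
  unfolding cell_nodes_def by (simp add: cball_ultra_eq)

lemma cell_nodes:
  assumes "infinite (X i \<inter> cball a d)"
  shows "inj_on (cell_nodes X d r i a) {..r}" "k \<le> r \<Longrightarrow> cell_nodes X d r i a k \<in> X i \<inter> cball a d"
proof -
  obtain z where "inj (z :: nat \<Rightarrow> 'k)" "range z \<subseteq> X i \<inter> cball a d"
    using infinite_countable_subset[OF assms] by blast
  then have "\<exists>z. inj_on z {..r} \<and> z ` {..r} \<subseteq> X i \<inter> cball a d"
    by (intro exI[of _ z]) (auto intro: inj_on_subset)
  from someI_ex[OF this]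
  show "inj_on (cell_nodes X d r i a) {..r}" "k \<le> r \<Longrightarrow> cell_nodes X d r i a k \<in> X i \<inter> cball a d"
    unfolding cell_nodes_def by auto
qed

text \<open>After gluing, all nodes lie in one cell, where \<open>newton_cell\<close> is Newton
  interpolation with fixed nodes. The oscillation is asked for at the top order only, since lower
  orders are reached by exchanging nodes.\<close>

theorem newton_cell_error:
  fixes X :: "'n::finite \<Rightarrow> 'k set"
  assumes d: "0 < d" and e: "0 \<le> e" and X: "\<And>i x. x \<in> X i \<Longrightarrow> infinite (X i \<inter> cball x d)"
    and osc: "\<And>Y Y'. node_sets Y \<Longrightarrow> node_sets Y' \<Longrightarrow> (\<And>i. Y i \<union> Y' i \<subseteq> X i)
      \<Longrightarrow> dd_type Y = dd_type Y' \<Longrightarrow> dd_order Y = r \<Longrightarrow> same_cell d (\<lambda>i. Y i \<union> Y' i)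
      \<Longrightarrow> q (dd Y f - dd Y' f) \<le> e"
  shows "dd_bound r X d (e * d ^ r) (\<lambda>x. f x - newton_cell X d r f x)"
proof (rule dd_bound_glue[OF d])
  fix Y :: "'n \<Rightarrow> 'k set"
  assume Y: "node_sets Y" "\<And>i. Y i \<subseteq> X i" "same_cell d Y"
  obtain y where y: "y \<in> node_box Y" using node_box_nonempty[OF Y(1)] by blast
  define z where "z = (\<lambda>i. cell_nodes X d r i (y i))"
  have inf: "infinite (X i \<inter> cball (y i) d)" for i
    using X[of "y i" i] y Y(2) by (auto simp: node_box_def)
  have z: "inj_on (z i) {..r}" "k \<le> r \<Longrightarrow> z i k \<in> X i \<inter> cball (y i) d" for i k
    unfolding z_def using cell_nodes[of X i "y i" d, OF inf] by blast+
  \<comment> \<open>The interpolation nodes may lie outside the finite sets \<open>Y i\<close>, so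
    the estimate is made on the whole cell.\<close>
  let ?X = "\<lambda>i. X i \<inter> cball (y i) d"
  have sc: "same_cell d ?X"
    unfolding same_cell_def
  proof (intro allI ballI)
    fix i s t assume "s \<in> ?X i" "t \<in> ?X i"
    then show "dist s t \<le> d" using dist_ultra[of s "y i" d t] by (simp add: dist_commute)
  qed
  have YX: "Y i \<subseteq> ?X i" for i
  proof
    fix s assume s: "s \<in> Y i"
    then have "dist (y i) s \<le> d" using Y(3) y unfolding same_cell_def node_box_def by blast
    then show "s \<in> ?X i" using s Y(2) by auto
  qed
  have nz: "newton_cell X d r f s = newton z r f s" if "s \<in> node_box Y" for s
  proof -
    have "dist (s i) (y i) \<le> d" for i
      using that y Y(3) unfolding same_cell_def node_box_def by blast
    then have "(\<lambda>i. cell_nodes X d r i (s i)) = z"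
      unfolding z_def by (intro ext cell_nodes_cong)
    then show ?thesis by (simp add: newton_cell_def)
  qed
  have "dd_bound r Y d (e * d ^ r) (\<lambda>x. f x - newton z r f x)"
    unfolding dd_bound_def
  proof (intro allI impI)
    fix W :: "'n \<Rightarrow> 'k set" assume W: "node_sets W" "\<forall>i. W i \<subseteq> Y i" "dd_order W \<le> r"
    show "q (dd W (\<lambda>x. f x - newton z r f x)) * d ^ dd_order W \<le> e * d ^ r"
    proof (rule newton_error_cell[OF d e sc z(1) z(2) _ W(1) _ W(3)])
      show "W i \<subseteq> ?X i" for i using W(2) YX by blast
      fix V :: "'n \<Rightarrow> 'k set" assume V: "node_sets V" "\<And>i. V i \<subseteq> ?X i" "dd_order V = r"
      have le: "dd_type V i \<le> r" for i
        unfolding V(3)[symmetric] by (rule member_le_sum) auto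
      have inj: "inj_on (z i) {..dd_type V i}" for i
        using inj_on_subset[OF z(1)] le[of i] by fastforce
      have sub: "newton_set z (dd_type V) i \<subseteq> ?X i" for i
        using z(2) le[of i] by (auto simp: newton_set_def)
      show "q (dd V f - dd (newton_set z (dd_type V)) f) \<le> e"
      proof (rule osc)
        show "dd_type V = dd_type (newton_set z (dd_type V))" using dd_type_newton[of z, OF inj] by simp
        show "V i \<union> newton_set z (dd_type V) i \<subseteq> X i" for i using V(2) sub by blast
        show "same_cell d (\<lambda>i. V i \<union> newton_set z (dd_type V) i)"
          using sc V(2) sub unfolding same_cell_def by blast
      qed (use V node_sets_newton in auto)
    qed
  qed
  then show "dd_bound r Y d (e * d ^ r) (\<lambda>x. f x - newton_cell X d r f x)"
    by (rule dd_bound_cong) (simp add: nz)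
qed

lemma poly_in_newton_poly:
  assumes "\<And>i. \<gamma> i \<noteq> 0 \<Longrightarrow> i \<in> I" "poly_in smul I f"
  shows "poly_in smul I (\<lambda>x. smul (newton_poly z \<gamma> x) (f x))"
  using assms(1)
proof (induction "\<Sum>i\<in>UNIV. \<gamma> i" arbitrary: \<gamma>)
  case 0
  then have "\<gamma> = (\<lambda>_. 0)" by auto
  then show ?case using assms(2) by (simp add: newton_poly_0)
next
  case (Suc n)
  then obtain i where "\<gamma> i \<noteq> 0" by (metis (mono_tags, lifting) nat.distinct(1) sum.neutral)
  then obtain k where k: "\<gamma> i = Suc k" using not0_implies_Suc by blast
  have "n = (\<Sum>j\<in>UNIV. (\<gamma>(i := k)) j)" using sum_fun_upd[of \<gamma> i k] Suc.hyps(2) k by simp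
  then have "poly_in smul I (\<lambda>x. smul (newton_poly z (\<gamma>(i := k)) x) (f x))"
    by (rule Suc.hyps(1)) (use Suc.prems k in \<open>auto split: if_splits\<close>)
  then have "poly_in smul I (\<lambda>x. smul (x i - z i k) (smul (newton_poly z (\<gamma>(i := k)) x) (f x)))"
    using Suc.prems k by (intro poly_in_linear) auto
  then show ?case by (simp add: newton_poly_Suc[of \<gamma> i k, OF k])
qed

lemma locally_poly_newton_cell: "locally_poly_in smul UNIV d (newton_cell X d r f)"
  unfolding locally_poly_in_def
proof (intro allI)
  fix c :: "'a \<Rightarrow> 'k"
  let ?p = "newton (\<lambda>i. cell_nodes X d r i (c i)) r f"
  have "poly_in smul UNIV ?p"
    unfolding newton_def by (intro poly_in_sum poly_in_newton_poly poly_in_const) auto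
  moreover have "newton_cell X d r f x = ?p x" if "\<forall>i\<in>UNIV. dist (x i) (c i) \<le> d" for x
    using that cell_nodes_cong[of "x i" "c i" d X r i for i] by (simp add: newton_cell_def)
  ultimately show "\<exists>p. poly_in smul UNIV p \<and> (\<forall>x. (\<forall>i\<in>UNIV. dist (x i) (c i) \<le> d) \<longrightarrow> newton_cell X d r f x = p x)"
    by blast
qed

end

section \<open>Interpolation in one variable after the other\<close>

context ultrametric_seminorm
begin

text \<open>The other variables are parameters; one-variable interpolation is the general one with
  index type \<open>unit\<close>.\<close>

definition newton_dir ::
    "('n::finite \<Rightarrow> 'k set) \<Rightarrow> real \<Rightarrow> nat \<Rightarrow> 'n \<Rightarrow> (('n \<Rightarrow> 'k) \<Rightarrow> 'e) \<Rightarrow> ('n \<Rightarrow> 'k) \<Rightarrow> 'e" where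
  "newton_dir X d r i F x =
     newton_cell (\<lambda>_::unit. X i) d r (\<lambda>t. F (x(i := t ()))) (\<lambda>_. x i)"

lemma divdiff_swap:
  "dd Z (\<lambda>u. dd W (\<lambda>s. G u s)) = dd W (\<lambda>s. dd Z (\<lambda>u. G u s))"
  unfolding divdiff_def scale_sum_right
  by (subst sum.swap) (simp add: mult.commute)

text \<open>A direction with a single node contributes an empty product, so that node is merely
  substituted. Moving it into the function frees the family of nodes from the variable of
  interpolation.\<close>

lemma divdiff_slice: "dd (Y(i := {u})) F = dd (Y(i := {t})) (\<lambda>s. F (s(i := u)))"
  unfolding divdiff_def
proof (rule sum.reindex_bij_witness[where i = "\<lambda>s. s(i := u)" and j = "\<lambda>s. s(i := t)"])
  fix s assume s: "s \<in> node_box (Y(i := {u}))"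
  have eq: "dd_coeff (Y(i := {v})) x = (\<Prod>j\<in>UNIV - {i}. \<Prod>t\<in>Y j - {x j}. 1 / (x j - t))"
    if "x i = v" for v x
  proof -
    have "dd_coeff (Y(i := {v})) x = (\<Prod>j\<in>UNIV - {i}. \<Prod>t\<in>(Y(i := {v})) j - {x j}. 1 / (x j - t))"
      using that by (simp add: dd_coeff_def prod.remove[of UNIV i])
    also have "\<dots> = (\<Prod>j\<in>UNIV - {i}. \<Prod>t\<in>Y j - {x j}. 1 / (x j - t))"
      by (rule prod.cong) auto
    finally show ?thesis .
  qed
  have si: "s i = u" using s by (auto simp: node_box_def split: if_splits)
  have "(\<Prod>j\<in>UNIV - {i}. \<Prod>w\<in>Y j - {(s(i := t)) j}. 1 / ((s(i := t)) j - w))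
    = (\<Prod>j\<in>UNIV - {i}. \<Prod>w\<in>Y j - {s j}. 1 / (s j - w))"
    by (rule prod.cong) auto
  then have "dd_coeff (Y(i := {t})) (s(i := t)) = dd_coeff (Y(i := {u})) s"
    using eq[of "s(i := t)" t] eq[of s u] si by simp
  moreover have "(s(i := t))(i := u) = s" using si by auto
  ultimately show "smul (dd_coeff (Y(i := {t})) (s(i := t))) (F ((s(i := t))(i := u))) = smul (dd_coeff (Y(i := {u})) s) (F s)"
    by (simp only:)
qed (auto simp: node_box_def split: if_splits)

lemma newton_divdiff: "newton z r (\<lambda>u. dd W (\<lambda>s. G u s)) t = dd W (\<lambda>s. newton z r (\<lambda>u. G u s) t)"
  unfolding newton_def divdiff_sum divdiff_scale divdiff_swap[of _ W] ..

text \<open>Interpolation in direction \<open>i\<close> commutes with divided differences in the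
  other directions, as both are finite linear combinations of values. By Fubini it then acts on a
  function of one variable.\<close>

lemma divdiff_newton_dir:
  assumes "node_sets Y"
  shows "dd Y (newton_dir X d r i F)
    = dd (\<lambda>_::unit. Y i) (newton_cell (\<lambda>_. X i) d r (\<lambda>t. dd (Y(i := {t ()})) F))"
proof -
  have "dd (Y(i := {t ()})) (newton_dir X d r i F)
    = newton_cell (\<lambda>_. X i) d r (\<lambda>t. dd (Y(i := {t ()})) F) t" for t :: "unit \<Rightarrow> 'k"
  proof -
    have t: "(\<lambda>_. t ()) = t" by auto
    have "dd (Y(i := {t ()})) (newton_dir X d r i F)
      = dd (Y(i := {t ()})) (\<lambda>s. newton_cell (\<lambda>_::unit. X i) d r (\<lambda>u. F (s(i := u ()))) t)"
    proof (rule divdiff_cong)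
      fix s assume "s \<in> node_box (Y(i := {t ()}))"
      then have "s i = t ()" by (auto simp: node_box_def split: if_splits)
      then show "newton_dir X d r i F s = newton_cell (\<lambda>_::unit. X i) d r (\<lambda>u. F (s(i := u ()))) t"
        by (simp add: newton_dir_def t)
    qed
    also have "\<dots> = newton_cell (\<lambda>_::unit. X i) d r (\<lambda>u. dd (Y(i := {t ()})) (\<lambda>s. F (s(i := u ())))) t"
      unfolding newton_cell_def newton_divdiff ..
    also have "\<dots> = newton_cell (\<lambda>_::unit. X i) d r (\<lambda>u. dd (Y(i := {u ()})) F) t"
      by (simp only: divdiff_slice[of Y i _ F "t ()"])
    finally show ?thesis .
  qed
  then show ?thesis by (subst divdiff_fubini[OF assms, of _ i]) simp
qed

lemma newton_dir_diff: "newton_dir X d r i (\<lambda>x. F x - G x) x = newton_dir X d r i F x - newton_dir X d r i G x"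
  by (simp add: newton_dir_def newton_cell_def newton_def divdiff_diff scale_right_diff_distrib sum_subtractf)

text \<open>The one-variable estimate applied to slices. The families compared differ in direction
  \<open>i\<close> only, where their order is raised to \<open>\<beta> i\<close>; this keeps them in
  the box of orders up to \<open>\<beta>\<close>. The surplus power of \<open>d\<close> is discarded
  because \<open>d \<le> 1\<close>.\<close>

lemma newton_dir_error:
  fixes X :: "'n::finite \<Rightarrow> 'k set"
  assumes d: "0 < d" "d \<le> 1" and e: "0 \<le> e" and X: "\<And>i x. x \<in> X i \<Longrightarrow> infinite (X i \<inter> cball x d)"
    and osc: "\<And>Y Y'. node_sets Y \<Longrightarrow> node_sets Y' \<Longrightarrow> (\<And>j. Y j \<union> Y' j \<subseteq> X j)
      \<Longrightarrow> dd_type Y = dd_type Y' \<Longrightarrow> dd_type Y \<le> \<beta> \<Longrightarrow> same_cell d (\<lambda>_::unit. Y i \<union> Y' i)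
      \<Longrightarrow> (\<And>j. j \<noteq> i \<Longrightarrow> Y j = Y' j) \<Longrightarrow> q (dd Y f - dd Y' f) \<le> e"
    and Y: "node_sets Y" "\<And>j. Y j \<subseteq> X j" "dd_type Y \<le> \<beta>"
  shows "q (dd Y (\<lambda>x. f x - newton_dir X d (\<beta> i) i f x)) \<le> e"
proof -
  let ?g = "\<lambda>t::unit \<Rightarrow> 'k. dd (Y(i := {t ()})) f"
  have slice: "dd W ?g = dd (Y(i := W ())) f" if "node_sets W" for W :: "unit \<Rightarrow> 'k set"
  proof -
    have "node_sets (Y(i := W ()))" using Y(1) that by (auto simp: node_sets_def)
    moreover have "(\<lambda>_. W ()) = W" by auto
    ultimately show ?thesis using divdiff_fubini[of "Y(i := W ())" f i] by simp
  qed
  have "dd_bound (\<beta> i) (\<lambda>_::unit. X i) d (e * d ^ \<beta> i) (\<lambda>t. ?g t - newton_cell (\<lambda>_. X i) d (\<beta> i) ?g t)"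
  proof (rule newton_cell_error[OF d(1) e])
    fix W W' :: "unit \<Rightarrow> 'k set"
    assume W: "node_sets W" "node_sets W'" "\<And>j. W j \<union> W' j \<subseteq> X i" "dd_type W = dd_type W'"
      "dd_order W = \<beta> i" "same_cell d (\<lambda>j. W j \<union> W' j)"
    have ty: "dd_type (Y(i := V ())) = (dd_type Y)(i := dd_type V ())" for V :: "unit \<Rightarrow> 'k set"
      by (auto simp: dd_type_def fun_eq_iff)
    show "q (dd W ?g - dd W' ?g) \<le> e"
      unfolding slice[OF W(1)] slice[OF W(2)]
    proof (rule osc)
      show "node_sets (Y(i := W ()))" "node_sets (Y(i := W' ()))"
        using Y(1) W(1,2) by (auto simp: node_sets_def)
      show "dd_type (Y(i := W ())) = dd_type (Y(i := W' ()))" unfolding ty W(4) ..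
      have "dd_type W () = \<beta> i" using W(5) by (simp add: UNIV_unit)
      then show "dd_type (Y(i := W ())) \<le> \<beta>" unfolding ty using Y(3) by (auto simp: le_fun_def)
      show "(Y(i := W ())) j \<union> (Y(i := W' ())) j \<subseteq> X j" for j using Y(2) W(3) by auto
      show "same_cell d (\<lambda>_::unit. (Y(i := W ())) i \<union> (Y(i := W' ())) i)"
        using W(6) by (simp add: same_cell_def)
    qed simp
  qed (rule X)
  then have "q (dd (\<lambda>_::unit. Y i) (\<lambda>t. ?g t - newton_cell (\<lambda>_. X i) d (\<beta> i) ?g t)) * d ^ dd_type Y i \<le> e * d ^ \<beta> i"
    using dd_boundD[of "\<beta> i" "\<lambda>_::unit. X i" d _ _ "\<lambda>_. Y i"] Y
    by (auto simp: node_sets_def dd_type_def le_fun_def)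
  moreover have "dd (\<lambda>_::unit. Y i) (\<lambda>t. ?g t - newton_cell (\<lambda>_. X i) d (\<beta> i) ?g t)
    = dd Y (\<lambda>x. f x - newton_dir X d (\<beta> i) i f x)"
    unfolding divdiff_diff divdiff_newton_dir[OF Y(1)] divdiff_fubini[OF Y(1), of f i] ..
  ultimately have "q (dd Y (\<lambda>x. f x - newton_dir X d (\<beta> i) i f x)) * d ^ dd_type Y i \<le> e * d ^ \<beta> i"
    by simp
  also have "e * d ^ \<beta> i \<le> e * d ^ dd_type Y i"
    using d e Y(3) by (intro mult_left_mono power_decreasing) (auto simp: le_fun_def)
  finally show ?thesis using d by simp
qed

text \<open>After the substitution nothing depends on \<open>x i\<close>, so \<open>i\<close> can
  join the polynomial variables.\<close>

lemma poly_in_slice: "poly_in smul I p \<Longrightarrow> i \<notin> I \<Longrightarrow> poly_in smul (insert i I) (\<lambda>x. p (x(i := t)))"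
proof (induction rule: poly_in.induct)
  case (indep g)
  show ?case by (rule poly_in.indep, rule indep) auto
next
  case (mult j f)
  have "poly_in smul (insert i I) (\<lambda>x. smul (x j) (f (x(i := t))))"
    by (intro poly_in.mult insertI2 mult.hyps mult.IH mult.prems)
  moreover have "(x(i := t)) j = x j" for x :: "'a \<Rightarrow> 'k" using mult by auto
  ultimately show ?case by (simp only:)
qed (auto intro: poly_in.add)

lemma poly_in_newton_poly_dir:
  fixes z :: "unit \<Rightarrow> nat \<Rightarrow> 'k"
  assumes "i \<in> I" "poly_in smul I f"
  shows "poly_in smul I (\<lambda>x. smul (newton_poly z \<gamma> (\<lambda>_. x i)) (f x))"
proof -
  have "poly_in smul I (\<lambda>x. smul (\<Prod>k<m. x i - z () k) (f x))" for m
  proof (induction m)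
    case (Suc m)
    then have "poly_in smul I (\<lambda>x. smul (x i - z () m) (smul (\<Prod>k<m. x i - z () k) (f x)))"
      using assms(1) by (intro poly_in_linear)
    then show ?case by (simp add: mult.commute)
  qed (use assms(2) in simp)
  then show ?thesis by (simp add: newton_poly_def UNIV_unit)
qed

text \<open>The coefficients of the interpolation polynomial in \<open>x i\<close> are linear
  combinations of slices of \<open>F\<close>, which stay polynomial in the variables of
  \<open>I\<close> on the same balls.\<close>

lemma locally_poly_newton_dir:
  fixes F :: "('n::finite \<Rightarrow> 'k) \<Rightarrow> 'e"
  assumes "locally_poly_in smul I d F" "i \<notin> I"
  shows "locally_poly_in smul (insert i I) d (newton_dir X d r i F)"
  unfolding locally_poly_in_def
proof (intro allI)
  fix c :: "'n \<Rightarrow> 'k"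
  obtain p where p: "poly_in smul I p" "\<And>x. \<forall>j\<in>I. dist (x j) (c j) \<le> d \<Longrightarrow> F x = p x"
    using assms(1) unfolding locally_poly_in_def by blast
  let ?z = "\<lambda>j::unit. cell_nodes (\<lambda>_::unit. X i) d r j (c i)"
  let ?P = "\<lambda>x. newton ?z r (\<lambda>t. p (x(i := t ()))) (\<lambda>_. x i)"
  have "poly_in smul (insert i I) ?P"
    unfolding newton_def
    by (intro poly_in_sum poly_in_newton_poly_dir, simp, unfold divdiff_def)
       (intro poly_in_sum poly_in_smul poly_in_slice p(1) assms(2))
  moreover have "newton_dir X d r i F x = ?P x" if x: "\<forall>j\<in>insert i I. dist (x j) (c j) \<le> d" for x
  proof -
    have "F (x(i := t)) = p (x(i := t))" for t using x assms(2) by (intro p(2)) auto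
    moreover have "cell_nodes (\<lambda>_::unit. X i) d r j (x i) = ?z j" for j
      using x by (intro cell_nodes_cong) auto
    ultimately show ?thesis by (simp add: newton_dir_def newton_cell_def)
  qed
  ultimately show "\<exists>p. poly_in smul (insert i I) p \<and> (\<forall>x. (\<forall>j\<in>insert i I. dist (x j) (c j) \<le> d) \<longrightarrow> newton_dir X d r i F x = p x)"
    by blast
qed

text \<open>Induction over the directions, from \<open>f\<close> itself, which is a polynomial in no
  variables. Oscillation hypothesis and conclusion have the same form as in
  \<open>isotropic_newton\<close>, so that both results fit one localisation argument.\<close>

theorem tensor_newton:
  fixes X :: "'n::finite \<Rightarrow> 'k set"
  assumes d: "0 < d" "d \<le> 1" and e: "0 \<le> e" and X: "\<And>i x. x \<in> X i \<Longrightarrow> infinite (X i \<inter> cball x d)"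
    and osc: "\<And>Y Y'. node_sets Y \<Longrightarrow> node_sets Y' \<Longrightarrow> (\<And>j. Y j \<union> Y' j \<subseteq> X j)
      \<Longrightarrow> dd_type Y = dd_type Y' \<Longrightarrow> dd_type Y \<le> \<beta>
      \<Longrightarrow> (\<And>j. Y j = Y' j \<or> same_cell d (\<lambda>_::unit. Y j \<union> Y' j)) \<Longrightarrow> q (dd Y f - dd Y' f) \<le> e"
  shows "\<exists>F. locally_poly_in smul UNIV d F \<and>
    (\<forall>Y. node_sets Y \<longrightarrow> (\<forall>j. Y j \<subseteq> X j) \<longrightarrow> dd_type Y \<le> \<beta> \<longrightarrow> q (dd Y (\<lambda>x. f x - F x)) \<le> e)"
proof -
  have "\<exists>F. locally_poly_in smul I d F \<and>
    (\<forall>Y. node_sets Y \<longrightarrow> (\<forall>j. Y j \<subseteq> X j) \<longrightarrow> dd_type Y \<le> \<beta> \<longrightarrow> q (dd Y (\<lambda>x. f x - F x)) \<le> e)"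
    if "finite I" for I :: "'n set"
    using that
  proof (induction I rule: finite_induct)
    case empty
    have "poly_in smul {} f" by (rule poly_in.indep) (metis empty_iff ext)
    then have "locally_poly_in smul {} d f" by (auto simp: locally_poly_in_def)
    then show ?case using e by (intro exI[of _ f]) (simp add: divdiff_zero)
  next
    case (insert i I)
    then obtain F where F: "locally_poly_in smul I d F" "\<And>Y. node_sets Y \<Longrightarrow> (\<And>j. Y j \<subseteq> X j)
      \<Longrightarrow> dd_type Y \<le> \<beta> \<Longrightarrow> q (dd Y (\<lambda>x. f x - F x)) \<le> e" by blast
    let ?L = "newton_dir X d (\<beta> i) i"
    have "q (dd Y (\<lambda>x. f x - ?L F x)) \<le> e"
      if Y: "node_sets Y" "\<And>j. Y j \<subseteq> X j" "dd_type Y \<le> \<beta>" for Y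
    proof -
      have 1: "q (dd Y (\<lambda>x. f x - ?L f x)) \<le> e"
      proof (rule newton_dir_error[OF d e X _ Y])
        fix Y Y' :: "'n \<Rightarrow> 'k set"
        assume *: "node_sets Y" "node_sets Y'" "\<And>j. Y j \<union> Y' j \<subseteq> X j" "dd_type Y = dd_type Y'"
          "dd_type Y \<le> \<beta>" "same_cell d (\<lambda>_::unit. Y i \<union> Y' i)" "\<And>j. j \<noteq> i \<Longrightarrow> Y j = Y' j"
        show "q (dd Y f - dd Y' f) \<le> e"
        proof (rule osc[OF *(1-5)])
          fix j show "Y j = Y' j \<or> same_cell d (\<lambda>_::unit. Y j \<union> Y' j)"
            using *(6,7) by (cases "j = i") auto
        qed
      qed
      \<comment> \<open>The ultrametric inequality bounds any oscillation of \<open>f - F\<close> by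
        its size, which is at most \<open>e\<close> already.\<close>
      have 2: "q (dd Y (\<lambda>x. (f x - F x) - ?L (\<lambda>x. f x - F x) x)) \<le> e"
      proof (rule newton_dir_error[OF d e X _ Y])
        fix Y Y' :: "'n \<Rightarrow> 'k set"
        assume *: "node_sets Y" "node_sets Y'" "\<And>j. Y j \<union> Y' j \<subseteq> X j" "dd_type Y = dd_type Y'" "dd_type Y \<le> \<beta>"
        have "q (dd Y (\<lambda>x. f x - F x)) \<le> e" "q (dd Y' (\<lambda>x. f x - F x)) \<le> e"
          using * by (auto intro!: F(2))
        then show "q (dd Y (\<lambda>x. f x - F x) - dd Y' (\<lambda>x. f x - F x)) \<le> e"
          by (rule q_diff_le)
      qed
      have 3: "q (dd Y (\<lambda>x. f x - F x)) \<le> e" by (rule F(2)[OF Y])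
      \<comment> \<open>\<open>f - L F = (f - L f) + L (f - F)\<close>, where
        \<open>L (f - F)\<close> is written as \<open>f - F\<close> minus its interpolation error,
        because errors are what has been estimated.\<close>
      have "dd Y (\<lambda>x. f x - ?L F x) = dd Y (\<lambda>x. f x - ?L f x)
        + (dd Y (\<lambda>x. f x - F x) - dd Y (\<lambda>x. (f x - F x) - ?L (\<lambda>x. f x - F x) x))"
        by (simp add: newton_dir_diff divdiff_diff)
      then show ?thesis
        using q_add_le[OF 1 q_diff_le[OF 3 2]] by simp
    qed
    then show ?case using locally_poly_newton_dir[OF F(1) insert.hyps(2)] by blast
  qed
  then show ?thesis by simp
qed

theorem isotropic_newton:
  fixes X :: "'n::finite \<Rightarrow> 'k set"
  assumes d: "0 < d" "d \<le> 1" and e: "0 \<le> e" and X: "\<And>i x. x \<in> X i \<Longrightarrow> infinite (X i \<inter> cball x d)"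
    and osc: "\<And>Y Y'. node_sets Y \<Longrightarrow> node_sets Y' \<Longrightarrow> (\<And>j. Y j \<union> Y' j \<subseteq> X j)
      \<Longrightarrow> dd_type Y = dd_type Y' \<Longrightarrow> dd_order Y \<le> r
      \<Longrightarrow> (\<And>j. Y j = Y' j \<or> same_cell d (\<lambda>_::unit. Y j \<union> Y' j)) \<Longrightarrow> q (dd Y f - dd Y' f) \<le> e"
  shows "\<exists>F. locally_poly_in smul UNIV d F \<and>
    (\<forall>Y. node_sets Y \<longrightarrow> (\<forall>j. Y j \<subseteq> X j) \<longrightarrow> dd_order Y \<le> r \<longrightarrow> q (dd Y (\<lambda>x. f x - F x)) \<le> e)"
proof (intro exI conjI allI impI)
  show "locally_poly_in smul UNIV d (newton_cell X d r f)" by (rule locally_poly_newton_cell)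
  fix Y :: "'n \<Rightarrow> 'k set" assume Y: "node_sets Y" "\<forall>j. Y j \<subseteq> X j" "dd_order Y \<le> r"
  have "dd_bound r X d (e * d ^ r) (\<lambda>x. f x - newton_cell X d r f x)"
  proof (rule newton_cell_error[OF d(1) e X])
    fix Y Y' :: "'n \<Rightarrow> 'k set"
    assume *: "node_sets Y" "node_sets Y'" "\<And>j. Y j \<union> Y' j \<subseteq> X j" "dd_type Y = dd_type Y'"
      "dd_order Y = r" "same_cell d (\<lambda>j. Y j \<union> Y' j)"
    show "q (dd Y f - dd Y' f) \<le> e"
      using *(5,6) by (intro osc *(1-4)) (auto simp: same_cell_def)
  qed
  then have "q (dd Y (\<lambda>x. f x - newton_cell X d r f x)) * d ^ dd_order Y \<le> e * d ^ r"
    using Y by (intro dd_boundD) auto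
  also have "\<dots> \<le> e * d ^ dd_order Y"
    using d e Y(3) by (intro mult_left_mono power_decreasing) auto
  finally show "q (dd Y (\<lambda>x. f x - newton_cell X d r f x)) \<le> e" using d by simp
qed

end

section \<open>Localisation\<close>

lemma cell_sym: "x \<in> cell d y \<longleftrightarrow> y \<in> cell d x"
  by (simp add: cell_def dist_commute)

lemma cell_trans:
  fixes x :: "'n \<Rightarrow> 'k::ultrametric_field"
  shows "x \<in> cell d y \<Longrightarrow> y \<in> cell d z \<Longrightarrow> x \<in> cell d z"
  using dist_ultra unfolding cell_def by blast

lemma cell_mono: "d \<le> e \<Longrightarrow> cell d x \<subseteq> cell e x"
  unfolding cell_def by (auto intro: order_trans)

lemma locally_poly_in_mono:
  assumes "locally_poly_in smul I d F" "e \<le> d"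
  shows "locally_poly_in smul I e F"
  using assms unfolding locally_poly_in_def by (meson order_trans)

context ultrametric_seminorm
begin

text \<open>\<open>D\<close> is the set of admissible orders, closed downwards because gluing
  removes nodes. The grid of nodes ranges over a neighbourhood of \<open>C\<close>, since the
  distinct tuples that approximate a given tuple leave \<open>C\<close>. On each cell of radius
  \<open>d\<close> around a point of \<open>R\<close> the domain is contained in a box, and the
  local approximants there are assembled into one locally polynomial function.\<close>

lemma localised_poly_approx:
  fixes f :: "('n::finite \<Rightarrow> 'k) \<Rightarrow> 'e" and A :: "('n \<Rightarrow> 'k) \<Rightarrow> 'n \<Rightarrow> 'k set"
  assumes R: "finite R" "C \<subseteq> (\<Union>r\<in>R. cell d r)" and d: "0 < d" "d \<le> 1" and e: "0 < e"
    and A: "\<And>r. r \<in> R \<Longrightarrow> U \<inter> cell d r \<subseteq> node_box (A r)"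
    and D: "\<And>\<gamma> \<gamma>'. D \<gamma> \<Longrightarrow> \<gamma>' \<le> \<gamma> \<Longrightarrow> D \<gamma>'" "\<And>\<gamma>. D \<gamma> \<Longrightarrow> (\<Sum>i\<in>UNIV. \<gamma> i) \<le> N"
    and loc: "\<And>r e. r \<in> R \<Longrightarrow> 0 < e \<Longrightarrow> \<exists>\<delta> F. 0 < \<delta> \<and> locally_poly_in smul UNIV \<delta> F \<and>
      (\<forall>Y. node_sets Y \<longrightarrow> D (dd_type Y) \<longrightarrow>
        (\<forall>i. Y i \<subseteq> A r i \<inter> (\<Union>c\<in>C \<inter> cell d r. cball (c i) \<delta>)) \<longrightarrow> q (dd Y (\<lambda>x. f x - F x)) \<le> e)"
    and bounded: "\<And>\<delta> i. 0 < \<delta> \<Longrightarrow> \<exists>T. finite T \<and> (\<lambda>c. c i) ` C \<subseteq> (\<Union>t\<in>T. cball t \<delta>)"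
  shows "\<exists>\<delta> P. 0 < \<delta> \<and> poly_in smul UNIV P \<and>
      (\<forall>Y. node_sets Y \<longrightarrow> D (dd_type Y) \<longrightarrow> node_box Y \<subseteq> U \<inter> (\<Union>c\<in>C. cell \<delta> c) \<longrightarrow>
        q (dd Y (\<lambda>x. f x - P x)) \<le> e)"
proof -
  define e' where "e' = e * d ^ N"
  have e': "0 < e'" using e d by (simp add: e'_def)
  define good where "good = (\<lambda>r \<delta> F. 0 < \<delta> \<and> locally_poly_in smul UNIV \<delta> F \<and>
      (\<forall>Y. node_sets Y \<longrightarrow> D (dd_type Y) \<longrightarrow>
        (\<forall>i. Y i \<subseteq> A r i \<inter> (\<Union>c\<in>C \<inter> cell d r. cball (c i) \<delta>)) \<longrightarrow> q (dd Y (\<lambda>x. f x - F x)) \<le> e'))"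
  have "\<forall>r\<in>R. \<exists>\<delta> F. good r \<delta> F"
    unfolding good_def using loc[OF _ e'] by blast
  then obtain \<delta>r Fr where good: "\<And>r. r \<in> R \<Longrightarrow> good r (\<delta>r r) (Fr r)"
    by metis
  then have Fr: "\<And>r. r \<in> R \<Longrightarrow> 0 < \<delta>r r" "\<And>r. r \<in> R \<Longrightarrow> locally_poly_in smul UNIV (\<delta>r r) (Fr r)"
    unfolding good_def by simp_all
  have Fr_err: "q (dd Y (\<lambda>x. f x - Fr r x)) \<le> e'"
    if "r \<in> R" "node_sets Y" "D (dd_type Y)"
      "\<And>i. Y i \<subseteq> A r i \<inter> (\<Union>c\<in>C \<inter> cell d r. cball (c i) (\<delta>r r))" for r Y
    using good[OF that(1)] that(2-4) unfolding good_def by blast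
  \<comment> \<open>At most \<open>d\<close>, so that a cell of radius \<delta> lies in one cell of
    radius \<open>d\<close>; at most each \<open>\<delta>r r\<close>, so that the chosen approximant
    is polynomial on it.\<close>
  define \<delta> where "\<delta> = Min (insert d (\<delta>r ` R))"
  have \<delta>: "0 < \<delta>" "\<delta> \<le> d" "\<And>r. r \<in> R \<Longrightarrow> \<delta> \<le> \<delta>r r"
    using R(1) d Fr(1) by (auto simp: \<delta>_def)
  \<comment> \<open>The choice depends only on the cell of radius \<open>d\<close> containing
    \<open>x\<close>. Together with the value 0 outside these cells this makes \<open>F\<close>
    locally polynomial everywhere.\<close>
  define rep where "rep = (\<lambda>x. SOME r. r \<in> R \<and> x \<in> cell d r)"
  define F where "F = (\<lambda>x. if \<exists>r. r \<in> R \<and> x \<in> cell d r then Fr (rep x) x else 0)"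
  have rep: "rep x \<in> R" "x \<in> cell d (rep x)" if "\<exists>r. r \<in> R \<and> x \<in> cell d r" for x
    using someI_ex[OF that] by (auto simp: rep_def)
  have same: "x \<in> cell d r \<longleftrightarrow> y \<in> cell d r" if "x \<in> cell d y" for x y r :: "'n \<Rightarrow> 'k"
    using that cell_trans[of x d y r] cell_trans[of y d x r] cell_sym by blast
  have FLP: "locally_poly_in smul UNIV \<delta> F"
    unfolding locally_poly_in_def
  proof (intro allI)
    fix c :: "'n \<Rightarrow> 'k"
    have cong: "(\<exists>r. r \<in> R \<and> x \<in> cell d r) = (\<exists>r. r \<in> R \<and> c \<in> cell d r)" "rep x = rep c"
      if "x \<in> cell \<delta> c" for x
    proof -
      have "x \<in> cell d c" using that cell_mono[OF \<delta>(2)] by blast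
      then have "(\<lambda>r. r \<in> R \<and> x \<in> cell d r) = (\<lambda>r. r \<in> R \<and> c \<in> cell d r)" using same by blast
      then show "(\<exists>r. r \<in> R \<and> x \<in> cell d r) = (\<exists>r. r \<in> R \<and> c \<in> cell d r)" "rep x = rep c"
        unfolding rep_def by metis+
    qed
    show "\<exists>p. poly_in smul UNIV p \<and> (\<forall>x. (\<forall>i\<in>UNIV. dist (x i) (c i) \<le> \<delta>) \<longrightarrow> F x = p x)"
    proof (cases "\<exists>r. r \<in> R \<and> c \<in> cell d r")
      case True
      then have "locally_poly_in smul UNIV \<delta> (Fr (rep c))"
        using Fr(2) locally_poly_in_mono \<delta>(3) rep(1) by blast
      then obtain p where p: "poly_in smul UNIV p" "\<And>x. x \<in> cell \<delta> c \<Longrightarrow> Fr (rep c) x = p x"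
        unfolding locally_poly_in_def cell_def by blast
      have "F x = p x" if "x \<in> cell \<delta> c" for x
        using p(2)[OF that] cong[OF that] True by (simp add: F_def)
      then show ?thesis using p(1) by (auto simp: cell_def)
    next
      case False
      then have "F x = 0" if "x \<in> cell \<delta> c" for x using False cong(1)[OF that] unfolding F_def by argo
      then show ?thesis using poly_in_const[of UNIV 0] by (auto simp: cell_def)
    qed
  qed
  let ?C = "\<Union>c\<in>C. cell \<delta> c"
  have FE: "q (dd Y (\<lambda>x. f x - F x)) \<le> e"
    if Y: "node_sets Y" "D (dd_type Y)" "node_box Y \<subseteq> U \<inter> ?C" for Y
  proof -
    have "q (dd Y (\<lambda>x. f x - F x)) * d ^ dd_order Y \<le> e'"
    \<comment> \<open>Gluing at the fixed scale \<open>d\<close>: nodes in one cell have a common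
      representative, so that only one local approximant is involved.\<close>
    proof (rule divdiff_glue[where P = "\<lambda>Y. node_sets Y \<and> D (dd_type Y) \<and> node_box Y \<subseteq> U \<inter> ?C"])
      show "node_sets Y \<and> D (dd_type Y) \<and> node_box Y \<subseteq> U \<inter> ?C" using Y by blast
    next
      fix Y i u assume Y: "node_sets Y \<and> D (dd_type Y) \<and> node_box Y \<subseteq> U \<inter> ?C" "u \<in> Y i" "0 < dd_type Y i"
      have "(dd_type Y)(i := dd_type Y i - 1) \<le> dd_type Y" by (auto simp: le_fun_def)
      then have "D (dd_type (Y(i := Y i - {u})))"
        using D(1) Y(1) unfolding dd_type_remove[of Y u i, OF conjunct1[OF Y(1)] Y(2)] by blast
      moreover have "node_box (Y(i := Y i - {u})) \<subseteq> node_box Y" by (rule node_box_mono) auto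
      ultimately show "node_sets (Y(i := Y i - {u})) \<and> D (dd_type (Y(i := Y i - {u})))
          \<and> node_box (Y(i := Y i - {u})) \<subseteq> U \<inter> ?C"
        using Y(1) node_sets_remove[OF conjunct1[OF Y(1)] Y(3)] by (meson order_trans)
    next
      fix Y assume Y: "node_sets Y \<and> D (dd_type Y) \<and> node_box Y \<subseteq> U \<inter> ?C" and sc: "same_cell d Y"
      have Yn: "node_sets Y" and YD: "D (dd_type Y)" and YU: "node_box Y \<subseteq> U" "node_box Y \<subseteq> ?C"
        using Y by auto
      obtain y where y: "y \<in> node_box Y" using node_box_nonempty[OF Yn] by blast
      then obtain c where c: "c \<in> C" "y \<in> cell \<delta> c" using YU(2) by blast
      then obtain r0 where "r0 \<in> R" "c \<in> cell d r0" using R(2) by blast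
      then have ex: "\<exists>r. r \<in> R \<and> y \<in> cell d r"
        using cell_trans[of y d c r0] cell_mono[OF \<delta>(2), of c] c by blast
      define r where "r = rep y"
      have r: "r \<in> R" "y \<in> cell d r" using rep[OF ex] by (simp_all add: r_def)
      have sy: "s \<in> cell d y" if "s \<in> node_box Y" for s
        using sc that y unfolding same_cell_def node_box_def cell_def by blast
      have Fs: "F s = Fr r s" if "s \<in> node_box Y" for s
      proof -
        have "(\<lambda>r. r \<in> R \<and> s \<in> cell d r) = (\<lambda>r. r \<in> R \<and> y \<in> cell d r)" using same[OF sy[OF that]] by blast
        then have "(\<exists>r. r \<in> R \<and> s \<in> cell d r) = (\<exists>r. r \<in> R \<and> y \<in> cell d r)" "rep s = r"
          unfolding rep_def r_def by (rule arg_cong)+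
        then show ?thesis using ex unfolding F_def by argo
      qed
      have "Y i \<subseteq> A r i \<inter> (\<Union>c\<in>C \<inter> cell d r. cball (c i) (\<delta>r r))" for i
      proof
        \<comment> \<open>Cells and the domain concern points, so the entry \<open>t\<close> is
          completed to a point \<open>s\<close> of the grid.\<close>
        fix t assume "t \<in> Y i"
        then obtain s where s: "s \<in> node_box Y" "s i = t" using node_box_through[OF Yn] by blast
        have sr: "s \<in> cell d r" using same[OF sy[OF s(1)]] r(2) by blast
        then have "s \<in> node_box (A r)" using A[OF r(1)] YU(1) s(1) by blast
        moreover obtain c where c: "c \<in> C" "s \<in> cell \<delta> c" using s(1) YU(2) by blast
        moreover have "c \<in> cell d r"
          using sr c(2) cell_mono[OF \<delta>(2), of c] same[of s c r] by blast
        moreover have "t \<in> cball (c i) (\<delta>r r)"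
        proof -
          have "dist (s i) (c i) \<le> \<delta>" using c(2) by (simp add: cell_def)
          then show ?thesis using s(2) \<delta>(3)[OF r(1)] by (simp add: dist_commute)
        qed
        ultimately show "t \<in> A r i \<inter> (\<Union>c\<in>C \<inter> cell d r. cball (c i) (\<delta>r r))"
          using s(2) by (auto simp: node_box_def)
      qed
      then have "q (dd Y (\<lambda>x. f x - Fr r x)) \<le> e'" by (intro Fr_err r(1) Yn YD)
      moreover have "dd Y (\<lambda>x. f x - F x) = dd Y (\<lambda>x. f x - Fr r x)"
        by (rule divdiff_cong) (simp add: Fs)
      moreover have "d ^ dd_order Y \<le> 1" using d by (intro power_le_one) auto
      ultimately show "q (dd Y (\<lambda>x. f x - F x)) * d ^ dd_order Y \<le> e'"
        using mult_mono[of "q (dd Y (\<lambda>x. f x - F x))" e' "d ^ dd_order Y" 1] e' d by simp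
    qed (use d in auto)
    also have "e' \<le> e * d ^ dd_order Y"
      unfolding e'_def using d e D(2)[OF Y(2)] by (intro mult_left_mono power_decreasing) auto
    finally show ?thesis using d by simp
  qed
  obtain T where T: "\<And>i. finite (T i)" "\<And>i. (\<lambda>c. c i) ` C \<subseteq> (\<Union>t\<in>T i. cball t \<delta>)"
    using bounded[OF \<delta>(1)] by metis
  let ?S = "\<lambda>i. \<Union>t\<in>T i. cball t \<delta>"
  have "0 < e * \<delta> ^ N" using e \<delta>(1) by simp
  then have "\<exists>P. poly_in smul UNIV P \<and> dd_bound N ?S \<delta> (e * \<delta> ^ N) (\<lambda>x. P x - F x)"
    by (rule locally_poly_approx[OF FLP \<delta>(1), where T = T]) (simp_all add: T(1))
  then obtain P where P: "poly_in smul UNIV P" "dd_bound N ?S \<delta> (e * \<delta> ^ N) (\<lambda>x. P x - F x)"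
    by blast
  have "q (dd Y (\<lambda>x. f x - P x)) \<le> e"
    if Y: "node_sets Y" "D (dd_type Y)" "node_box Y \<subseteq> U \<inter> ?C" for Y
  proof -
    have "Y i \<subseteq> ?S i" for i
    proof
      fix t assume "t \<in> Y i"
      then obtain s where s: "s \<in> node_box Y" "s i = t" using node_box_through[OF Y(1)] by blast
      then obtain c where c: "c \<in> C" "s \<in> cell \<delta> c" using Y(3) by blast
      then obtain w where w: "w \<in> T i" "c i \<in> cball w \<delta>" using T(2)[of i] by blast
      have "dist w t \<le> \<delta>" using dist_ultra[of w "c i" \<delta> t] w(2) c(2) s(2) by (auto simp: cell_def dist_commute)
      then show "t \<in> ?S i" using w(1) by auto
    qed
    then have "q (dd Y (\<lambda>x. P x - F x)) * \<delta> ^ dd_order Y \<le> e * \<delta> ^ N"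
      using Y D(2) by (intro dd_boundD[OF P(2)]) auto
    also have "\<dots> \<le> e * \<delta> ^ dd_order Y"
      using \<delta> d e D(2)[OF Y(2)] by (intro mult_left_mono power_decreasing) auto
    finally have "q (dd Y (\<lambda>x. P x - F x)) \<le> e" using \<delta>(1) by simp
    from q_diff_le[OF FE[OF Y] this] show ?thesis by (simp add: divdiff_diff)
  qed
  then show ?thesis using \<delta>(1) P(1) by blast
qed

end

text \<open>The Minkowski functional of \<open>M\<close>. The scalar 0 is excluded because
  \<open>inverse 0 = 0\<close> would make it admissible for every \<open>x\<close>.\<close>

definition gauge_seminorm :: "('k::ultrametric_field \<Rightarrow> 'e::ab_group_add \<Rightarrow> 'e) \<Rightarrow> 'e set \<Rightarrow> 'e \<Rightarrow> real" where
  "gauge_seminorm smul M x = Inf (absval ` {c. c \<noteq> 0 \<and> smul (inverse c) x \<in> M})"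

context topological_vector_space
begin

lemma open_vimage_smul: "open M \<Longrightarrow> open {c. smul c x \<in> M}" "open M \<Longrightarrow> open {y. smul c (y - x) \<in> M}"
proof -
  assume M: "open M"
  have 1: "continuous_on UNIV (\<lambda>c. (\<lambda>(c, x). smul c x) (c, x))"
    by (rule continuous_on_compose2[OF continuous_smul]) (auto intro!: continuous_intros)
  then show "open {c. smul c x \<in> M}"
    using open_vimage[OF M 1] by (simp add: vimage_def)
  have 2: "continuous_on UNIV (\<lambda>y. (\<lambda>(c, x). smul c x) (c, y - x))"
    by (rule continuous_on_compose2[OF continuous_smul]) (auto intro!: continuous_intros)
  then show "open {y. smul c (y - x) \<in> M}"
    using open_vimage[OF M 2] by (simp add: vimage_def)
qed

context
  fixes M assumes M: "open M" "ball_submodule smul M"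
begin

lemma submodule_add: "x \<in> M \<Longrightarrow> y \<in> M \<Longrightarrow> x + y \<in> M"
  and submodule_smul: "x \<in> M \<Longrightarrow> absval c \<le> 1 \<Longrightarrow> smul c x \<in> M"
  and submodule_0: "0 \<in> M"
  using M(2) by (auto simp: ball_submodule_def)

text \<open>The admissible scalars are closed upwards in absolute value. Hence the larger of two
  scalars serves both vectors, which gives the ultrametric inequality.\<close>

lemma gauge_mono:
  assumes "c \<noteq> 0" "smul (inverse c) x \<in> M" "absval c \<le> absval d"
  shows "d \<noteq> 0 \<and> smul (inverse d) x \<in> M"
proof
  show "d \<noteq> 0" using assms(1,3) by (metis absval_0 absval_pos not_le)
  then have "absval (c / d) \<le> 1" using assms by (simp add: absval_divide)
  then have "smul (c / d) (smul (inverse c) x) \<in> M" using assms submodule_smul by blast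
  moreover have "c / d * inverse c = inverse d" using assms(1) by (simp add: field_simps)
  ultimately show "smul (inverse d) x \<in> M" by (simp only: scale_scale)
qed

lemma gauge_ex: "\<exists>c. c \<noteq> 0 \<and> smul (inverse c) x \<in> M"
proof -
  have "0 \<in> {c. smul c x \<in> M}" using submodule_0 by simp
  then obtain e where e: "e > 0" "ball 0 e \<subseteq> {c. smul c x \<in> M}"
    using open_vimage_smul(1)[OF M(1), of x] open_contains_ball by blast
  obtain c :: 'k where c: "c \<noteq> 0" "absval c < e" using ex_absval_less[OF e(1)] by blast
  then have "c \<in> ball 0 e" by (simp add: dist_absval)
  then have "smul c x \<in> M" using e by blast
  then show ?thesis using c by (intro exI[of _ "inverse c"]) auto
qed

lemma gauge_le: "c \<noteq> 0 \<Longrightarrow> smul (inverse c) x \<in> M \<Longrightarrow> gauge_seminorm smul M x \<le> absval c"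
  unfolding gauge_seminorm_def by (rule cInf_lower) (auto intro: bdd_belowI[of _ 0])

lemma gauge_nonneg: "0 \<le> gauge_seminorm smul M x"
  unfolding gauge_seminorm_def using gauge_ex[of x] by (intro cInf_greatest) auto

lemma gauge_less: "gauge_seminorm smul M x < r \<Longrightarrow> \<exists>c. c \<noteq> 0 \<and> smul (inverse c) x \<in> M \<and> absval c < r"
  unfolding gauge_seminorm_def using gauge_ex[of x] by (auto dest!: cInf_lessD[rotated])

lemma gauge_smul_le: 
  assumes "a \<noteq> 0" shows "gauge_seminorm smul M (smul a x) \<le> absval a * gauge_seminorm smul M x"
proof -
  have "gauge_seminorm smul M (smul a x) / absval a \<le> gauge_seminorm smul M x"
  proof (rule dense_ge)
    fix r assume "gauge_seminorm smul M x < r"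
    then obtain c where c: "c \<noteq> 0" "smul (inverse c) x \<in> M" "absval c < r" using gauge_less by blast
    have "inverse (a * c) * a = inverse c" using assms by (simp add: field_simps)
    then have "gauge_seminorm smul M (smul a x) \<le> absval (a * c)"
      using assms c by (intro gauge_le) (simp_all only: scale_scale mult_eq_0_iff simp_thms)
    then have "gauge_seminorm smul M (smul a x) / absval a \<le> absval c"
      using assms by (simp add: absval_mult field_simps)
    then show "gauge_seminorm smul M (smul a x) / absval a \<le> r" using c by linarith
  qed
  then show ?thesis using assms by (simp add: field_simps)
qed

lemma gauge_0: "gauge_seminorm smul M 0 = 0"
proof (rule antisym[OF _ gauge_nonneg])
  show "gauge_seminorm smul M 0 \<le> 0"
  proof (rule dense_ge)
    fix r :: real assume "0 < r"
    then obtain c :: 'k where "c \<noteq> 0" "absval c < r" using ex_absval_less by blast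
    then show "gauge_seminorm smul M 0 \<le> r" using gauge_le[of c 0] submodule_0 by simp
  qed
qed

lemma ultrametric_seminorm_gauge: "ultrametric_seminorm smul (gauge_seminorm smul M)"
proof
  fix x y
  show "gauge_seminorm smul M (x + y) \<le> max (gauge_seminorm smul M x) (gauge_seminorm smul M y)"
  proof (rule dense_ge)
    fix r assume "max (gauge_seminorm smul M x) (gauge_seminorm smul M y) < r"
    then obtain c d where c: "c \<noteq> 0" "smul (inverse c) x \<in> M" "absval c < r"
      and d: "d \<noteq> 0" "smul (inverse d) y \<in> M" "absval d < r"
      using gauge_less[of x r] gauge_less[of y r] by auto
    have "\<exists>m. m \<noteq> 0 \<and> smul (inverse m) x \<in> M \<and> smul (inverse m) y \<in> M \<and> absval m < r"
      using c d gauge_mono[OF c(1,2), of d] gauge_mono[OF d(1,2), of c]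
      by (cases "absval c \<le> absval d") auto
    then obtain m where "m \<noteq> 0" "smul (inverse m) x \<in> M" "smul (inverse m) y \<in> M" "absval m < r" by blast
    then show "gauge_seminorm smul M (x + y) \<le> r"
      using gauge_le[of m "x + y"] submodule_add by (simp add: scale_right_distrib)
  qed
  fix a
  show "gauge_seminorm smul M (smul a x) = absval a * gauge_seminorm smul M x"
  proof (cases "a = 0")
    case False
    have "absval a * gauge_seminorm smul M (smul (inverse a) (smul a x)) \<le> gauge_seminorm smul M (smul a x)"
    proof -
      have "absval a * gauge_seminorm smul M (smul (inverse a) (smul a x))
        \<le> absval a * (absval (inverse a) * gauge_seminorm smul M (smul a x))"
        using False by (intro mult_left_mono gauge_smul_le) auto
      also have "\<dots> = gauge_seminorm smul M (smul a x)"
        using False by (simp add: absval_inverse del: inverse_eq_divide)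
      finally show ?thesis .
    qed
    then show ?thesis using gauge_smul_le[OF False, of x] False by simp
  qed (simp add: gauge_0)
qed

lemma gauge_less_1: "gauge_seminorm smul M x < 1 \<Longrightarrow> x \<in> M"
proof -
  assume "gauge_seminorm smul M x < 1"
  then obtain c where "c \<noteq> 0" "smul (inverse c) x \<in> M" "absval c < 1" using gauge_less by blast
  then show "x \<in> M" using gauge_mono[of c x 1] by simp
qed

lemma continuous_gauge: "continuous_on UNIV (gauge_seminorm smul M)"
  unfolding continuous_on_eq_continuous_at[OF open_UNIV]
proof
  fix x
  interpret ultrametric_seminorm smul "gauge_seminorm smul M" by (rule ultrametric_seminorm_gauge)
  show "isCont (gauge_seminorm smul M) x"
    unfolding isCont_def tendsto_iff
  proof (intro allI impI)
    fix e :: real assume "0 < e"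
    then obtain c :: 'k where c: "c \<noteq> 0" "absval c < e" using ex_absval_less by blast
    have "\<bar>gauge_seminorm smul M y - gauge_seminorm smul M x\<bar> < e" if "smul (inverse c) (y - x) \<in> M" for y
    proof -
      have "gauge_seminorm smul M (y - x) < e" using gauge_le[OF c(1) that] c by simp
      moreover have "gauge_seminorm smul M y \<le> max (gauge_seminorm smul M (y - x)) (gauge_seminorm smul M x)"
        using q_add[of "y - x" x] by simp
      moreover have "gauge_seminorm smul M x \<le> max (gauge_seminorm smul M (y - x)) (gauge_seminorm smul M y)"
        using q_diff[of y "y - x"] by simp
      ultimately show ?thesis using gauge_nonneg[of x] gauge_nonneg[of y] \<open>0 < e\<close> by linarith
    qed
    moreover have "x \<in> {y. smul (inverse c) (y - x) \<in> M}" using submodule_0 by simp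
    ultimately show "\<forall>\<^sub>F y in at x. dist (gauge_seminorm smul M y) (gauge_seminorm smul M x) < e"
      unfolding eventually_at_topological
      using open_vimage_smul(2)[OF M(1), of "inverse c" x] by (auto simp: dist_real_def)
  qed
qed

end

end

section \<open>Tuples of distinct entries and their sets of nodes\<close>

lemma multi_pow_iff:
  "x \<in> multi_pow A \<beta> \<longleftrightarrow> (\<forall>i j. (j \<le> \<beta> i \<longrightarrow> x i j \<in> A i) \<and> (\<beta> i < j \<longrightarrow> x i j = undefined))"
  by (auto simp: multi_pow_def PiE_def extensional_def Pi_def not_le)

lemma multi_pow_distinct_iff:
  "x \<in> multi_pow_distinct A \<beta> \<longleftrightarrow> x \<in> multi_pow A \<beta> \<and> (\<forall>i. inj_on (x i) {..\<beta> i})"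
proof -
  have "inj_on (x i) {..\<beta> i} \<longleftrightarrow> (\<forall>j k. j < k \<and> k \<le> \<beta> i \<longrightarrow> x i j \<noteq> x i k)" for i
  proof
    assume *: "\<forall>j k. j < k \<and> k \<le> \<beta> i \<longrightarrow> x i j \<noteq> x i k"
    show "inj_on (x i) {..\<beta> i}"
    proof (rule inj_onI, rule ccontr)
      fix j k assume "j \<in> {..\<beta> i}" "k \<in> {..\<beta> i}" "x i j = x i k" "j \<noteq> k"
      then show False using *[rule_format, of j k] *[rule_format, of k j] by fastforce
    qed
  qed (auto simp: inj_on_def)
  then show ?thesis by (auto simp: multi_pow_distinct_def)
qed

definition tuple_nodes :: "('n \<Rightarrow> nat) \<Rightarrow> ('n \<Rightarrow> nat \<Rightarrow> 'k) \<Rightarrow> 'n \<Rightarrow> 'k set" where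
  "tuple_nodes \<beta> x = (\<lambda>i. x i ` {..\<beta> i})"

lemma node_sets_tuple: "node_sets (tuple_nodes \<beta> x)"
  by (auto simp: node_sets_def tuple_nodes_def)

lemma dd_type_tuple:
  "x \<in> multi_pow_distinct A \<beta> \<Longrightarrow> dd_type (tuple_nodes \<beta> x) = \<beta>"
  by (auto simp: multi_pow_distinct_iff dd_type_def tuple_nodes_def card_image fun_eq_iff)

text \<open>Distinct entries make the map from multi-indices to points of the grid bijective, so the
  sum over indices can be reindexed by nodes.\<close>

lemma diff_quot_eq_divdiff:
  fixes x :: "'n::finite \<Rightarrow> nat \<Rightarrow> 'k::field" and smul :: "'k \<Rightarrow> 'e::comm_monoid_add \<Rightarrow> 'e"
  assumes "x \<in> multi_pow_distinct A \<beta>"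
  shows "diff_quot smul \<beta> f x = divdiff smul (tuple_nodes \<beta> x) (\<lambda>s. f (\<chi> i. s i))"
proof -
  have inj: "inj_on (x i) {..\<beta> i}" for i using assms by (simp add: multi_pow_distinct_iff)
  let ?h = "\<lambda>(j::'n \<Rightarrow> nat) i. x i (j i)"
  have bij: "bij_betw ?h (PiE UNIV (\<lambda>i. {..\<beta> i})) (node_box (tuple_nodes \<beta> x))"
  proof (rule bij_betwI[where g = "\<lambda>s i. the_inv_into {..\<beta> i} (x i) (s i)"])
    show "?h \<in> PiE UNIV (\<lambda>i. {..\<beta> i}) \<rightarrow> node_box (tuple_nodes \<beta> x)"
      by (auto simp: node_box_def tuple_nodes_def)
    show "(\<lambda>s i. the_inv_into {..\<beta> i} (x i) (s i)) \<in> node_box (tuple_nodes \<beta> x) \<rightarrow> PiE UNIV (\<lambda>i. {..\<beta> i})"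
    proof
      fix s assume "s \<in> node_box (tuple_nodes \<beta> x)"
      then have "s i \<in> x i ` {..\<beta> i}" for i by (simp add: node_box_def tuple_nodes_def)
      then have "the_inv_into {..\<beta> i} (x i) (s i) \<in> {..\<beta> i}" for i
        by (rule the_inv_into_into[OF inj]) simp
      then show "(\<lambda>i. the_inv_into {..\<beta> i} (x i) (s i)) \<in> PiE UNIV (\<lambda>i. {..\<beta> i})" by blast
    qed
    show "(\<lambda>i. the_inv_into {..\<beta> i} (x i) (?h j i)) = j" if "j \<in> PiE UNIV (\<lambda>i. {..\<beta> i})" for j
    proof
      fix i show "the_inv_into {..\<beta> i} (x i) (?h j i) = j i"
        using the_inv_into_f_f[OF inj, of "j i" i] that by auto
    qed
    show "?h (\<lambda>i. the_inv_into {..\<beta> i} (x i) (s i)) = s" if "s \<in> node_box (tuple_nodes \<beta> x)" for s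
    proof
      fix i show "?h (\<lambda>i. the_inv_into {..\<beta> i} (x i) (s i)) i = s i"
        using that by (simp add: f_the_inv_into_f[OF inj] node_box_def tuple_nodes_def)
    qed
  qed
  have "dd_coeff (tuple_nodes \<beta> x) (?h j) = (\<Prod>i\<in>UNIV. \<Prod>k\<in>{..\<beta> i} - {j i}. 1 / (x i (j i) - x i k))"
    if j: "j \<in> PiE UNIV (\<lambda>i. {..\<beta> i})" for j
    unfolding dd_coeff_def
  proof (rule prod.cong[OF refl])
    fix i
    have "tuple_nodes \<beta> x i - {x i (j i)} = x i ` ({..\<beta> i} - {j i})"
      using j inj[of i] unfolding tuple_nodes_def by (subst inj_on_image_set_diff[of _ "{..\<beta> i}"]) auto
    then show "(\<Prod>t\<in>tuple_nodes \<beta> x i - {x i (j i)}. 1 / (x i (j i) - t))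
      = (\<Prod>k\<in>{..\<beta> i} - {j i}. 1 / (x i (j i) - x i k))"
      using inj_on_subset[OF inj[of i], of "{..\<beta> i} - {j i}"] by (simp add: prod.reindex)
  qed
  then show ?thesis
    unfolding diff_quot_def divdiff_def sum.reindex_bij_betw[OF bij, symmetric]
    by (intro sum.cong) auto
qed

text \<open>The restriction makes all entries past the last node \<open>undefined\<close>, as
  membership in \<open>multi_pow\<close> requires.\<close>

definition enum_set :: "'a set \<Rightarrow> nat \<Rightarrow> 'a" where
  "enum_set S = restrict (SOME e. bij_betw e {..card S - 1} S) {..card S - 1}"

lemma bij_betw_enum_set:
  assumes "finite S" "S \<noteq> {}"
  shows "bij_betw (enum_set S) {..card S - 1} S"
proof -
  have "{0..<card S} = {..card S - 1}" using assms     by (metis Suc_pred' atLeast0LessThan card_gt_0_iff lessThan_Suc_atMost)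
  then have "\<exists>e. bij_betw e {..card S - 1} S" using ex_bij_betw_nat_finite[OF assms(1)] by simp
  from someI_ex[OF this] show ?thesis
    unfolding enum_set_def by (subst bij_betw_restrict_eq) 
qed

lemma enum_tuple:
  assumes "node_sets Y" "\<And>i. Y i \<subseteq> A i"
  shows "(\<lambda>i. enum_set (Y i)) \<in> multi_pow_distinct A (dd_type Y)"
    "tuple_nodes (dd_type Y) (\<lambda>i. enum_set (Y i)) = Y"
proof -
  have bij: "bij_betw (enum_set (Y i)) {..dd_type Y i} (Y i)" for i
    using assms(1) unfolding dd_type_def by (intro bij_betw_enum_set) (auto simp: node_sets_def)
  have "enum_set (Y i) j = undefined" if "dd_type Y i < j" for i j
    using that by (simp add: enum_set_def dd_type_def)
  then show "(\<lambda>i. enum_set (Y i)) \<in> multi_pow_distinct A (dd_type Y)"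
    using bij assms(2) by (fastforce simp: multi_pow_distinct_iff multi_pow_iff bij_betw_def)
  show "tuple_nodes (dd_type Y) (\<lambda>i. enum_set (Y i)) = Y"
    using bij by (auto simp: tuple_nodes_def bij_betw_def)
qed

section \<open>Compactness and density\<close>

lemma compact_PiE_UNIV:
  fixes S :: "'i \<Rightarrow> 'a::topological_space set"
  assumes "\<And>i. compact (S i)"
  shows "compact (PiE UNIV S)"
proof -
  have "compactin (product_topology (\<lambda>i. euclidean) UNIV) (PiE UNIV S)"
    using assms by (simp add: compactin_PiE)
  then show ?thesis by (simp add: euclidean_product_topology)
qed

text \<open>Coordinates beyond \<open>\<beta> i\<close> are frozen at \<open>undefined\<close> and
  count as singleton factors in Tychonoff's theorem.\<close>

lemma compact_multi_pow:
  fixes \<kappa> :: "'n \<Rightarrow> 'k::topological_space set"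
  assumes "\<And>i. compact (\<kappa> i)"
  shows "compact (multi_pow \<kappa> \<beta>)"
proof -
  have "PiE {..\<beta> i} (\<lambda>j. \<kappa> i) = PiE UNIV (\<lambda>j. if j \<le> \<beta> i then \<kappa> i else {undefined})" for i
    by (auto simp: PiE_def extensional_def Pi_def split: if_splits)
  then show ?thesis
    unfolding multi_pow_def using assms by (simp, intro compact_PiE_UNIV) auto
qed

lemma totally_bounded_compact:
  assumes "compact Q" "\<And>x. x \<in> Q \<Longrightarrow> \<exists>V. open V \<and> x \<in> V \<and> V \<subseteq> N x"
  shows "\<exists>B\<subseteq>Q. finite B \<and> Q \<subseteq> (\<Union>x\<in>B. N x)"
proof -
  obtain V where V: "\<And>x. x \<in> Q \<Longrightarrow> open (V x) \<and> x \<in> V x \<and> V x \<subseteq> N x" using assms(2) by metis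
  have cov: "Q \<subseteq> (\<Union>x\<in>Q. V x)" "\<And>x. x \<in> Q \<Longrightarrow> open (V x)" using V by auto
  obtain B where B: "B \<subseteq> Q" "finite B" "Q \<subseteq> (\<Union>x\<in>B. V x)"
    using compactE_image[OF assms(1) cov(2,1)] by metis
  moreover have "(\<Union>x\<in>B. V x) \<subseteq> (\<Union>x\<in>B. N x)" using V B(1) by (intro UN_mono) auto
  ultimately show ?thesis by (intro exI[of _ B]) simp
qed

text \<open>A Lebesgue number. No radius is halved, because in the applications \<open>R d x\<close>
  is an ultrametric ball and thus is centred at each of its points.\<close>

lemma ultra_lebesgue:
  assumes Q: "compact Q"
    and R: "\<And>x d. x \<in> Q \<Longrightarrow> 0 < d \<Longrightarrow> \<exists>V. open V \<and> x \<in> V \<and> V \<subseteq> R d x"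
    and P: "\<And>x. x \<in> Q \<Longrightarrow> \<exists>d>0. P d x"
  shows "\<exists>\<delta>>0::real. \<forall>y\<in>Q. \<exists>x\<in>Q. \<exists>d\<ge>\<delta>. P d x \<and> y \<in> R d x"
proof -
  obtain d where d: "\<And>x. x \<in> Q \<Longrightarrow> 0 < d x \<and> P (d x) x" using P by metis
  have "\<exists>V. open V \<and> x \<in> V \<and> V \<subseteq> R (d x) x" if "x \<in> Q" for x
    using R[OF that] d[OF that] by simp
  from totally_bounded_compact[where N = "\<lambda>x. R (d x) x", OF Q this]
  obtain B where B: "B \<subseteq> Q" "finite B" "Q \<subseteq> (\<Union>x\<in>B. R (d x) x)" by auto
  have "0 < Min (insert 1 (d ` B))" using B d by (subst Min_gr_iff) auto
  moreover have "\<exists>x\<in>Q. \<exists>e\<ge>Min (insert 1 (d ` B)). P e x \<and> y \<in> R e x" if y_Q: "y \<in> Q" for y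
  proof -
    obtain x where x: "x \<in> B" "y \<in> R (d x) x" using B(3) y_Q by auto
    moreover have "Min (insert 1 (d ` B)) \<le> d x" using x B(2) by (intro Min_le) auto
    ultimately show ?thesis using d B(1) by blast
  qed
  ultimately show ?thesis by blast
qed

lemma open_near_tuple:
  fixes x :: "'n::finite \<Rightarrow> nat \<Rightarrow> 'k::metric_space"
  shows "open {y. \<forall>i. \<forall>j\<le>\<beta> i. dist (x i j) (y i j) < d}"
proof -
  have "{y. \<forall>i. \<forall>j\<le>\<beta> i. dist (x i j) (y i j) < d} = (\<Inter>i\<in>UNIV. \<Inter>j\<in>{..\<beta> i}. {y. dist (x i j) (y i j) < d})"
    by auto
  moreover have "continuous_on UNIV (\<lambda>y::'n \<Rightarrow> nat \<Rightarrow> 'k. y i j)" for i j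
    by (rule continuous_on_product_then_coordinatewise[OF continuous_on_product_coordinates])
  then have "open {y::'n \<Rightarrow> nat \<Rightarrow> 'k. dist (x i j) (y i j) < d}" for i j
    by (intro open_Collect_less continuous_intros)
  ultimately show ?thesis by (auto intro!: open_INT)
qed

lemma tendsto_fun:
  fixes y :: "nat \<Rightarrow> 'i \<Rightarrow> 'a::topological_space"
  assumes "\<And>i. (\<lambda>n. y n i) \<longlonglongrightarrow> x i"
  shows "y \<longlonglongrightarrow> x"
proof -
  have "limitin (product_topology (\<lambda>i. euclidean) UNIV) y x sequentially"
    using assms by (subst limitin_componentwise) auto
  then show ?thesis by (simp add: euclidean_product_topology)
qed

lemma tendsto_tuple:
  fixes x :: "'n \<Rightarrow> nat \<Rightarrow> 'k::metric_space"
  assumes "x \<in> multi_pow A \<beta>" "\<And>n. y n \<in> multi_pow A \<beta>"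
    and near: "\<And>n i j. j \<le> \<beta> i \<Longrightarrow> dist (x i j) (y n i j) \<le> inverse (real (Suc n))"
  shows "y \<longlonglongrightarrow> x"
proof (rule tendsto_fun, rule tendsto_fun)
  fix i j
  show "(\<lambda>n. y n i j) \<longlonglongrightarrow> x i j"
  proof (cases "j \<le> \<beta> i")
    case True
    show ?thesis
    proof (rule tendstoI)
      fix e :: real assume "0 < e"
      then have "eventually (\<lambda>n. inverse (real (Suc n)) < e) sequentially"
        using LIMSEQ_inverse_real_of_nat by (rule order_tendstoD(2)[rotated])
      then show "eventually (\<lambda>n. dist (y n i j) (x i j) < e) sequentially"
      proof eventually_elim
        case (elim n)
        then show ?case using near[OF True, of n] unfolding dist_commute[of "y n i j"] by (rule order_le_less_trans[rotated])
      qed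
    qed
  next
    case False
    then show ?thesis using assms(1,2) by (simp add: multi_pow_iff not_le)
  qed
qed

text \<open>Otherwise there are tuples outside \<open>V\<close> whose relevant entries tend to those
  of \<open>x\<close>. The remaining entries are constant, so these tuples converge to
  \<open>x\<close>.\<close>

lemma near_tuple_subset_open:
  fixes x :: "'n::finite \<Rightarrow> nat \<Rightarrow> 'k::metric_space"
  assumes V: "open V" "x \<in> V" and x: "x \<in> multi_pow A \<beta>"
  shows "\<exists>d>0. \<forall>y\<in>multi_pow A \<beta>. (\<forall>i. \<forall>j\<le>\<beta> i. dist (x i j) (y i j) \<le> d) \<longrightarrow> y \<in> V"
proof (rule ccontr)
  assume not: "\<not> ?thesis"
  have "\<exists>y. y \<in> multi_pow A \<beta> \<and> (\<forall>i. \<forall>j\<le>\<beta> i. dist (x i j) (y i j) \<le> inverse (real (Suc n))) \<and> y \<notin> V" for n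
  proof -
    have "0 < inverse (real (Suc n))" by simp
    with not show ?thesis by blast
  qed
  then obtain y where y: "\<And>n. y n \<in> multi_pow A \<beta>"
    "\<And>n i j. j \<le> \<beta> i \<Longrightarrow> dist (x i j) (y n i j) \<le> inverse (real (Suc n))" "\<And>n. y n \<notin> V"
    by metis
  have "y \<longlonglongrightarrow> x" by (rule tendsto_tuple[OF x y(1,2)])
  then have "eventually (\<lambda>n. y n \<in> V) sequentially" using V by (rule topological_tendstoD)
  then show False using y(3) by simp
qed

text \<open>Stronger than uniform continuity on \<open>Q\<close>: the two points compared may lie
  outside \<open>Q\<close>, as long as both are near one point of it. Interpolation nodes are of
  this kind.\<close>

lemma uniform_continuity_near:
  fixes g :: "('n::finite \<Rightarrow> nat \<Rightarrow> 'k::ultrametric_field) \<Rightarrow> 'f::topological_ab_group_add" and p :: "'f \<Rightarrow> real"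
  assumes g: "continuous_on (multi_pow A \<beta>) g" and Q: "compact Q" "Q \<subseteq> multi_pow A \<beta>"
    and p: "continuous_on UNIV p" "p 0 = 0" "\<And>x y. p (x - y) \<le> max (p x) (p y)" and e: "0 < e"
  shows "\<exists>\<delta>>0. \<forall>x\<in>Q. \<forall>y\<in>multi_pow A \<beta>. \<forall>z\<in>multi_pow A \<beta>.
     (\<forall>i. \<forall>j\<le>\<beta> i. dist (x i j) (y i j) \<le> \<delta>) \<longrightarrow> (\<forall>i. \<forall>j\<le>\<beta> i. dist (x i j) (z i j) \<le> \<delta>)
     \<longrightarrow> p (g y - g z) \<le> e"
proof -
  define near where "near = (\<lambda>d (x::'n \<Rightarrow> nat \<Rightarrow> 'k). {y. \<forall>i. \<forall>j\<le>\<beta> i. dist (x i j) (y i j) \<le> d})"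
  let ?P = "\<lambda>d x. \<forall>y\<in>multi_pow A \<beta>. y \<in> near d x \<longrightarrow> p (g y - g x) \<le> e"
  have "\<exists>\<delta>>0. \<forall>y\<in>Q. \<exists>x\<in>Q. \<exists>d\<ge>\<delta>. ?P d x \<and> y \<in> near d x"
  proof (rule ultra_lebesgue[OF Q(1)])
    fix x :: "'n \<Rightarrow> nat \<Rightarrow> 'k" and d :: real assume "x \<in> Q" "0 < d"
    show "\<exists>V. open V \<and> x \<in> V \<and> V \<subseteq> near d x"
      using open_near_tuple[of \<beta> x d] \<open>0 < d\<close>
      by (intro exI[of _ "{y. \<forall>i. \<forall>j\<le>\<beta> i. dist (x i j) (y i j) < d}"]) (auto simp: near_def less_imp_le)
  next
    fix x assume "x \<in> Q"
    then have x: "x \<in> multi_pow A \<beta>" using Q(2) by blast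
    have "continuous_on (multi_pow A \<beta>) (\<lambda>y. p (g y - g x))"
      by (rule continuous_on_compose2[OF p(1)]) (auto intro!: continuous_intros g)
    moreover have "open {..<e}" by simp
    ultimately obtain V where V: "open V" "V \<inter> multi_pow A \<beta> = (\<lambda>y. p (g y - g x)) -` {..<e} \<inter> multi_pow A \<beta>"
      unfolding continuous_on_open_invariant by blast
    then have "x \<in> V" using x p(2) e by auto
    then obtain d where "d > 0" "\<forall>y\<in>multi_pow A \<beta>. (\<forall>i. \<forall>j\<le>\<beta> i. dist (x i j) (y i j) \<le> d) \<longrightarrow> y \<in> V"
      using near_tuple_subset_open[OF V(1) _ x] by blast
    then show "\<exists>d>0. ?P d x" using V(2) unfolding near_def by (intro exI[of _ d]) fastforce
  qed
  then obtain \<delta> where \<delta>: "\<delta> > 0" "\<And>y. y \<in> Q \<Longrightarrow> \<exists>x\<in>Q. \<exists>d\<ge>\<delta>. ?P d x \<and> y \<in> near d x" by blast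
  have "p (g y - g z) \<le> e"
    if "w \<in> Q" "y \<in> multi_pow A \<beta>" "z \<in> multi_pow A \<beta>" "y \<in> near \<delta> w" "z \<in> near \<delta> w" for w y z
  proof -
    obtain x d where x: "d \<ge> \<delta>" "?P d x" "w \<in> near d x" using \<delta>(2)[OF \<open>w \<in> Q\<close>] by blast
    have "v \<in> near d x" if "v \<in> near \<delta> w" for v
      unfolding near_def
    proof (intro CollectI allI impI)
      fix i j assume j: "j \<le> \<beta> i"
      have "dist (x i j) (w i j) \<le> d" using x(3) j unfolding near_def by blast
      moreover have "dist (w i j) (v i j) \<le> \<delta>" using that j unfolding near_def by blast
      ultimately show "dist (x i j) (v i j) \<le> d"
        using x(1) by (intro dist_ultra[of "x i j" "w i j" d "v i j"]) auto
    qed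
    then have "p (g y - g x) \<le> e" "p (g z - g x) \<le> e" using x(2) that by auto
    then show ?thesis using p(3)[of "g y - g x" "g z - g x"] by simp
  qed
  then show ?thesis using \<delta>(1) unfolding near_def by blast
qed

lemma infinite_near:
  fixes A :: "'k::metric_space set"
  assumes "no_isolated_points A" "x \<in> A" "0 < d"
  shows "infinite (A \<inter> ball x d)"
proof
  assume fin: "finite (A \<inter> ball x d)"
  have "\<not> x isolated_in A" using assms(1) by (auto simp: no_isolated_points_def)
  then have "x islimpt A" using assms(2) by (simp add: isolated_in_islimpt_iff)
  then show False using fin assms(3) by (meson islimpt_eq_infinite_ball)
qed

lemma ex_distinct_choice:
  assumes "\<And>j::nat. infinite (T j)"
  shows "\<exists>y. inj y \<and> (\<forall>j. y j \<in> T j)"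
proof -
  have "\<exists>y. \<forall>j. y j \<in> T j \<and> y j \<notin> y ` {..<j}"
  proof (rule dependent_wellorder_choice)
    fix r :: 'a and f g :: "nat \<Rightarrow> 'a" and j :: nat assume "\<And>k. k < j \<Longrightarrow> f k = g k"
    then have "f ` {..<j} = g ` {..<j}" by (intro image_cong) auto
    then show "(r \<in> T j \<and> r \<notin> f ` {..<j}) = (r \<in> T j \<and> r \<notin> g ` {..<j})" by simp
  next
    fix j and f :: "nat \<Rightarrow> 'a"
    have "infinite (T j - f ` {..<j})" using assms by (simp add: Diff_infinite_finite)
    then show "\<exists>r. r \<in> T j \<and> r \<notin> f ` {..<j}" by (metis Diff_iff ex_in_conv finite.emptyI)
  qed
  then obtain y where y: "\<And>j. y j \<in> T j" "\<And>j. y j \<notin> y ` {..<j}" by blast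
  then have "inj y" by (intro linorder_injI) (metis imageI lessThan_iff)
  with y(1) show ?thesis by blast
qed

lemma ex_distinct_near:
  fixes A :: "'n \<Rightarrow> 'k::metric_space set"
  assumes A: "\<And>i. no_isolated_points (A i)" and x: "x \<in> multi_pow A \<beta>" and d: "0 < d"
  shows "\<exists>y\<in>multi_pow_distinct A \<beta>. \<forall>i. \<forall>j\<le>\<beta> i. dist (x i j) (y i j) < d"
proof -
  have "\<exists>y. inj_on y {..\<beta> i} \<and> (\<forall>j\<le>\<beta> i. y j \<in> A i \<inter> ball (x i j) d)" for i
  proof -
    \<comment> \<open>The index is capped at \<open>\<beta> i\<close>, so that finitely many balls
      become a sequence of infinite sets from which distinct elements are chosen.\<close>
    have "infinite (A i \<inter> ball (x i (min j (\<beta> i))) d)" for j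
      using x by (intro infinite_near A d) (auto simp: multi_pow_iff)
    from ex_distinct_choice[where T = "\<lambda>j. A i \<inter> ball (x i (min j (\<beta> i))) d", OF this]
    obtain y where y: "inj y" "\<And>j. y j \<in> A i \<inter> ball (x i (min j (\<beta> i))) d" by blast
    have "y j \<in> A i \<inter> ball (x i j) d" if "j \<le> \<beta> i" for j
      using y(2)[of j] that by (simp add: min_absorb1)
    then show ?thesis using y(1) inj_on_subset by blast
  qed
  then obtain y where y: "\<And>i. inj_on (y i) {..\<beta> i}" "\<And>i j. j \<le> \<beta> i \<Longrightarrow> y i j \<in> A i \<inter> ball (x i j) d"
    by metis
  define z where "z = (\<lambda>i. restrict (y i) {..\<beta> i})"
  have "z \<in> multi_pow_distinct A \<beta>"
    using y by (auto simp: multi_pow_distinct_iff multi_pow_iff z_def inj_on_def)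
  moreover have "dist (x i j) (z i j) < d" if "j \<le> \<beta> i" for i j using y(2)[OF that] that by (simp add: z_def)
  ultimately show ?thesis by blast
qed

text \<open>The bound \<open>d\<close> keeps the whole sequence in the neighbourhood of
  \<open>x\<close> on which an approximation is available.\<close>

lemma ex_distinct_seq:
  fixes A :: "'n \<Rightarrow> 'k::metric_space set"
  assumes A: "\<And>i. no_isolated_points (A i)" and x: "x \<in> multi_pow A \<beta>" and d: "0 < d"
  shows "\<exists>y. y \<longlonglongrightarrow> x \<and> (\<forall>n. y n \<in> multi_pow_distinct A \<beta> \<and> (\<forall>i. \<forall>j\<le>\<beta> i. dist (x i j) (y n i j) \<le> d))"
proof -
  have "\<exists>y\<in>multi_pow_distinct A \<beta>. \<forall>i. \<forall>j\<le>\<beta> i. dist (x i j) (y i j) < min d (inverse (real (Suc n)))" for n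
    using d by (intro ex_distinct_near[OF A x]) auto
  then obtain y where y: "\<And>n. y n \<in> multi_pow_distinct A \<beta>"
    "\<And>n i j. j \<le> \<beta> i \<Longrightarrow> dist (x i j) (y n i j) < min d (inverse (real (Suc n)))" by metis
  have "y \<longlonglongrightarrow> x"
    using y by (intro tendsto_tuple[OF x]) (auto simp: multi_pow_distinct_iff less_imp_le)
  then show ?thesis using y by (intro exI[of _ y]) (auto intro: less_imp_le)
qed

lemma diff_quot_ext_unique:
  fixes A :: "'n::finite \<Rightarrow> 'k::ultrametric_field set" and g h :: "_ \<Rightarrow> 'e::{comm_monoid_add,t2_space}"
  assumes A: "\<And>i. no_isolated_points (A i)"
    and g: "is_diff_quot_ext smul A \<beta> f g" and h: "is_diff_quot_ext smul A \<beta> f h"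
  shows "g = h"
proof
  fix x
  show "g x = h x"
  proof (cases "x \<in> multi_pow A \<beta>")
    case True
    obtain y where y: "y \<longlonglongrightarrow> x" "\<And>n. y n \<in> multi_pow_distinct A \<beta>"
      using ex_distinct_seq[OF A True, of 1] by auto
    have yp: "y n \<in> multi_pow A \<beta>" for n using y(2)[of n] by (simp add: multi_pow_distinct_iff)
    have "(\<lambda>n. g (y n)) \<longlonglongrightarrow> g x" "(\<lambda>n. h (y n)) \<longlonglongrightarrow> h x"
      using g h unfolding is_diff_quot_ext_def
      by (auto intro!: continuous_on_tendsto_compose[OF _ y(1) True] simp: yp)
    moreover have "g (y n) = h (y n)" for n using g h y(2)[of n] by (simp add: is_diff_quot_ext_def)
    ultimately show ?thesis using LIMSEQ_unique by simp
  next
    case False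
    then show ?thesis using g h by (simp add: is_diff_quot_ext_def extensional_def)
  qed
qed

lemma diff_quot_ext_eq:
  fixes A :: "'n::finite \<Rightarrow> 'k::ultrametric_field set" and g :: "_ \<Rightarrow> 'e::{comm_monoid_add,t2_space}"
  assumes "\<And>i. no_isolated_points (A i)" "is_diff_quot_ext smul A \<beta> f g"
  shows "diff_quot_ext smul A \<beta> f = g"
  unfolding diff_quot_ext_def using assms diff_quot_ext_unique by blast

section \<open>Polynomial functions and their difference quotients\<close>

context divided_differences
begin

lemma poly_in_monomials:
  fixes P :: "('n::finite \<Rightarrow> 'k) \<Rightarrow> 'e"
  assumes "poly_in smul UNIV P"
  shows "\<exists>B a. finite B \<and> (\<forall>x. P x = (\<Sum>\<beta>\<in>B. smul (\<Prod>i\<in>UNIV. x i ^ \<beta> i) (a \<beta>)))"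
  using assms
proof (induction rule: poly_in.induct)
  case (indep g)
  have "g x = g undefined" for x by (rule indep) simp
  then show ?case by (intro exI[of _ "{\<lambda>_. 0}"] exI[of _ "\<lambda>_. g undefined"]) simp
next
  case (add f g)
  from add.IH(1) obtain B a where f0: "finite B \<and> (\<forall>x. f x = (\<Sum>\<beta>\<in>B. smul (\<Prod>i\<in>UNIV. x i ^ \<beta> i) (a \<beta>)))"
    by (elim exE) (rule that)
  from add.IH(2) obtain C b where g0: "finite C \<and> (\<forall>x. g x = (\<Sum>\<beta>\<in>C. smul (\<Prod>i\<in>UNIV. x i ^ \<beta> i) (b \<beta>)))"
    by (elim exE) (rule that)
  note f = conjunct1[OF f0] conjunct2[OF f0, rule_format]
  note g = conjunct1[OF g0] conjunct2[OF g0, rule_format]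
  define a' b' where "a' = (\<lambda>\<beta>. if \<beta> \<in> B then a \<beta> else 0)" and "b' = (\<lambda>\<beta>. if \<beta> \<in> C then b \<beta> else 0)"
  have "f x = (\<Sum>\<beta>\<in>B \<union> C. smul (\<Prod>i\<in>UNIV. x i ^ \<beta> i) (a' \<beta>))" for x
    unfolding f(2) using f(1) g(1) by (intro sum.mono_neutral_cong_left) (auto simp: a'_def)
  moreover have "g x = (\<Sum>\<beta>\<in>B \<union> C. smul (\<Prod>i\<in>UNIV. x i ^ \<beta> i) (b' \<beta>))" for x
    unfolding g(2) using f(1) g(1) by (intro sum.mono_neutral_cong_left) (auto simp: b'_def)
  ultimately have "\<forall>x. f x + g x = (\<Sum>\<beta>\<in>B \<union> C. smul (\<Prod>i\<in>UNIV. x i ^ \<beta> i) (a' \<beta> + b' \<beta>))"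
    by (simp add: scale_right_distrib sum.distrib)
  then show ?case using f(1) g(1) by (intro exI[of _ "B \<union> C"] exI[of _ "\<lambda>\<beta>. a' \<beta> + b' \<beta>"]) simp
next
  case (mult i f)
  from mult.IH obtain B a where f0: "finite B \<and> (\<forall>x. f x = (\<Sum>\<beta>\<in>B. smul (\<Prod>i\<in>UNIV. x i ^ \<beta> i) (a \<beta>)))"
    by (elim exE) (rule that)
  note f = conjunct1[OF f0] conjunct2[OF f0, rule_format]
  define up where "up = (\<lambda>\<beta>::'n \<Rightarrow> nat. \<beta>(i := Suc (\<beta> i)))"
  define down where "down = (\<lambda>\<beta>::'n \<Rightarrow> nat. \<beta>(i := \<beta> i - 1))"
  have du: "down (up \<beta>) = \<beta>" for \<beta> by (simp add: up_def down_def)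
  then have inj: "inj_on up B" by (metis inj_on_inverseI)
  have "x i * (\<Prod>j\<in>UNIV. x j ^ \<beta> j) = (\<Prod>j\<in>UNIV. x j ^ up \<beta> j)" for x :: "'n \<Rightarrow> 'k" and \<beta>
  proof -
    have "(\<Prod>j\<in>UNIV - {i}. x j ^ up \<beta> j) = (\<Prod>j\<in>UNIV - {i}. x j ^ \<beta> j)"
      by (rule prod.cong) (auto simp: up_def)
    moreover have "up \<beta> i = Suc (\<beta> i)" by (simp add: up_def)
    ultimately show ?thesis by (simp add: prod.remove[of UNIV i] mult_ac)
  qed
  then have "\<forall>x. smul (x i) (f x) = (\<Sum>\<beta>\<in>up ` B. smul (\<Prod>i\<in>UNIV. x i ^ \<beta> i) (a (down \<beta>)))"
    unfolding f(2) by (simp add: scale_sum_right sum.reindex[OF inj] du)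
  then show ?case using f(1) by (intro exI[of _ "up ` B"] exI[of _ "\<lambda>\<beta>. a (down \<beta>)"]) simp
qed

lemma Pol_eq:
  fixes U :: "('k ^ 'n::finite) set"
  shows "Pol smul U = {restrict (\<lambda>x. P (\<lambda>i. x $ i)) U | P. poly_in smul UNIV P}"
proof (intro equalityI subsetI)
  fix f assume "f \<in> Pol smul U"
  then obtain B :: "('n \<Rightarrow> nat) set" and a where f: "f = restrict (\<lambda>x. \<Sum>\<beta>\<in>B. smul (\<Prod>i\<in>UNIV. x $ i ^ \<beta> i) (a \<beta>)) U"
    unfolding Pol_def by blast
  have "poly_in smul UNIV (\<lambda>x. smul (\<Prod>i\<in>UNIV. poly (monom 1 (\<beta> i)) (x i)) (a \<beta>))" for \<beta> :: "'n \<Rightarrow> nat"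
    by (intro poly_in_prod_poly poly_in_const) auto
  then have "poly_in smul UNIV (\<lambda>x. \<Sum>\<beta>\<in>B. smul (\<Prod>i\<in>UNIV. x i ^ \<beta> i) (a \<beta>))"
    by (intro poly_in_sum) (simp add: poly_monom)
  then show "f \<in> {restrict (\<lambda>x. P (\<lambda>i. x $ i)) U | P. poly_in smul UNIV P}"
    unfolding f by (intro CollectI exI[of _ "\<lambda>x. \<Sum>\<beta>\<in>B. smul (\<Prod>i\<in>UNIV. x i ^ \<beta> i) (a \<beta>)"]) simp
next
  fix f assume "f \<in> {restrict (\<lambda>x. P (\<lambda>i. x $ i)) U | P. poly_in smul UNIV P}"
  then obtain P where P: "poly_in smul UNIV P" "f = restrict (\<lambda>x. P (\<lambda>i. x $ i)) U" by blast
  from poly_in_monomials[OF P(1)] obtain B a where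
    B: "finite B \<and> (\<forall>x. P x = (\<Sum>\<beta>\<in>B. smul (\<Prod>i\<in>UNIV. x i ^ \<beta> i) (a \<beta>)))"
    by (elim exE) (rule that)
  have "f = restrict (\<lambda>x. \<Sum>\<beta>\<in>B. smul (\<Prod>i\<in>UNIV. x $ i ^ \<beta> i) (a \<beta>)) U"
    unfolding P(2) conjunct2[OF B, rule_format] ..
  then show "f \<in> Pol smul U" unfolding Pol_def using B by blast
qed

end

sublocale topological_vector_space \<subseteq> divided_differences smul ..

lemma box_of_chart: "A \<in> cartesian_charts U \<Longrightarrow> box_of A \<subseteq> U"
  unfolding cartesian_charts_def using openin_imp_subset by blast

lemma node_box_tuple:
  assumes "y \<in> multi_pow A \<beta>" "s \<in> node_box (tuple_nodes \<beta> y)"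
  shows "(\<chi> i. s i) \<in> box_of A" "\<exists>j\<in>PiE UNIV (\<lambda>i. {..\<beta> i}). s = (\<lambda>i. y i (j i))"
proof -
  have "\<exists>k\<le>\<beta> i. s i = y i k" for i using assms(2) by (auto simp: node_box_def tuple_nodes_def)
  then obtain j where j: "\<And>i. j i \<le> \<beta> i \<and> s i = y i (j i)" by metis
  then show "(\<chi> i. s i) \<in> box_of A" using assms(1) by (auto simp: box_of_def multi_pow_iff)
  show "\<exists>j\<in>PiE UNIV (\<lambda>i. {..\<beta> i}). s = (\<lambda>i. y i (j i))"
    using j by (intro bexI[of _ j]) auto
qed

context topological_vector_space
begin

lemma continuous_on_smul:
  "continuous_on S c \<Longrightarrow> continuous_on S f \<Longrightarrow> continuous_on S (\<lambda>y. smul (c y) (f y))"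
  using continuous_on_compose2[OF continuous_smul, of S "\<lambda>y. (c y, f y)"]
  by (auto intro: continuous_on_Pair)

text \<open>The Leibniz rule at the last entry expresses the difference quotients of
  \<open>x i * f\<close> through those of \<open>f\<close>, by a formula that is still meaningful
  and continuous at tuples with repeated entries.\<close>

lemma poly_in_divdiff_continuous:
  fixes P :: "('n::finite \<Rightarrow> 'k) \<Rightarrow> 'e"
  assumes "poly_in smul UNIV P"
  shows "\<exists>g. continuous_on (multi_pow A \<beta>) g \<and> (\<forall>y\<in>multi_pow_distinct A \<beta>. g y = dd (tuple_nodes \<beta> y) P)"
  using assms
proof (induction arbitrary: \<beta> rule: poly_in.induct)
  case (indep f)
  have "f x = f undefined" for x by (rule indep) simp
  then have f: "f = (\<lambda>x. f undefined)" by (rule ext)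
  have "dd (tuple_nodes \<beta> y) f = (if (\<Sum>i\<in>UNIV. \<beta> i) = 0 then f undefined else 0)"
    if "y \<in> multi_pow_distinct A \<beta>" for y
    by (subst f, subst divdiff_const) (simp_all add: node_sets_tuple dd_type_tuple[OF that])
  then show ?case by (intro exI[of _ "\<lambda>y. if (\<Sum>i\<in>UNIV. \<beta> i) = 0 then f undefined else 0"]) simp
next
  case (add f g)
  obtain f' where "continuous_on (multi_pow A \<beta>) f'" "\<forall>y\<in>multi_pow_distinct A \<beta>. f' y = dd (tuple_nodes \<beta> y) f"
    using add.IH(1) by blast
  moreover obtain g' where "continuous_on (multi_pow A \<beta>) g'" "\<forall>y\<in>multi_pow_distinct A \<beta>. g' y = dd (tuple_nodes \<beta> y) g"
    using add.IH(2) by blast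
  ultimately show ?case
    by (intro exI[of _ "\<lambda>y. f' y + g' y"]) (auto simp: divdiff_add intro: continuous_on_add)
next
  case (mult i f)
  obtain g where g: "continuous_on (multi_pow A \<beta>) g" "\<And>y. y \<in> multi_pow_distinct A \<beta> \<Longrightarrow> g y = dd (tuple_nodes \<beta> y) f"
    using mult.IH by blast
  let ?\<beta> = "\<beta>(i := \<beta> i - 1)"
  obtain h where h: "continuous_on (multi_pow A ?\<beta>) h" "\<And>y. y \<in> multi_pow_distinct A ?\<beta> \<Longrightarrow> h y = dd (tuple_nodes ?\<beta> y) f"
    using mult.IH by blast
  \<comment> \<open>Dropping the last entry means writing \<open>undefined\<close> there, which puts
    the tuple into the product of the lower order.\<close>
  define cut where "cut = (\<lambda>y::'n \<Rightarrow> nat \<Rightarrow> 'k. y(i := (y i)(\<beta> i := undefined)))"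
  define G where "G = (\<lambda>y. smul (y i (\<beta> i)) (g y) + (if \<beta> i = 0 then 0 else h (cut y)))"
  have coord: "continuous_on S (\<lambda>y::'n \<Rightarrow> nat \<Rightarrow> 'k. y k j)" for S k j
    by (rule continuous_on_subset[OF continuous_on_product_then_coordinatewise[OF continuous_on_product_coordinates]]) simp
  have "continuous_on S cut" for S
    unfolding cut_def
  proof (intro continuous_on_coordinatewise_then_product)
    fix k j show "continuous_on S (\<lambda>y::'n \<Rightarrow> nat \<Rightarrow> 'k. (y(i := (y i)(\<beta> i := undefined))) k j)"
      using coord[of S k j] by (cases "k = i"; cases "j = \<beta> i") simp_all
  qed
  moreover have cut: "cut y \<in> multi_pow A ?\<beta>" if "y \<in> multi_pow A \<beta>" "\<beta> i \<noteq> 0" for y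
    using that by (auto simp: multi_pow_iff cut_def)
  ultimately have "continuous_on (multi_pow A \<beta>) (\<lambda>y. h (cut y))" if "\<beta> i \<noteq> 0"
    using that by (intro continuous_on_compose2[OF h(1)]) auto
  then have "continuous_on (multi_pow A \<beta>) (\<lambda>y. if \<beta> i = 0 then 0 else h (cut y))"
    by (cases "\<beta> i = 0") simp_all
  then have "continuous_on (multi_pow A \<beta>) G"
    unfolding G_def by (intro continuous_on_add continuous_on_smul g(1) coord)
  moreover have "G y = dd (tuple_nodes \<beta> y) (\<lambda>x. smul (x i) (f x))" if y: "y \<in> multi_pow_distinct A \<beta>" for y
  proof -
    let ?Y = "tuple_nodes \<beta> y"
    have inj: "inj_on (y j) {..\<beta> j}" for j using y by (simp add: multi_pow_distinct_iff)
    have s: "y i (\<beta> i) \<in> ?Y i" by (auto simp: tuple_nodes_def)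
    have "h (cut y) = dd (?Y(i := ?Y i - {y i (\<beta> i)})) f" if pos: "\<beta> i \<noteq> 0"
    proof -
      have "inj_on (cut y j) {..?\<beta> j}" for j
        using inj[of j] pos by (auto simp: inj_on_def cut_def)
      then have "cut y \<in> multi_pow_distinct A ?\<beta>"
        using cut pos y by (auto simp: multi_pow_distinct_iff)
      moreover have "tuple_nodes ?\<beta> (cut y) = ?Y(i := ?Y i - {y i (\<beta> i)})"
      proof
        fix j show "tuple_nodes ?\<beta> (cut y) j = (?Y(i := ?Y i - {y i (\<beta> i)})) j"
        proof (cases "j = i")
          case True
          have "{..\<beta> i} - {\<beta> i} = {..\<beta> i - 1}" using pos by auto
          then have "?Y i - {y i (\<beta> i)} = y i ` {..\<beta> i - 1}"
            using inj_on_image_set_diff[OF inj[of i], of "{..\<beta> i}" "{\<beta> i}"] by (simp add: tuple_nodes_def)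
          moreover have "tuple_nodes ?\<beta> (cut y) i = y i ` {..\<beta> i - 1}"
            unfolding tuple_nodes_def by (rule image_cong) (use pos in \<open>auto simp: cut_def\<close>)
          ultimately show ?thesis using True by simp
        qed (auto simp: tuple_nodes_def cut_def)
      qed
      ultimately show ?thesis using h(2) by simp
    qed
    then show ?thesis
      using divdiff_mult_linear[OF node_sets_tuple s, of 0 f] g(2)[OF y] dd_type_tuple[OF y]
      by (simp add: G_def)
  qed
  ultimately show ?case by blast
qed

lemma diff_quot_restrict:
  fixes U :: "('k ^ 'n::finite) set"
  assumes "A \<in> cartesian_charts U" "y \<in> multi_pow_distinct A \<beta>"
  shows "diff_quot smul \<beta> (restrict (\<lambda>x. P (\<lambda>i. x $ i)) U) y = dd (tuple_nodes \<beta> y) P"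
  unfolding diff_quot_eq_divdiff[OF assms(2)]
proof (rule divdiff_cong)
  fix s assume "s \<in> node_box (tuple_nodes \<beta> y)"
  then have "(\<chi> i. s i) \<in> U"
    using node_box_tuple(1)[of y A \<beta> s] box_of_chart[OF assms(1)] assms(2) by (auto simp: multi_pow_distinct_iff)
  moreover have "(\<lambda>i. (\<chi> i. s i) $ i) = s" by simp
  ultimately show "restrict (\<lambda>x. P (\<lambda>i. x $ i)) U (\<chi> i. s i) = P s" by (simp only: restrict_apply if_True)
qed

lemma Pol_ext:
  fixes U :: "('k ^ 'n::finite) set"
  assumes "poly_in smul UNIV P" "A \<in> cartesian_charts U"
  shows "\<exists>g. is_diff_quot_ext smul A \<beta> (restrict (\<lambda>x. P (\<lambda>i. x $ i)) U) g"
proof -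
  obtain g where g: "continuous_on (multi_pow A \<beta>) g" "\<And>y. y \<in> multi_pow_distinct A \<beta> \<Longrightarrow> g y = dd (tuple_nodes \<beta> y) P"
    using poly_in_divdiff_continuous[OF assms(1)] by blast
  have "is_diff_quot_ext smul A \<beta> (restrict (\<lambda>x. P (\<lambda>i. x $ i)) U) (restrict g (multi_pow A \<beta>))"
    unfolding is_diff_quot_ext_def
    using g diff_quot_restrict[OF assms(2)]
    by (auto simp: multi_pow_distinct_iff intro: continuous_on_eq)
  then show ?thesis by blast
qed

lemma Pol_subset_C_alpha: "Pol smul U \<subseteq> C_alpha smul U \<alpha>"
  unfolding Pol_eq C_alpha_def using Pol_ext by fastforce

lemma Pol_subset_C_r: "Pol smul U \<subseteq> C_r smul U r"
proof -
  have "Pol smul U \<subseteq> extensional U" by (auto simp: Pol_def)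
  then show ?thesis unfolding C_r_def using Pol_subset_C_alpha by blast
qed

end

section \<open>Polydiscs that meet the domain in a box\<close>

lemma open_cball_ultra: "0 < d \<Longrightarrow> open (cball (x::'k::ultrametric_field) d)"
  unfolding open_contains_ball
proof
  fix y assume "0 < d" "y \<in> cball x d"
  then have "ball y d \<subseteq> cball x d" using cball_ultra_eq[of x y d] by auto
  then show "\<exists>e>0. ball y e \<subseteq> cball x d" using \<open>0 < d\<close> by blast
qed

lemma no_isolated_points_Int_open:
  assumes "no_isolated_points A" "open V"
  shows "no_isolated_points (A \<inter> V)"
  unfolding no_isolated_points_def
proof
  assume "\<exists>x. x isolated_in A \<inter> V"
  then obtain x T where "x \<in> A \<inter> V" "open T" "T \<inter> (A \<inter> V) = {x}" by (auto simp: isolated_in_def)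
  then have "x isolated_in A" using assms(2) unfolding isolated_in_def
    by (intro conjI exI[of _ "T \<inter> V"]) (auto intro: open_Int)
  then show False using assms(1) by (auto simp: no_isolated_points_def)
qed

text \<open>Closed polydiscs are open, so their traces on \<open>U\<close> are relatively
  open.\<close>

lemma chart_of_cell:
  fixes U :: "('k::ultrametric_field ^ 'n::finite) set"
  assumes "0 < d" "\<And>i. no_isolated_points (A i)" "{s. (\<chi> i. s i) \<in> U} \<inter> cell d c = node_box A"
  shows "A \<in> cartesian_charts U"
proof -
  have "open {x::'k^'n. \<forall>i. x $ i \<in> cball (c i) d}"
    unfolding open_vec_def using open_cball_ultra[OF assms(1)]
    by (intro ballI) (rule exI[of _ "\<lambda>i. cball (c i) d"], auto)
  moreover have "box_of A = U \<inter> {x. \<forall>i. x $ i \<in> cball (c i) d}"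
  proof (rule set_eqI)
    fix x :: "'k^'n"
    have "x \<in> box_of A \<longleftrightarrow> (\<lambda>i. x $ i) \<in> node_box A" by (simp add: box_of_def node_box_def)
    also have "\<dots> \<longleftrightarrow> x \<in> U \<inter> {x. \<forall>i. x $ i \<in> cball (c i) d}"
      unfolding assms(3)[symmetric] by (auto simp: cell_def dist_commute vec_nth_inverse)
    finally show "x \<in> box_of A \<longleftrightarrow> x \<in> U \<inter> {x. \<forall>i. x $ i \<in> cball (c i) d}" .
  qed
  ultimately show ?thesis using assms(2) unfolding cartesian_charts_def openin_open by blast
qed

text \<open>A polydisc inside the open set that cuts the chart out of \<open>U\<close> meets
  \<open>U\<close> in the intersection of two boxes. Its factors inherit the absence of isolated
  points, because balls are open.\<close>

lemma locally_cartesian_cell: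
  fixes U :: "('k::ultrametric_field ^ 'n::finite) set"
  assumes "locally_cartesian U" "(\<chi> i. c i) \<in> U"
  shows "\<exists>d>0. d \<le> 1 \<and> (\<exists>A. (\<forall>i. no_isolated_points (A i)) \<and> {s. (\<chi> i. s i) \<in> U} \<inter> cell d c = node_box A)"
proof -
  obtain V where V: "openin (top_of_set U) V" "(\<chi> i. c i) \<in> V" "cartesian V"
    using assms unfolding locally_cartesian_def by blast
  then obtain A where A: "\<And>i. no_isolated_points (A i)" "V = box_of A" unfolding cartesian_def by blast
  obtain W where W: "open W" "V = U \<inter> W" using V(1) unfolding openin_open by blast
  obtain B where B: "\<And>i. open (B i)" "\<And>i. c i \<in> B i" "\<And>y. (\<forall>i. y $ i \<in> B i) \<Longrightarrow> y \<in> W"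
  proof -
    have "(\<chi> i. c i) \<in> W" using W V(2) by blast
    with W(1) obtain B where "\<forall>i. open (B i) \<and> (\<chi> i. c i) $ i \<in> B i" "\<forall>y. (\<forall>i. y $ i \<in> B i) \<longrightarrow> y \<in> W"
      unfolding open_vec_def by blast
    then show thesis using that[of B] by simp
  qed
  have "\<exists>e>0. cball (c i) e \<subseteq> B i" for i using B(1,2) open_contains_cball by blast
  then obtain e where e: "\<And>i. 0 < e i" "\<And>i. cball (c i) (e i) \<subseteq> B i" by metis
  define d where "d = Min (insert 1 (range e))"
  have d: "0 < d" "d \<le> 1" "\<And>i. d \<le> e i" using e(1) by (simp_all add: d_def min.coboundedI2)
  have cW: "(\<chi> i. s i) \<in> W" if "s \<in> cell d c" for s
  proof (rule B(3), intro allI)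
    fix i
    have "s i \<in> cball (c i) (e i)" using that d(3)[of i] by (auto simp: cell_def dist_commute intro: order_trans)
    then have "s i \<in> B i" using e(2) by blast
    then show "(\<chi> i. s i) $ i \<in> B i" by simp
  qed
  have "{s. (\<chi> i. s i) \<in> U} \<inter> cell d c = node_box (\<lambda>i. A i \<inter> cball (c i) d)"
  proof (rule set_eqI)
    fix s
    have "s \<in> {s. (\<chi> i. s i) \<in> U} \<inter> cell d c \<longleftrightarrow> (\<chi> i. s i) \<in> box_of A \<and> s \<in> cell d c"
      using cW A(2) W(2) by blast
    also have "\<dots> \<longleftrightarrow> s \<in> node_box (\<lambda>i. A i \<inter> cball (c i) d)"
      by (auto simp: box_of_def cell_def node_box_def dist_commute)
    finally show "s \<in> {s. (\<chi> i. s i) \<in> U} \<inter> cell d c \<longleftrightarrow> s \<in> node_box (\<lambda>i. A i \<inter> cball (c i) d)" .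
  qed
  moreover have "no_isolated_points (A i \<inter> cball (c i) d)" for i
    using A(1) d(1) by (intro no_isolated_points_Int_open open_cball_ultra)
  ultimately show ?thesis using d(1,2) by (intro exI[of _ d] conjI exI[of _ "\<lambda>i. A i \<inter> cball (c i) d"]) auto
qed

lemma open_near_point:
  fixes x :: "'n::finite \<Rightarrow> 'k::metric_space"
  shows "open {y. \<forall>i. dist (y i) (x i) < d}"
proof -
  have "open (\<Inter>i\<in>UNIV. {y::'n \<Rightarrow> 'k. dist (y i) (x i) < d})"
    by (intro open_INT ballI open_Collect_less continuous_intros continuous_on_product_coordinates) auto
  moreover have "(\<Inter>i\<in>UNIV. {y. dist (y i) (x i) < d}) = {y. \<forall>i. dist (y i) (x i) < d}" by auto
  ultimately show ?thesis by simp
qed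

lemma cell_nhd:
  fixes x :: "'n::finite \<Rightarrow> 'k::metric_space"
  assumes "0 < d"
  shows "\<exists>V. open V \<and> x \<in> V \<and> V \<subseteq> cell d x"
  using assms open_near_point[of x d]
  by (intro exI[of _ "{y. \<forall>i. dist (y i) (x i) < d}"]) (auto simp: cell_def less_imp_le)

lemma closed_cell: "closed (cell d (x :: 'n \<Rightarrow> 'k::metric_space))"
  unfolding cell_def by (intro closed_Collect_all closed_Collect_le continuous_intros continuous_on_product_coordinates)

text \<open>A Lebesgue number for the previous radii; shrinking a polydisc that meets
  \<open>U\<close> in a box leaves a box.\<close>

lemma uniform_charts:
  fixes U :: "('k::ultrametric_field ^ 'n::finite) set"
  assumes U: "locally_cartesian U" and C: "compact C" "C \<subseteq> {s. (\<chi> i. s i) \<in> U}"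
  shows "\<exists>\<delta>>0. \<delta> \<le> 1 \<and> (\<forall>c\<in>C. \<exists>A\<in>cartesian_charts U. {s. (\<chi> i. s i) \<in> U} \<inter> cell \<delta> c = node_box A)"
proof -
  let ?U = "{s. (\<chi> i. s i) \<in> U}"
  let ?P = "\<lambda>d c. d \<le> 1 \<and> (\<exists>A. (\<forall>i. no_isolated_points (A i)) \<and> ?U \<inter> cell d c = node_box A)"
  have "\<exists>\<delta>>0. \<forall>y\<in>C. \<exists>x\<in>C. \<exists>d\<ge>\<delta>. ?P d x \<and> y \<in> cell d x"
  proof (rule ultra_lebesgue[OF C(1)])
    show "\<exists>d>0. ?P d c" if "c \<in> C" for c
      using locally_cartesian_cell[OF U] that C(2) by blast
  qed (rule cell_nhd)
  then obtain \<delta> where \<delta>: "\<delta> > 0" "\<And>y. y \<in> C \<Longrightarrow> \<exists>x\<in>C. \<exists>d\<ge>\<delta>. ?P d x \<and> y \<in> cell d x" by blast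
  define \<epsilon> where "\<epsilon> = min \<delta> 1"
  have \<epsilon>: "0 < \<epsilon>" "\<epsilon> \<le> 1" "\<epsilon> \<le> \<delta>" using \<delta>(1) by (auto simp: \<epsilon>_def)
  have "\<exists>A\<in>cartesian_charts U. ?U \<inter> cell \<epsilon> c = node_box A" if c: "c \<in> C" for c
  proof -
    obtain x d A where x: "d \<ge> \<delta>" "c \<in> cell d x" "\<And>i. no_isolated_points (A i)" "?U \<inter> cell d x = node_box A"
      using \<delta>(2)[OF c] by blast
    let ?A = "\<lambda>i. A i \<inter> cball (c i) \<epsilon>"
    have "cell \<epsilon> c \<subseteq> cell d x"
      using cell_mono[of \<epsilon> d c] cell_trans[OF _ x(2)] \<epsilon>(3) x(1) by fastforce
    then have "?U \<inter> cell \<epsilon> c = node_box A \<inter> cell \<epsilon> c" using x(4) by blast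
    also have "\<dots> = node_box ?A" by (auto simp: node_box_def cell_def dist_commute)
    finally have eq: "?U \<inter> cell \<epsilon> c = node_box ?A" .
    moreover have "no_isolated_points (?A i)" for i
      using x(3) \<epsilon>(1) by (intro no_isolated_points_Int_open open_cball_ultra)
    ultimately show ?thesis using chart_of_cell[OF \<epsilon>(1), of ?A U c] by blast
  qed
  then show ?thesis using \<epsilon> by blast
qed

section \<open>Approximation of finitely many difference quotients\<close>

text \<open>Supplies the point of the compact product that is near both tuples, as uniform
  continuity requires. Closeness to \<open>z\<close> follows from closeness to
  \<open>y\<close>.\<close>

lemma ex_near_tuple:
  fixes \<kappa> :: "'n \<Rightarrow> 'k::ultrametric_field set"
  assumes "\<And>i j. j \<le> \<beta> i \<Longrightarrow> \<exists>c\<in>\<kappa> i. dist c (y i j) \<le> d"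
    and "\<And>i j. j \<le> \<beta> i \<Longrightarrow> dist (y i j) (z i j) \<le> d"
  shows "\<exists>x\<in>multi_pow \<kappa> \<beta>. (\<forall>i. \<forall>j\<le>\<beta> i. dist (x i j) (y i j) \<le> d)
    \<and> (\<forall>i. \<forall>j\<le>\<beta> i. dist (x i j) (z i j) \<le> d)"
proof -
  define x where "x = (\<lambda>i j. SOME c. c \<in> \<kappa> i \<and> dist c (y i j) \<le> d)"
  have x: "x i j \<in> \<kappa> i \<and> dist (x i j) (y i j) \<le> d" if "j \<le> \<beta> i" for i j
    unfolding x_def by (rule someI_ex) (use assms(1)[OF that] in blast)
  let ?x = "\<lambda>i j. if j \<le> \<beta> i then x i j else undefined"
  have "?x \<in> multi_pow \<kappa> \<beta>" using x by (auto simp: multi_pow_iff)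
  moreover have "dist (x i j) (z i j) \<le> d" if "j \<le> \<beta> i" for i j
    using dist_ultra[of "x i j" "y i j" d "z i j"] x assms(2) that by blast
  ultimately show ?thesis using x by (intro bexI[of _ ?x]) simp_all
qed

context locally_convex_space
begin

text \<open>The interpolation scheme enters as an assumption about the set \<open>D\<close> of
  orders. It is discharged by \<open>tensor_newton\<close> when \<open>D\<close> is a box and by
  \<open>isotropic_newton\<close> when it is a simplex.\<close>

context
  fixes M :: "'e set" and U :: "('k ^ 'n::finite) set" and D :: "('n \<Rightarrow> nat) \<Rightarrow> bool" and N :: nat
  assumes M: "open M" "ball_submodule smul M"
    and U: "locally_cartesian U"
    and D: "\<And>\<gamma> \<gamma>'. D \<gamma> \<Longrightarrow> \<gamma>' \<le> \<gamma> \<Longrightarrow> D \<gamma>'" "\<And>\<gamma>. D \<gamma> \<Longrightarrow> (\<Sum>i\<in>UNIV. \<gamma> i) \<le> N"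
    and interpolation: "\<And>(X :: 'n \<Rightarrow> 'k set) d e f. 0 < d \<Longrightarrow> d \<le> 1 \<Longrightarrow> 0 \<le> e
      \<Longrightarrow> (\<And>i x. x \<in> X i \<Longrightarrow> infinite (X i \<inter> cball x d))
      \<Longrightarrow> (\<And>Y Y'. node_sets Y \<Longrightarrow> node_sets Y' \<Longrightarrow> (\<And>j. Y j \<union> Y' j \<subseteq> X j)
        \<Longrightarrow> dd_type Y = dd_type Y' \<Longrightarrow> D (dd_type Y)
        \<Longrightarrow> (\<And>j. Y j = Y' j \<or> same_cell d (\<lambda>_::unit. Y j \<union> Y' j))
        \<Longrightarrow> gauge_seminorm smul M (dd Y f - dd Y' f) \<le> e)
      \<Longrightarrow> \<exists>F. locally_poly_in smul UNIV d F \<and>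
        (\<forall>Y. node_sets Y \<longrightarrow> (\<forall>j. Y j \<subseteq> X j) \<longrightarrow> D (dd_type Y) \<longrightarrow>
          gauge_seminorm smul M (dd Y (\<lambda>x. f x - F x)) \<le> e)"
begin

interpretation ultrametric_seminorm smul "gauge_seminorm smul M"
  by (rule ultrametric_seminorm_gauge[OF M])

text \<open>Only finitely many orders satisfy \<open>D\<close>, so one radius \<open>d\<close> makes
  the oscillation of all corresponding difference quotients at most \<open>e\<close> near the
  compact product.\<close>

lemma box_poly_approx:
  fixes A \<kappa> :: "'n \<Rightarrow> 'k set" and f :: "('n \<Rightarrow> 'k) \<Rightarrow> 'e"
  assumes A: "\<And>i. no_isolated_points (A i)" and \<kappa>: "\<And>i. compact (\<kappa> i)" "\<And>i. \<kappa> i \<subseteq> A i"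
    and g: "\<And>\<gamma>. D \<gamma> \<Longrightarrow> continuous_on (multi_pow A \<gamma>) (g \<gamma>)"
      "\<And>\<gamma> y. D \<gamma> \<Longrightarrow> y \<in> multi_pow_distinct A \<gamma> \<Longrightarrow> g \<gamma> y = dd (tuple_nodes \<gamma> y) f"
    and e: "0 < e"
  shows "\<exists>d F. 0 < d \<and> locally_poly_in smul UNIV d F \<and>
      (\<forall>Y. node_sets Y \<longrightarrow> D (dd_type Y) \<longrightarrow> (\<forall>i. Y i \<subseteq> A i \<inter> (\<Union>c\<in>\<kappa> i. cball c d)) \<longrightarrow>
        gauge_seminorm smul M (dd Y (\<lambda>x. f x - F x)) \<le> e)"
proof -
  have finD: "finite {\<gamma>. D \<gamma>}"
    using D(2) by (intro finite_subset[OF _ finite_order_le[of N]]) auto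
  define near where "near = (\<lambda>\<gamma> \<delta>. \<forall>x\<in>multi_pow \<kappa> \<gamma>. \<forall>y\<in>multi_pow A \<gamma>. \<forall>z\<in>multi_pow A \<gamma>.
     (\<forall>i. \<forall>j\<le>\<gamma> i. dist (x i j) (y i j) \<le> \<delta>) \<longrightarrow> (\<forall>i. \<forall>j\<le>\<gamma> i. dist (x i j) (z i j) \<le> \<delta>)
     \<longrightarrow> gauge_seminorm smul M (g \<gamma> y - g \<gamma> z) \<le> e)"
  have nearD: "gauge_seminorm smul M (g \<gamma> y - g \<gamma> z) \<le> e"
    if "near \<gamma> \<delta>" "x \<in> multi_pow \<kappa> \<gamma>" "y \<in> multi_pow A \<gamma>" "z \<in> multi_pow A \<gamma>"
      "\<And>i j. j \<le> \<gamma> i \<Longrightarrow> dist (x i j) (y i j) \<le> \<delta>" "\<And>i j. j \<le> \<gamma> i \<Longrightarrow> dist (x i j) (z i j) \<le> \<delta>"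
    for \<gamma> \<delta> x y z
    using that(1)[unfolded near_def, rule_format, OF that(2-4)] that(5,6) by simp
  have "\<exists>\<delta>>0. near \<gamma> \<delta>" if "D \<gamma>" for \<gamma>
    unfolding near_def
  proof (rule uniform_continuity_near[OF g(1)[OF that] compact_multi_pow[OF \<kappa>(1)]])
    show "multi_pow \<kappa> \<gamma> \<subseteq> multi_pow A \<gamma>" using subsetD[OF \<kappa>(2)] by (auto simp: multi_pow_iff)
  qed (use e q_diff continuous_gauge[OF M] in auto)
  then obtain \<delta> where \<delta>: "\<And>\<gamma>. D \<gamma> \<Longrightarrow> 0 < \<delta> \<gamma> \<and> near \<gamma> (\<delta> \<gamma>)" by metis
  define d where "d = Min (insert 1 (\<delta> ` {\<gamma>. D \<gamma>}))"
  have d: "0 < d" "d \<le> 1" "\<And>\<gamma>. D \<gamma> \<Longrightarrow> d \<le> \<delta> \<gamma>"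
    using finD \<delta> by (auto simp: d_def)
  \<comment> \<open>With each point, \<open>X i\<close> contains all points of \<open>A i\<close>
    within distance \<open>d\<close>, so there are infinitely many nodes to choose from.\<close>
  define X where "X = (\<lambda>i. A i \<inter> (\<Union>c\<in>\<kappa> i. cball c d))"
  have "\<exists>F. locally_poly_in smul UNIV d F \<and>
    (\<forall>Y. node_sets Y \<longrightarrow> (\<forall>j. Y j \<subseteq> X j) \<longrightarrow> D (dd_type Y) \<longrightarrow> gauge_seminorm smul M (dd Y (\<lambda>x. f x - F x)) \<le> e)"
  proof (rule interpolation[OF d(1,2)])
    fix i x assume x: "x \<in> X i"
    then obtain c where c: "c \<in> \<kappa> i" "dist c x \<le> d" by (auto simp: X_def)
    have "A i \<inter> ball x d \<subseteq> X i \<inter> cball x d"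
    proof
      fix t assume t: "t \<in> A i \<inter> ball x d"
      then have "t \<in> cball x d" by auto
      moreover from this have "t \<in> cball c d" by (simp only: cball_ultra_eq[OF c(2)])
      ultimately show "t \<in> X i \<inter> cball x d" using t c(1) unfolding X_def by blast
    qed
    moreover have "infinite (A i \<inter> ball x d)" using x by (intro infinite_near A d(1)) (simp add: X_def)
    ultimately show "infinite (X i \<inter> cball x d)" using finite_subset by blast
  next
    fix Y Y' :: "'n \<Rightarrow> 'k set"
    assume Y: "node_sets Y" "node_sets Y'" "\<And>j. Y j \<union> Y' j \<subseteq> X j" "dd_type Y = dd_type Y'" "D (dd_type Y)"
      and same: "\<And>j. Y j = Y' j \<or> same_cell d (\<lambda>_::unit. Y j \<union> Y' j)"
    let ?\<gamma> = "dd_type Y" and ?y = "\<lambda>i. enum_set (Y i)" and ?z = "\<lambda>i. enum_set (Y' i)"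
    have sub: "Y i \<subseteq> A i" "Y' i \<subseteq> A i" for i using Y(3)[of i] by (auto simp: X_def)
    have y: "?y \<in> multi_pow_distinct A ?\<gamma>" "tuple_nodes ?\<gamma> ?y = Y"
      using enum_tuple[of Y A, OF Y(1) sub(1)] by auto
    have z: "?z \<in> multi_pow_distinct A ?\<gamma>" "tuple_nodes ?\<gamma> ?z = Y'"
      using enum_tuple[of Y' A, OF Y(2) sub(2)] unfolding Y(4) by auto
    have yY: "?y i j \<in> Y i" "?z i j \<in> Y' i" if "j \<le> ?\<gamma> i" for i j
      using fun_cong[OF y(2), of i] fun_cong[OF z(2), of i] that by (auto simp: tuple_nodes_def)
    have "\<exists>x\<in>multi_pow \<kappa> ?\<gamma>. (\<forall>i. \<forall>j\<le>?\<gamma> i. dist (x i j) (?y i j) \<le> d)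
      \<and> (\<forall>i. \<forall>j\<le>?\<gamma> i. dist (x i j) (?z i j) \<le> d)"
    proof (rule ex_near_tuple)
      fix i j assume j: "j \<le> ?\<gamma> i"
      show "\<exists>c\<in>\<kappa> i. dist c (?y i j) \<le> d"
      proof -
        have "?y i j \<in> X i" using yY(1)[OF j] Y(3)[of i] by blast
        then show ?thesis by (simp add: X_def)
      qed
      show "dist (?y i j) (?z i j) \<le> d"
        using same[of i]
      proof
        assume "Y i = Y' i"
        then show ?thesis using d(1) by simp
      next
        assume "same_cell d (\<lambda>_::unit. Y i \<union> Y' i)"
        then show ?thesis using yY[OF j] unfolding same_cell_def by blast
      qed
    qed
    then obtain x where x: "x \<in> multi_pow \<kappa> ?\<gamma>" "\<And>i j. j \<le> ?\<gamma> i \<Longrightarrow> dist (x i j) (?y i j) \<le> \<delta> ?\<gamma>"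
      "\<And>i j. j \<le> ?\<gamma> i \<Longrightarrow> dist (x i j) (?z i j) \<le> \<delta> ?\<gamma>"
      using order_trans[OF _ d(3)[OF Y(5)]] by metis
    have "?y \<in> multi_pow A ?\<gamma>" "?z \<in> multi_pow A ?\<gamma>" using y(1) z(1) by (simp_all add: multi_pow_distinct_iff)
    then have "gauge_seminorm smul M (g ?\<gamma> ?y - g ?\<gamma> ?z) \<le> e"
      by (rule nearD[OF conjunct2[OF \<delta>[OF Y(5)]] x(1) _ _ x(2,3)])
    then show "gauge_seminorm smul M (dd Y f - dd Y' f) \<le> e"
      unfolding g(2)[OF Y(5) y(1)] g(2)[OF Y(5) z(1)] y(2) z(2) .
  qed (use e in simp)
  then show ?thesis using d(1) unfolding X_def by blast
qed

text \<open>At tuples of distinct entries close to \<open>K\<close> the difference quotients are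
  divided differences, to which the localised approximation applies. Continuity of both extensions
  and of the gauge carries the estimate to \<open>K\<close>.\<close>

theorem poly_approx_diff_quots:
  fixes f :: "'k ^ 'n \<Rightarrow> 'e"
  assumes f: "\<And>A \<beta>. A \<in> cartesian_charts U \<Longrightarrow> D \<beta> \<Longrightarrow> \<exists>g. is_diff_quot_ext smul A \<beta> f g"
    and Q: "finite Q" "\<And>A \<beta> K. (A, \<beta>, K) \<in> Q \<Longrightarrow> A \<in> cartesian_charts U \<and> D \<beta> \<and> compact K \<and> K \<subseteq> multi_pow A \<beta>"
  shows "\<exists>P\<in>Pol smul U. \<forall>(A, \<beta>, K)\<in>Q. \<forall>x\<in>K. diff_quot_ext smul A \<beta> P x - diff_quot_ext smul A \<beta> f x \<in> M"
proof -
  let ?U = "{s. (\<chi> i. s i) \<in> U}"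
  let ?f = "\<lambda>s. f (\<chi> i. s i)"
  \<comment> \<open>All points at which the difference quotients on the sets \<open>K\<close>
    evaluate \<open>f\<close>.\<close>
  define C where "C = (\<Union>(A, \<beta>, K)\<in>Q. \<Union>j\<in>PiE UNIV (\<lambda>i. {..\<beta> i}). (\<lambda>x i. x i (j i)) ` K)"
  have C: "compact C"
    unfolding C_def
  proof (intro compact_UN Q(1), clarify, intro compact_UN)
    fix A \<beta> K assume AK: "(A, \<beta>, K) \<in> Q"
    show "finite (PiE UNIV (\<lambda>i. {..\<beta> i}))" by (intro finite_PiE) auto
    fix j :: "'n \<Rightarrow> nat"
    have "continuous_on K (\<lambda>x i. x i (j i))"
      by (intro continuous_on_coordinatewise_then_product
          continuous_on_subset[OF continuous_on_product_then_coordinatewise[OF continuous_on_product_coordinates]]) simp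
    then show "compact ((\<lambda>x i. x i (j i)) ` K)" using Q(2)[OF AK] by (intro compact_continuous_image) auto
  qed
  have CU: "C \<subseteq> ?U"
  proof
    fix c assume "c \<in> C"
    then obtain A \<beta> K j x where *: "(A, \<beta>, K) \<in> Q" "j \<in> PiE UNIV (\<lambda>i. {..\<beta> i})" "x \<in> K" "c = (\<lambda>i. x i (j i))"
      unfolding C_def by blast
    then have "(\<chi> i. c i) \<in> box_of A" using Q(2)[OF *(1)] by (auto simp: box_of_def multi_pow_iff PiE_def Pi_def)
    then show "c \<in> ?U" using Q(2)[OF *(1)] box_of_chart by blast
  qed
  obtain d where d: "0 < d" "d \<le> 1" "\<And>c. c \<in> C \<Longrightarrow> \<exists>A\<in>cartesian_charts U. ?U \<inter> cell d c = node_box A"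
    using uniform_charts[OF U C CU] by auto
  obtain A where A: "\<And>c. c \<in> C \<Longrightarrow> A c \<in> cartesian_charts U" "\<And>c. c \<in> C \<Longrightarrow> ?U \<inter> cell d c = node_box (A c)"
    using d(3) by metis
  obtain R where R: "R \<subseteq> C" "finite R" "C \<subseteq> (\<Union>r\<in>R. cell d r)"
    using totally_bounded_compact[OF C, where N = "cell d"] cell_nhd[OF d(1)] by blast
  \<comment> \<open>Any bound below 1 would do: it survives the passage to the limit and still
    forces membership in \<open>M\<close>.\<close>
  have "\<exists>\<delta> P. 0 < \<delta> \<and> poly_in smul UNIV P \<and>
      (\<forall>Y. node_sets Y \<longrightarrow> D (dd_type Y) \<longrightarrow> node_box Y \<subseteq> ?U \<inter> (\<Union>c\<in>C. cell \<delta> c) \<longrightarrow>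
        gauge_seminorm smul M (dd Y (\<lambda>x. ?f x - P x)) \<le> 1 / 2)"
  proof (rule localised_poly_approx[where D = D and N = N and A = A, OF R(2,3) d(1,2)])
    show "(0::real) < 1 / 2" by simp
    show "?U \<inter> cell d r \<subseteq> node_box (A r)" if "r \<in> R" for r using A(2) R(1) that by blast
  next
    fix r and e :: real assume r: "r \<in> R" and e: "0 < e"
    then have rC: "r \<in> C" using R(1) by blast
    note Ar = A(1)[OF rC]
    have "\<exists>g. is_diff_quot_ext smul (A r) \<gamma> f g" if "D \<gamma>" for \<gamma> by (rule f[OF Ar that])
    then obtain g where g: "\<And>\<gamma>. D \<gamma> \<Longrightarrow> is_diff_quot_ext smul (A r) \<gamma> f (g \<gamma>)" by metis
    \<comment> \<open>Cells are closed, so the part of \<open>C\<close> in a cell and its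
      projections are compact.\<close>
    let ?\<kappa> = "\<lambda>i. (\<lambda>c. c i) ` (C \<inter> cell d r)"
    have "\<exists>\<delta> F. 0 < \<delta> \<and> locally_poly_in smul UNIV \<delta> F \<and>
      (\<forall>Y. node_sets Y \<longrightarrow> D (dd_type Y) \<longrightarrow> (\<forall>i. Y i \<subseteq> A r i \<inter> (\<Union>c\<in>?\<kappa> i. cball c \<delta>)) \<longrightarrow>
        gauge_seminorm smul M (dd Y (\<lambda>x. ?f x - F x)) \<le> e)"
    proof (rule box_poly_approx[OF _ _ _ _ _ e])
      show "no_isolated_points (A r i)" for i using Ar by (simp add: cartesian_charts_def)
      show "compact (?\<kappa> i)" for i
        using C closed_cell
        by (intro compact_continuous_image compact_Int_closed continuous_on_subset[OF continuous_on_product_coordinates]) auto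
      show "?\<kappa> i \<subseteq> A r i" for i
      proof -
        have "C \<inter> cell d r \<subseteq> node_box (A r)" using CU A(2)[OF rC] by blast
        then show ?thesis by (auto simp: node_box_def)
      qed
      show "continuous_on (multi_pow (A r) \<gamma>) (g \<gamma>)" if "D \<gamma>" for \<gamma>
        using g[OF that] by (simp add: is_diff_quot_ext_def)
      show "g \<gamma> y = dd (tuple_nodes \<gamma> y) ?f" if "D \<gamma>" "y \<in> multi_pow_distinct (A r) \<gamma>" for \<gamma> y
        using g[OF that(1)] that(2) diff_quot_eq_divdiff[OF that(2), of smul f] by (simp add: is_diff_quot_ext_def)
    qed
    then show "\<exists>\<delta> F. 0 < \<delta> \<and> locally_poly_in smul UNIV \<delta> F \<and>
      (\<forall>Y. node_sets Y \<longrightarrow> D (dd_type Y) \<longrightarrow> (\<forall>i. Y i \<subseteq> A r i \<inter> (\<Union>c\<in>C \<inter> cell d r. cball (c i) \<delta>)) \<longrightarrow>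
        gauge_seminorm smul M (dd Y (\<lambda>x. ?f x - F x)) \<le> e)" by simp
  next
    fix \<delta> :: real and i :: 'n assume "0 < \<delta>"
    have "compact ((\<lambda>c. c i) ` C)"
      using C by (intro compact_continuous_image continuous_on_subset[OF continuous_on_product_coordinates]) auto
    moreover have "\<exists>V. open V \<and> x \<in> V \<and> V \<subseteq> cball x \<delta>" for x :: 'k
      using \<open>0 < \<delta>\<close> by (intro exI[of _ "ball x \<delta>"]) auto
    ultimately show "\<exists>T. finite T \<and> (\<lambda>c. c i) ` C \<subseteq> (\<Union>t\<in>T. cball t \<delta>)"
      using totally_bounded_compact[of "(\<lambda>c. c i) ` C" "\<lambda>x. cball x \<delta>"] by blast
  qed (use D in auto)
  then obtain \<delta> P where P: "0 < \<delta>" "poly_in smul UNIV P"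
    "\<And>Y. node_sets Y \<Longrightarrow> D (dd_type Y) \<Longrightarrow> node_box Y \<subseteq> ?U \<inter> (\<Union>c\<in>C. cell \<delta> c) \<Longrightarrow>
        gauge_seminorm smul M (dd Y (\<lambda>x. ?f x - P x)) \<le> 1 / 2" by blast
  let ?P = "restrict (\<lambda>x. P (\<lambda>i. x $ i)) U"
  have "diff_quot_ext smul A \<beta> ?P x - diff_quot_ext smul A \<beta> f x \<in> M" if AK: "(A, \<beta>, K) \<in> Q" and x: "x \<in> K" for A \<beta> K x
  proof -
    have A: "A \<in> cartesian_charts U" and \<beta>: "D \<beta>" and xA: "x \<in> multi_pow A \<beta>" using Q(2)[OF AK] x by auto
    have iso: "no_isolated_points (A i)" for i using A by (simp add: cartesian_charts_def)
    obtain g where g: "is_diff_quot_ext smul A \<beta> f g" using f[OF A \<beta>] by blast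
    obtain p where p: "is_diff_quot_ext smul A \<beta> ?P p" using Pol_ext[OF P(2) A] by blast
    obtain y where y: "y \<longlonglongrightarrow> x" "\<And>n. y n \<in> multi_pow_distinct A \<beta>"
      "\<And>n i j. j \<le> \<beta> i \<Longrightarrow> dist (x i j) (y n i j) \<le> \<delta>"
      using ex_distinct_seq[OF iso xA P(1)] by blast
    have yA: "y n \<in> multi_pow A \<beta>" for n using y(2)[of n] by (simp add: multi_pow_distinct_iff)
    have "gauge_seminorm smul M (g (y n) - p (y n)) \<le> 1 / 2" for n
    proof -
      have "node_box (tuple_nodes \<beta> (y n)) \<subseteq> ?U \<inter> (\<Union>c\<in>C. cell \<delta> c)"
      proof
        fix s assume s: "s \<in> node_box (tuple_nodes \<beta> (y n))"
        obtain j where j: "j \<in> PiE UNIV (\<lambda>i. {..\<beta> i})" "s = (\<lambda>i. y n i (j i))"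
          using node_box_tuple(2)[OF yA s] by blast
        have "(\<lambda>i. x i (j i)) \<in> C" unfolding C_def using AK x j(1) by blast
        moreover have "s \<in> cell \<delta> (\<lambda>i. x i (j i))"
          using y(3)[of "j _" _ n] j by (auto simp: cell_def dist_commute PiE_def Pi_def)
        ultimately show "s \<in> ?U \<inter> (\<Union>c\<in>C. cell \<delta> c)"
          using node_box_tuple(1)[OF yA s] box_of_chart[OF A] by blast
      qed
      then have "gauge_seminorm smul M (dd (tuple_nodes \<beta> (y n)) (\<lambda>x. ?f x - P x)) \<le> 1 / 2"
        using \<beta> by (intro P(3) node_sets_tuple) (simp_all add: dd_type_tuple[OF y(2)])
      moreover have "g (y n) = dd (tuple_nodes \<beta> (y n)) ?f"
        using g y(2) diff_quot_eq_divdiff[OF y(2), of smul f] by (simp add: is_diff_quot_ext_def)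
      moreover have "p (y n) = dd (tuple_nodes \<beta> (y n)) P"
        using p y(2) diff_quot_restrict[OF A y(2)] by (simp add: is_diff_quot_ext_def)
      ultimately show ?thesis by (simp add: divdiff_diff)
    qed
    moreover have "(\<lambda>n. gauge_seminorm smul M (g (y n) - p (y n))) \<longlonglongrightarrow> gauge_seminorm smul M (g x - p x)"
    proof -
      have "(\<lambda>n. g (y n)) \<longlonglongrightarrow> g x" "(\<lambda>n. p (y n)) \<longlonglongrightarrow> p x"
        using g p unfolding is_diff_quot_ext_def
        by (auto intro!: continuous_on_tendsto_compose[OF _ y(1) xA] simp: yA)
      then have "(\<lambda>n. g (y n) - p (y n)) \<longlonglongrightarrow> g x - p x" by (rule tendsto_diff)
      then show ?thesis
        by (rule continuous_on_tendsto_compose[OF continuous_gauge[OF M]]) auto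
    qed
    ultimately have "gauge_seminorm smul M (g x - p x) \<le> 1 / 2" by (intro LIMSEQ_le_const2) auto
    then have "gauge_seminorm smul M (p x - g x) < 1" by (simp add: q_minus_commute[of "p x"])
    then show ?thesis
      using gauge_less_1[OF M] unfolding diff_quot_ext_eq[OF iso g] diff_quot_ext_eq[OF iso p] by blast
  qed
  moreover have "?P \<in> Pol smul U" unfolding Pol_eq using P(2) by blast
  ultimately show ?thesis by blast
qed

end

end

section \<open>Neighbourhoods in the function spaces\<close>

text \<open>Since \<open>P\<close> is closed under supersets and finite intersections, it suffices
  to look at the subbasic sets containing \<open>f\<close>.\<close>

lemma topology_generated_by_nhd:
  assumes "openin (topology_generated_by B) W" "f \<in> W"
    and mono: "\<And>V V'. P V \<Longrightarrow> V \<subseteq> V' \<Longrightarrow> P V'" and Int: "\<And>V V'. P V \<Longrightarrow> P V' \<Longrightarrow> P (V \<inter> V')"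
    and basis: "\<And>V. V \<in> B \<Longrightarrow> f \<in> V \<Longrightarrow> P V"
  shows "P W"
proof -
  have "generate_topology_on B W" using assms(1) by (rule openin_topology_generated_by)
  then show ?thesis
    using assms(2)
  proof (induction rule: generate_topology_on.induct)
    case (UN K)
    then obtain k where k: "k \<in> K" "f \<in> k" by blast
    then have "P k" using UN.IH by blast
    then show ?case using Union_upper[OF k(1)] by (rule mono)
  qed (auto intro: Int basis)
qed

context locally_convex_space
begin

text \<open>Finitely many cosets \<open>b + M b\<close> cover \<open>L\<close>. Submodules are
  closed under addition, so \<open>(y - x) + (x - b)\<close> stays in \<open>M b\<close> and no
  smaller neighbourhood has to be chosen.\<close>

lemma compact_in_open_uniform:
  assumes L: "compact L" "L \<subseteq> W" "open W"
  shows "\<exists>M. open M \<and> ball_submodule smul M \<and> (\<forall>x\<in>L. \<forall>y. y - x \<in> M \<longrightarrow> y \<in> W)"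
proof -
  have "\<exists>M. open M \<and> ball_submodule smul M \<and> (\<forall>m\<in>M. x + m \<in> W)" if "x \<in> L" for x
  proof -
    have "open ((\<lambda>m. x + m) -` W)" by (intro open_vimage L(3) continuous_intros)
    moreover have "0 \<in> (\<lambda>m. x + m) -` W" using that L(2) by auto
    ultimately obtain M where "open M" "ball_submodule smul M" "M \<subseteq> (\<lambda>m. x + m) -` W"
      using locally_convex by blast
    then show ?thesis by blast
  qed
  then obtain M where M: "\<And>x. x \<in> L \<Longrightarrow> open (M x)" "\<And>x. x \<in> L \<Longrightarrow> ball_submodule smul (M x)"
    "\<And>x m. x \<in> L \<Longrightarrow> m \<in> M x \<Longrightarrow> x + m \<in> W" by metis
  have "\<exists>V. open V \<and> x \<in> V \<and> V \<subseteq> {y. y - x \<in> M x}" if "x \<in> L" for x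
  proof (intro exI conjI)
    have "open ((\<lambda>y. y - x) -` M x)" by (intro open_vimage M(1) that continuous_intros)
    then show "open {y. y - x \<in> M x}" by (simp add: vimage_def)
    show "x \<in> {y. y - x \<in> M x}" using M(2)[OF that] by (simp add: ball_submodule_def)
  qed simp
  from totally_bounded_compact[where N = "\<lambda>x. {y. y - x \<in> M x}", OF L(1) this]
  obtain B where B: "B \<subseteq> L" "finite B" "L \<subseteq> (\<Union>x\<in>B. {y. y - x \<in> M x})" by auto
  have "open (\<Inter>x\<in>B. M x)" using B(1,2) M(1) by (intro open_INT) auto
  moreover have "ball_submodule smul (\<Inter>x\<in>B. M x)"
    using M(2)[OF subsetD[OF B(1)]] unfolding ball_submodule_def by simp
  moreover have "y \<in> W" if x: "x \<in> L" and y: "y - x \<in> (\<Inter>x\<in>B. M x)" for x y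
  proof -
    obtain b where b: "b \<in> B" "x - b \<in> M b" using B(3) x by blast
    then have bL: "b \<in> L" using B(1) by blast
    have "(y - x) + (x - b) \<in> M b" using M(2)[OF bL] b y unfolding ball_submodule_def by blast
    then show ?thesis using M(3)[OF bL, of "y - b"] by simp
  qed
  ultimately show ?thesis by blast
qed

definition diff_quot_data ::
    "('k ^ 'n::finite) set \<Rightarrow> (('n \<Rightarrow> nat) \<Rightarrow> bool) \<Rightarrow>
      (('n \<Rightarrow> 'k set) \<times> ('n \<Rightarrow> nat) \<times> ('n \<Rightarrow> nat \<Rightarrow> 'k) set) set" where
  "diff_quot_data U D = {(A, \<beta>, K). A \<in> cartesian_charts U \<and> D \<beta> \<and> compact K \<and> K \<subseteq> multi_pow A \<beta>}"

definition diff_quot_nhd ::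
    "('k ^ 'n::finite \<Rightarrow> 'e) set \<Rightarrow> ('k ^ 'n \<Rightarrow> 'e) \<Rightarrow>
      (('n \<Rightarrow> 'k set) \<times> ('n \<Rightarrow> nat) \<times> ('n \<Rightarrow> nat \<Rightarrow> 'k) set) set \<Rightarrow> 'e set \<Rightarrow> ('k ^ 'n \<Rightarrow> 'e) set" where
  "diff_quot_nhd X f Q M =
     {h \<in> X. \<forall>(A, \<beta>, K)\<in>Q. \<forall>x\<in>K. diff_quot_ext smul A \<beta> h x - diff_quot_ext smul A \<beta> f x \<in> M}"

text \<open>Neighbourhoods for uniform convergence of finitely many difference quotients on compact
  sets. The carrier \<open>X\<close> and the set \<open>D\<close> of orders are parameters, so that
  one notion serves both families of function spaces.\<close>

definition is_diff_quot_nhd ::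
    "('k ^ 'n::finite) set \<Rightarrow> (('n \<Rightarrow> nat) \<Rightarrow> bool) \<Rightarrow> ('k ^ 'n \<Rightarrow> 'e) set \<Rightarrow> ('k ^ 'n \<Rightarrow> 'e)
      \<Rightarrow> ('k ^ 'n \<Rightarrow> 'e) set \<Rightarrow> bool" where
  "is_diff_quot_nhd U D X f V \<longleftrightarrow> (\<exists>Q M. finite Q \<and> Q \<subseteq> diff_quot_data U D \<and> open M \<and>
     ball_submodule smul M \<and> diff_quot_nhd X f Q M \<subseteq> V)"

lemma is_diff_quot_nhd_mono:
  "is_diff_quot_nhd U D X f V \<Longrightarrow> V \<subseteq> V' \<Longrightarrow> is_diff_quot_nhd U D X f V'"
  unfolding is_diff_quot_nhd_def by (meson order_trans)

lemma is_diff_quot_nhd_Int: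
  assumes "is_diff_quot_nhd U D X f V" "is_diff_quot_nhd U D X f V'"
  shows "is_diff_quot_nhd U D X f (V \<inter> V')"
proof -
  obtain Q M where Q: "finite Q" "Q \<subseteq> diff_quot_data U D" "open M" "ball_submodule smul M" "diff_quot_nhd X f Q M \<subseteq> V"
    using assms(1) unfolding is_diff_quot_nhd_def by blast
  obtain Q' M' where Q': "finite Q'" "Q' \<subseteq> diff_quot_data U D" "open M'" "ball_submodule smul M'" "diff_quot_nhd X f Q' M' \<subseteq> V'"
    using assms(2) unfolding is_diff_quot_nhd_def by blast
  have "ball_submodule smul (M \<inter> M')" using Q(4) Q'(4) unfolding ball_submodule_def by blast
  moreover have "diff_quot_nhd X f (Q \<union> Q') (M \<inter> M') \<subseteq> diff_quot_nhd X f Q M \<inter> diff_quot_nhd X f Q' M'"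
    unfolding diff_quot_nhd_def by blast
  ultimately show ?thesis
    unfolding is_diff_quot_nhd_def using Q Q'
    by (intro exI[of _ "Q \<union> Q'"] exI[of _ "M \<inter> M'"]) (auto intro: open_Int)
qed

lemma ex_open_ball_submodule: "\<exists>M. open M \<and> ball_submodule smul M"
  using locally_convex[OF open_UNIV] by blast

lemma is_diff_quot_nhd_carrier: "is_diff_quot_nhd U D X f X"
proof -
  obtain M where "open M" "ball_submodule smul M" using ex_open_ball_submodule by blast
  then show ?thesis
    unfolding is_diff_quot_nhd_def diff_quot_nhd_def by (intro exI[of _ "{}"] exI[of _ M]) auto
qed

text \<open>The initial topology and the compact-open topologies on its targets are both given by
  subbases, so the neighbourhood principle is applied twice, the second time to preimages.\<close>

lemma C_alpha_nhd:
  fixes U :: "('k ^ 'n::finite) set"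
  assumes W: "openin (C_alpha_topology smul U \<alpha>) W" "f \<in> W"
  shows "is_diff_quot_nhd U (\<lambda>\<beta>. \<forall>i. enat (\<beta> i) \<le> \<alpha> i) (C_alpha smul U \<alpha>) f W"
    (is "?P W")
  using W(1)[unfolded C_alpha_topology_def initial_topology_def] W(2)
proof (rule topology_generated_by_nhd)
  fix V assume V: "V \<in> insert (C_alpha smul U \<alpha>)
    {{x \<in> C_alpha smul U \<alpha>. (case i of (A, \<beta>) \<Rightarrow> diff_quot_ext smul A \<beta>) x \<in> W} |i W.
     i \<in> cartesian_charts U \<times> {\<beta>. \<forall>i. enat (\<beta> i) \<le> \<alpha> i} \<and>
     openin (case i of (A, \<beta>) \<Rightarrow> compact_open_topology (multi_pow A \<beta>)) W}" "f \<in> V"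
  show "?P V"
  proof (cases "V = C_alpha smul U \<alpha>")
    case True
    then show ?thesis using is_diff_quot_nhd_carrier by simp
  next
    case False
    then obtain A \<beta> G where A: "A \<in> cartesian_charts U" "\<forall>i. enat (\<beta> i) \<le> \<alpha> i"
      and G: "openin (compact_open_topology (multi_pow A \<beta>)) G"
      and VG: "V = {x \<in> C_alpha smul U \<alpha>. diff_quot_ext smul A \<beta> x \<in> G}"
      using V(1) by auto
    have fG: "diff_quot_ext smul A \<beta> f \<in> G" and fC: "f \<in> C_alpha smul U \<alpha>" using V(2) VG by auto
    show ?thesis
      unfolding VG
      using G[unfolded compact_open_topology_def] fG
    proof (rule topology_generated_by_nhd)
      fix S S' assume "?P {x \<in> C_alpha smul U \<alpha>. diff_quot_ext smul A \<beta> x \<in> S}" "S \<subseteq> S'"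
      then show "?P {x \<in> C_alpha smul U \<alpha>. diff_quot_ext smul A \<beta> x \<in> S'}"
        by (elim is_diff_quot_nhd_mono) auto
    next
      fix S S' assume "?P {x \<in> C_alpha smul U \<alpha>. diff_quot_ext smul A \<beta> x \<in> S}"
        "?P {x \<in> C_alpha smul U \<alpha>. diff_quot_ext smul A \<beta> x \<in> S'}"
      from is_diff_quot_nhd_Int[OF this]
      show "?P {x \<in> C_alpha smul U \<alpha>. diff_quot_ext smul A \<beta> x \<in> S \<inter> S'}"
        by (elim is_diff_quot_nhd_mono) auto
    next
      fix S assume S: "S \<in> {{g \<in> extensional (multi_pow A \<beta>). continuous_on (multi_pow A \<beta>) g \<and> g ` K \<subseteq> W} |K W.
          compact K \<and> K \<subseteq> multi_pow A \<beta> \<and> open W}" "diff_quot_ext smul A \<beta> f \<in> S"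
      then obtain K W where K: "compact K" "K \<subseteq> multi_pow A \<beta>" "open W"
        and SW: "S = {g \<in> extensional (multi_pow A \<beta>). continuous_on (multi_pow A \<beta>) g \<and> g ` K \<subseteq> W}" by blast
      let ?f = "diff_quot_ext smul A \<beta> f"
      have "compact (?f ` K)"
        using S(2) SW K by (intro compact_continuous_image) (auto intro: continuous_on_subset)
      moreover have "?f ` K \<subseteq> W" using S(2) SW by blast
      ultimately obtain M where M: "open M" "ball_submodule smul M" "\<forall>x\<in>?f ` K. \<forall>y. y - x \<in> M \<longrightarrow> y \<in> W"
        using compact_in_open_uniform[of "?f ` K" W] K(3) by auto
      have "diff_quot_nhd (C_alpha smul U \<alpha>) f {(A, \<beta>, K)} M
        \<subseteq> {x \<in> C_alpha smul U \<alpha>. diff_quot_ext smul A \<beta> x \<in> S}"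
      proof
        fix h assume h: "h \<in> diff_quot_nhd (C_alpha smul U \<alpha>) f {(A, \<beta>, K)} M"
        then have hC: "h \<in> C_alpha smul U \<alpha>" by (simp add: diff_quot_nhd_def)
        \<comment> \<open>Subbasic sets of the compact-open topology contain only continuous
          extensional maps; identifying the chosen extension with \<open>g\<close> provides both
          properties.\<close>
        then obtain g where g: "is_diff_quot_ext smul A \<beta> h g" using A unfolding C_alpha_def by blast
        have iso: "\<And>i. no_isolated_points (A i)" using A(1) by (simp add: cartesian_charts_def)
        have "diff_quot_ext smul A \<beta> h = g" using diff_quot_ext_eq[of A, OF iso g] .
        moreover have "diff_quot_ext smul A \<beta> h ` K \<subseteq> W"
          using h M(3) unfolding diff_quot_nhd_def by blast
        ultimately show "h \<in> {x \<in> C_alpha smul U \<alpha>. diff_quot_ext smul A \<beta> x \<in> S}"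
          using g hC unfolding SW is_diff_quot_ext_def by simp
      qed
      moreover have "{(A, \<beta>, K)} \<subseteq> diff_quot_data U (\<lambda>\<beta>. \<forall>i. enat (\<beta> i) \<le> \<alpha> i)"
        using A K by (simp add: diff_quot_data_def)
      ultimately show "?P {x \<in> C_alpha smul U \<alpha>. diff_quot_ext smul A \<beta> x \<in> S}"
        unfolding is_diff_quot_nhd_def using M(1,2) by blast
    qed
  qed
qed (fact is_diff_quot_nhd_mono is_diff_quot_nhd_Int)+

lemma C_r_nhd:
  fixes U :: "('k ^ 'n::finite) set"
  assumes W: "openin (C_r_topology smul U r) W" "f \<in> W"
  shows "is_diff_quot_nhd U (\<lambda>\<beta>. enat (\<Sum>i\<in>UNIV. \<beta> i) \<le> r) (C_r smul U r) f W"
    (is "?P W")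
  using W(1)[unfolded C_r_topology_def initial_topology_def] W(2)
proof (rule topology_generated_by_nhd)
  fix V assume V: "V \<in> insert (C_r smul U r) {{x \<in> C_r smul U r. x \<in> W} |i W.
      i \<in> {\<alpha>. enat (\<Sum>i\<in>UNIV. \<alpha> i) \<le> r} \<and> openin (C_alpha_topology smul U (\<lambda>ia. enat (i ia))) W}" "f \<in> V"
  show "?P V"
  proof (cases "V = C_r smul U r")
    case True
    then show ?thesis using is_diff_quot_nhd_carrier by simp
  next
    case False
    then obtain \<alpha> G where \<alpha>: "enat (\<Sum>i\<in>UNIV. \<alpha> i) \<le> r"
      and G: "openin (C_alpha_topology smul U (\<lambda>i. enat (\<alpha> i))) G" and VG: "V = {x \<in> C_r smul U r. x \<in> G}"
      using V(1) by blast
    obtain Q M where Q: "finite Q" "Q \<subseteq> diff_quot_data U (\<lambda>\<beta>. \<forall>i. enat (\<beta> i) \<le> enat (\<alpha> i))"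
      "open M" "ball_submodule smul M" "diff_quot_nhd (C_alpha smul U (\<lambda>i. enat (\<alpha> i))) f Q M \<subseteq> G"
    proof -
      have "f \<in> G" using V(2) VG by simp
      from C_alpha_nhd[OF G this] show thesis
        unfolding is_diff_quot_nhd_def using that by (elim exE conjE)
    qed
    have "enat (\<Sum>i\<in>UNIV. \<beta> i) \<le> r" if "\<forall>i. enat (\<beta> i) \<le> enat (\<alpha> i)" for \<beta> :: "'n \<Rightarrow> nat"
    proof -
      have "(\<Sum>i\<in>UNIV. \<beta> i) \<le> (\<Sum>i\<in>UNIV. \<alpha> i)" using that by (intro sum_mono) simp
      then show ?thesis using \<alpha> by (meson enat_ord_simps(1) order_trans)
    qed
    then have "Q \<subseteq> diff_quot_data U (\<lambda>\<beta>. enat (\<Sum>i\<in>UNIV. \<beta> i) \<le> r)"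
      using Q(2) unfolding diff_quot_data_def by blast
    moreover have "C_r smul U r \<subseteq> C_alpha smul U (\<lambda>i. enat (\<alpha> i))"
      using \<alpha> unfolding C_r_def by blast
    then have "diff_quot_nhd (C_r smul U r) f Q M \<subseteq> V"
      using Q(5) unfolding VG diff_quot_nhd_def by blast
    ultimately show ?thesis unfolding is_diff_quot_nhd_def using Q by blast
  qed
qed (fact is_diff_quot_nhd_mono is_diff_quot_nhd_Int)+

section \<open>Density of polynomial functions\<close>

lemma zero_in_Pol: "restrict (\<lambda>x. 0) U \<in> Pol smul U"
  unfolding Pol_eq by (intro CollectI exI[of _ "\<lambda>x. 0"]) (simp add: poly_in_const)

text \<open>\<alpha> may have infinite entries, but only finitely many orders occur in
  \<open>Q\<close>. Their componentwise maximum is a finite multi-index below \<alpha> and spans the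
  box of orders to be controlled.\<close>

lemma Pol_nhd_box:
  fixes U :: "('k ^ 'n::finite) set"
  assumes U: "locally_cartesian U" and M: "open M" "ball_submodule smul M"
    and f: "f \<in> C_alpha smul U \<alpha>" and Q: "finite Q" "Q \<subseteq> diff_quot_data U (\<lambda>\<beta>. \<forall>i. enat (\<beta> i) \<le> \<alpha> i)"
  shows "\<exists>P\<in>Pol smul U. P \<in> diff_quot_nhd (C_alpha smul U \<alpha>) f Q M"
\<comment> \<open>The maximum over \<open>Q\<close> is meaningful only for nonempty
  \<open>Q\<close>.\<close>
proof (cases "Q = {}")
  case True
  then show ?thesis using zero_in_Pol[of U] Pol_subset_C_alpha True by (auto simp: diff_quot_nhd_def)
next
  case False
  define \<beta>0 where "\<beta>0 = (\<lambda>i. Max ((\<lambda>(A, \<beta>, K). \<beta> i) ` Q))"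
  have \<beta>0: "\<beta> \<le> \<beta>0" if "(A, \<beta>, K) \<in> Q" for A \<beta> K
    unfolding le_fun_def \<beta>0_def using that Q(1) by (auto intro!: Max_ge rev_image_eqI)
  have \<beta>0\<alpha>: "enat (\<beta>0 i) \<le> \<alpha> i" for i
  proof -
    have "\<beta>0 i \<in> (\<lambda>(A, \<beta>, K). \<beta> i) ` Q" unfolding \<beta>0_def using Q(1) False by (intro Max_in) auto
    then show ?thesis using Q(2) by (auto simp: diff_quot_data_def)
  qed
  interpret ultrametric_seminorm smul "gauge_seminorm smul M" by (rule ultrametric_seminorm_gauge[OF M])
  have "\<exists>P\<in>Pol smul U. \<forall>(A, \<beta>, K)\<in>Q. \<forall>x\<in>K. diff_quot_ext smul A \<beta> P x - diff_quot_ext smul A \<beta> f x \<in> M"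
  proof (rule poly_approx_diff_quots[OF M U, where D = "\<lambda>\<gamma>. \<gamma> \<le> \<beta>0" and N = "\<Sum>i\<in>UNIV. \<beta>0 i"])
    show "\<exists>g. is_diff_quot_ext smul A \<beta> f g" if "A \<in> cartesian_charts U" "\<beta> \<le> \<beta>0" for A \<beta>
    proof -
      have "enat (\<beta> i) \<le> \<alpha> i" for i using that(2) \<beta>0\<alpha>[of i] by (meson enat_ord_simps(1) le_fun_def order_trans)
      then show ?thesis using f that(1) unfolding C_alpha_def by blast
    qed
    show "A \<in> cartesian_charts U \<and> \<beta> \<le> \<beta>0 \<and> compact K \<and> K \<subseteq> multi_pow A \<beta>" if "(A, \<beta>, K) \<in> Q" for A \<beta> K
      using \<beta>0[OF that] Q(2) that by (auto simp: diff_quot_data_def)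
    show "(\<Sum>i\<in>UNIV. \<gamma> i) \<le> (\<Sum>i\<in>UNIV. \<beta>0 i)" if "\<gamma> \<le> \<beta>0" for \<gamma>
      using that by (intro sum_mono) (simp add: le_fun_def)
  qed (fact tensor_newton Q(1) | erule (1) order_trans[rotated])+
  then show ?thesis using Pol_subset_C_alpha unfolding diff_quot_nhd_def by blast
qed

text \<open>The largest total order occurring in \<open>Q\<close> is finite even if \<open>r\<close>
  is infinite; it determines the simplex of orders to be controlled.\<close>

lemma Pol_nhd_simplex:
  fixes U :: "('k ^ 'n::finite) set"
  assumes U: "locally_cartesian U" and M: "open M" "ball_submodule smul M"
    and f: "f \<in> C_r smul U r" and Q: "finite Q" "Q \<subseteq> diff_quot_data U (\<lambda>\<beta>. enat (\<Sum>i\<in>UNIV. \<beta> i) \<le> r)"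
  shows "\<exists>P\<in>Pol smul U. P \<in> diff_quot_nhd (C_r smul U r) f Q M"
proof (cases "Q = {}")
  case True
  then show ?thesis using zero_in_Pol[of U] Pol_subset_C_r True by (auto simp: diff_quot_nhd_def)
next
  case False
  define N where "N = Max ((\<lambda>(A, \<beta>, K). \<Sum>i\<in>UNIV. \<beta> i) ` Q)"
  have N: "(\<Sum>i\<in>UNIV. \<beta> i) \<le> N" if "(A, \<beta>, K) \<in> Q" for A \<beta> K
    unfolding N_def using that Q(1) by (auto intro!: Max_ge rev_image_eqI)
  have Nr: "enat N \<le> r"
  proof -
    have "N \<in> (\<lambda>(A, \<beta>, K). \<Sum>i\<in>UNIV. \<beta> i) ` Q" unfolding N_def using Q(1) False by (intro Max_in) auto
    then show ?thesis using Q(2) by (auto simp: diff_quot_data_def)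
  qed
  interpret ultrametric_seminorm smul "gauge_seminorm smul M" by (rule ultrametric_seminorm_gauge[OF M])
  have "\<exists>P\<in>Pol smul U. \<forall>(A, \<beta>, K)\<in>Q. \<forall>x\<in>K. diff_quot_ext smul A \<beta> P x - diff_quot_ext smul A \<beta> f x \<in> M"
  proof (rule poly_approx_diff_quots[OF M U, where D = "\<lambda>\<gamma>. (\<Sum>i\<in>UNIV. \<gamma> i) \<le> N" and N = N])
    show "\<exists>g. is_diff_quot_ext smul A \<beta> f g" if "A \<in> cartesian_charts U" "(\<Sum>i\<in>UNIV. \<beta> i) \<le> N" for A \<beta>
    proof -
      have "enat (\<Sum>i\<in>UNIV. \<beta> i) \<le> r" using that(2) Nr by (meson enat_ord_simps(1) order_trans)
      then have "f \<in> C_alpha smul U (\<lambda>i. enat (\<beta> i))" using f unfolding C_r_def by blast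
      then show ?thesis using that(1) unfolding C_alpha_def by blast
    qed
    show "A \<in> cartesian_charts U \<and> (\<Sum>i\<in>UNIV. \<beta> i) \<le> N \<and> compact K \<and> K \<subseteq> multi_pow A \<beta>"
      if "(A, \<beta>, K) \<in> Q" for A \<beta> K
      using N[OF that] Q(2) that by (auto simp: diff_quot_data_def)
    show "(\<Sum>i\<in>UNIV. \<gamma>' i) \<le> N" if "(\<Sum>i\<in>UNIV. \<gamma> i) \<le> N" "\<gamma>' \<le> \<gamma>" for \<gamma> \<gamma>' :: "'n \<Rightarrow> nat"
      using that(1) sum_mono[of UNIV \<gamma>' \<gamma>] that(2) by (simp add: le_fun_def)
  qed (fact isotropic_newton Q(1) | assumption)+
  then show ?thesis using Pol_subset_C_r unfolding diff_quot_nhd_def by blast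
qed

end

lemma dense_subset_ofI:
  assumes "S \<subseteq> topspace T" "\<And>f W. openin T W \<Longrightarrow> f \<in> W \<Longrightarrow> \<exists>p\<in>S. p \<in> W"
  shows "dense_subset_of T S"
  unfolding dense_subset_of_def closure_of_def using assms by blast

theorem theoremE:
  fixes smul :: "'k::complete_ultrametric_field \<Rightarrow> 'e::{topological_ab_group_add,t2_space} \<Rightarrow> 'e"
    and U :: "('k ^ 'n::finite) set"
  assumes "locally_convex_space smul"
    and "locally closed U"
    and "locally_cartesian U"
  shows "(\<forall>r::enat. dense_subset_of (C_r_topology smul U r) (Pol smul U)) \<and>
         (\<forall>\<alpha>::'n \<Rightarrow> enat. dense_subset_of (C_alpha_topology smul U \<alpha>) (Pol smul U))"
proof (intro conjI allI)
  interpret locally_convex_space smul by fact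
  show "dense_subset_of (C_r_topology smul U r) (Pol smul U)" for r
  proof (rule dense_subset_ofI)
    show "Pol smul U \<subseteq> topspace (C_r_topology smul U r)"
      using Pol_subset_C_r by (simp add: topspace_C_r_topology)
    fix f W assume W: "openin (C_r_topology smul U r) W" "f \<in> W"
    then have f: "f \<in> C_r smul U r" using openin_subset[OF W(1)] by (auto simp: topspace_C_r_topology)
    from C_r_nhd[OF W] obtain Q M where Q: "finite Q" "Q \<subseteq> diff_quot_data U (\<lambda>\<beta>. enat (\<Sum>i\<in>UNIV. \<beta> i) \<le> r)"
      and M: "open M" "ball_submodule smul M" and sub: "diff_quot_nhd (C_r smul U r) f Q M \<subseteq> W"
      unfolding is_diff_quot_nhd_def by (elim exE conjE)
    from Pol_nhd_simplex[OF assms(3) M f Q] sub show "\<exists>p\<in>Pol smul U. p \<in> W" by blast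
  qed
  show "dense_subset_of (C_alpha_topology smul U \<alpha>) (Pol smul U)" for \<alpha>
  proof (rule dense_subset_ofI)
    show "Pol smul U \<subseteq> topspace (C_alpha_topology smul U \<alpha>)"
      using Pol_subset_C_alpha by (simp add: topspace_C_alpha_topology)
    fix f W assume W: "openin (C_alpha_topology smul U \<alpha>) W" "f \<in> W"
    then have f: "f \<in> C_alpha smul U \<alpha>" using openin_subset[OF W(1)] by (auto simp: topspace_C_alpha_topology)
    from C_alpha_nhd[OF W] obtain Q M where Q: "finite Q" "Q \<subseteq> diff_quot_data U (\<lambda>\<beta>. \<forall>i. enat (\<beta> i) \<le> \<alpha> i)"
      and M: "open M" "ball_submodule smul M" and sub: "diff_quot_nhd (C_alpha smul U \<alpha>) f Q M \<subseteq> W"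
      unfolding is_diff_quot_nhd_def by (elim exE conjE)
    from Pol_nhd_box[OF assms(3) M f Q] sub show "\<exists>p\<in>Pol smul U. p \<in> W" by blast
  qed
qed
end
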